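(* If $M$ is a non-horizontal submanifold (of codimension $p$) of the Heisenberg group $\mathbb H^n$, then the $\mu$-measure on $M$ is a constant multiple of the spherical Hausdorff measure on $M$ (of dimension $2n+2-p$, with respect to the Carnot–Carathéodory distance $\rho$).
   Context: Heisenberg group: $\mathbb H^n$ is $\mathbb R^{2n+1}$ (exponential coordinates) with group law $(x\cdot y)^k=x^k+y^k$ for $k\le 2n$ and $(x\cdot y)^{2n+1}=x^{2n+1}+y^{2n+1}+\frac12\sum_{i=1}^n(x^iy^{i+n}-y^ix^{i+n})$. Left-invariant vector fields: $e_i=\partial_{x^i}-\frac12x^{i+n}\partial_{x^{2n+1}}$, $e_{i+n}=\partial_{x^{i+n}}+\frac12x^i\partial_{x^{2n+1}}$ ($1\le i\le n$), $e_{2n+1}=\partial_{x^{2n+1}}$, with $[e_i,e_{i+n}]=e_{2n+1}$ and other brackets zero. $D$ is the distribution spanned by $e_1,\dots,e_{2n}$, and $h$ is the left-invariant Riemannian metric for which $e_1,\dots,e_{2n+1}$ are orthonormal. $\rho$ is the Carnot–Carathéodory distance: the infimum of the lengths of curves tangent to $D$ joining two points. A submanifold $M$ of codimension $p$ is non-horizontal if $TM+D=T\mathbb H^n$ along $M$. The measure $\mu$: let $\deg e_k=1$ for $k\le2n$, $\deg e_{2n+1}=2$, and let the degree of $e_{k_1}\wedge\cdots\wedge e_{k_s}$ be the sum of the degrees. With $Q=2n+2$ and $d=Q-p$, let $\tau_M(x)$ be an $h$-unit tangent $(2n+1-p)$-vector to $M$ at $x$ and $\tau_M^d(x)$ its component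 of degree $d$ in the basis $e_{k_1}\wedge\cdots\wedge e_{k_{2n+1-p}}$. Then $d\mu(x)=|\tau_M^d(x)|\,d\mathrm{vol}_h(x)$, where $|\cdot|$ is the norm induced by $h$ and $d\mathrm{vol}_h$ is the Riemannian volume on $M$ induced by $h$. The spherical Hausdorff measure is the $d$-dimensional spherical Hausdorff measure $S^d_\rho$ built from covers by $\rho$-balls. *)

theory Defs
  imports "HOL-Analysis.Analysis"
begin

text \<open>
  The coordinates of the Heisenberg group of dimension \<open>2n+1\<close> are indexed by \<open>'n + 'n + unit\<close> with
  \<open>n = CARD('n)\<close>: for \<open>i\<close> ranging over \<open>'n\<close>, the indices \<open>iX i\<close>, \<open>iY i\<close> and \<open>iT\<close> play the roles
  of \<open>i\<close>, \<open>i + n\<close> and \<open>2n + 1\<close>.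
\<close>

type_synonym 'n idx = "'n + 'n + unit"
type_synonym 'n heis = "real ^ ('n + 'n + unit)"

abbreviation iX :: "'n \<Rightarrow> 'n idx" where "iX i \<equiv> Inl i"
abbreviation iY :: "'n \<Rightarrow> 'n idx" where "iY i \<equiv> Inr (Inl i)"
abbreviation iT :: "'n idx" where "iT \<equiv> Inr (Inr ())"

definition heis_mult :: "'n::finite heis \<Rightarrow> 'n heis \<Rightarrow> 'n heis" where
  "heis_mult x y = x + y +
     (1/2 * (\<Sum>i\<in>UNIV. x $ iX i * y $ iY i - y $ iX i * x $ iY i)) *\<^sub>R axis iT 1"

fun frame :: "'n::finite idx \<Rightarrow> 'n heis \<Rightarrow> 'n heis" where
  "frame (Inl i) x = axis (iX i) 1 - (1/2 * x $ iY i) *\<^sub>R axis iT 1"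
| "frame (Inr (Inl i)) x = axis (iY i) 1 + (1/2 * x $ iX i) *\<^sub>R axis iT 1"
| "frame (Inr (Inr u)) x = axis iT 1"

definition horizontal :: "'n::finite heis \<Rightarrow> 'n heis set" where
  "horizontal x = span {frame k x |k. k \<noteq> iT}"

text \<open>
  \<open>coframe x v k\<close> is the coefficient of \<open>frame k x\<close> in the expansion of the tangent vector \<open>v\<close> at
  \<open>x\<close>; see \<open>frame_expansion\<close> and \<open>coframe_frame\<close> below.
\<close>

fun coframe :: "'n::finite heis \<Rightarrow> 'n heis \<Rightarrow> 'n idx \<Rightarrow> real" where
  "coframe x v (Inl i) = v $ iX i"
| "coframe x v (Inr (Inl i)) = v $ iY i"
| "coframe x v (Inr (Inr u)) =
     v $ iT + 1/2 * (\<Sum>i\<in>UNIV. x $ iY i * v $ iX i - x $ iX i * v $ iY i)"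

definition hmetric :: "'n::finite heis \<Rightarrow> 'n heis \<Rightarrow> 'n heis \<Rightarrow> real" where
  "hmetric x v w = (\<Sum>k\<in>UNIV. coframe x v k * coframe x w k)"

lemma idx_cases:
  fixes k :: "'n idx"
  obtains i where "k = iX i" | i where "k = iY i" | "k = iT"
  by (metis (full_types) old.unit.exhaust sumE)

lemma sum_idx:
  fixes f :: "'n::finite idx \<Rightarrow> 'a::comm_monoid_add"
  shows "(\<Sum>k\<in>UNIV. f k) = (\<Sum>i\<in>UNIV. f (iX i)) + ((\<Sum>i\<in>UNIV. f (iY i)) + f iT)"
proof -
  have *: "(\<Sum>k\<in>UNIV. g k) = (\<Sum>i\<in>UNIV. g (Inl i)) + (\<Sum>i\<in>UNIV. g (Inr i))"
    for g :: "'b::finite + 'c::finite \<Rightarrow> 'a"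
    unfolding UNIV_Plus_UNIV[symmetric] by (subst sum.Plus) (auto simp: comp_def)
  show ?thesis
    unfolding *[of f] *[of "\<lambda>k. f (Inr k)"] by (simp add: UNIV_unit)
qed

lemmas if_mult = if_distrib[where f = "(*) c" for c] if_distrib[where f = "\<lambda>z. z * c" for c]

lemma frame_expansion: "v = (\<Sum>k\<in>UNIV. coframe x v k *\<^sub>R frame k x)"
proof (rule vec_eq_iff[THEN iffD2], rule allI)
  fix j :: "'a idx"
  show "v $ j = (\<Sum>k\<in>UNIV. coframe x v k *\<^sub>R frame k x) $ j"
    by (cases j rule: idx_cases)
      (simp_all add: sum_idx axis_def if_mult sum_distrib_left sum_subtractf sum_negf
        algebra_simps cong: if_cong)
qed

lemma coframe_frame: "coframe x (frame j x) k = (if k = j then 1 else 0)"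
  by (cases j rule: idx_cases; cases k rule: idx_cases)
    (auto simp: axis_def if_mult sum_subtractf sum_negf cong: if_cong)

lemma hmetric_orthonormal: "hmetric x (frame j x) (frame k x) = (if j = k then 1 else 0)"
  by (simp add: hmetric_def coframe_frame if_mult cong: if_cong)

lemma frame_left_invariant:
  assumes "(heis_mult x has_derivative L) (at y)"
  shows "L (frame k y) = frame k (heis_mult x y)"
proof -
  let ?L = "\<lambda>v. v + (1/2 * (\<Sum>i\<in>UNIV. x $ iX i * v $ iY i - v $ iX i * x $ iY i)) *\<^sub>R axis iT 1"
  have "((\<lambda>z. x + ?L z) has_derivative ?L) (at y)"
    by (auto intro!: derivative_eq_intros bounded_linear.has_derivative[OF bounded_linear_vec_nth])
  then have "(heis_mult x has_derivative ?L) (at y)"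
    by (simp add: heis_mult_def[abs_def] add.assoc)
  then have L: "L = ?L"
    using assms has_derivative_unique by blast
  show ?thesis
    by (cases k rule: idx_cases)
      (auto simp: L heis_mult_def vec_eq_iff axis_def if_mult sum_subtractf sum_negf
        algebra_simps cong: if_cong)
qed

definition horizontal_path :: "(real \<Rightarrow> 'n::finite heis) \<Rightarrow> bool" where
  "horizontal_path \<gamma> \<longleftrightarrow> valid_path \<gamma> \<and>
     (\<forall>t\<in>{0<..<1}. \<gamma> differentiable (at t) \<longrightarrow>
        vector_derivative \<gamma> (at t) \<in> horizontal (\<gamma> t))"

text \<open>
  Near the finitely many exceptional points of a \<^const>\<open>valid_path\<close> the derivative need not be
  bounded, so the length can be infinite; hence the values in \<^typ>\<open>ennreal\<close> (with a gauge integral,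
  a path of infinite length would get length 0).
\<close>

definition path_len :: "(real \<Rightarrow> 'n::finite heis) \<Rightarrow> ennreal" where
  "path_len \<gamma> = (\<integral>\<^sup>+t\<in>{0..1}. ennreal (sqrt (hmetric (\<gamma> t)
     (vector_derivative \<gamma> (at t)) (vector_derivative \<gamma> (at t)))) \<partial>lborel)"

definition cc_dist :: "'n::finite heis \<Rightarrow> 'n heis \<Rightarrow> ennreal" where
  "cc_dist x y =
     (INF \<gamma>\<in>{\<gamma>. horizontal_path \<gamma> \<and> pathstart \<gamma> = x \<and> pathfinish \<gamma> = y}. path_len \<gamma>)"

text \<open>
  The spherical Hausdorff measure of a distance \<open>\<rho>\<close>, normalized so that a ball of radius \<open>r\<close> in a
  cover contributes \<open>r ^ d\<close>.
\<close>

definition spherical_content ::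
    "('a \<Rightarrow> 'a \<Rightarrow> ennreal) \<Rightarrow> nat \<Rightarrow> real \<Rightarrow> 'a set \<Rightarrow> ennreal" where
  "spherical_content \<rho> d \<delta> A =
     (INF (c, r)\<in>{(c :: nat \<Rightarrow> 'a, r :: nat \<Rightarrow> real).
          (\<forall>i. 0 < r i \<and> r i \<le> \<delta>) \<and> A \<subseteq> (\<Union>i. {y. \<rho> (c i) y \<le> ennreal (r i)})}.
        \<Sum>i. ennreal (r i ^ d))"

definition spherical_hausdorff ::
    "('a \<Rightarrow> 'a \<Rightarrow> ennreal) \<Rightarrow> nat \<Rightarrow> 'a set \<Rightarrow> ennreal" where
  "spherical_hausdorff \<rho> d A = (SUP \<delta>\<in>{0<..}. spherical_content \<rho> d \<delta> A)"

primrec k_smooth_on ::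
    "nat \<Rightarrow> 'a::euclidean_space set \<Rightarrow> ('a \<Rightarrow> 'b::real_normed_vector) \<Rightarrow> bool" where
  "k_smooth_on 0 U f \<longleftrightarrow> continuous_on U f"
| "k_smooth_on (Suc k) U f \<longleftrightarrow> f differentiable_on U \<and>
     (\<forall>b\<in>Basis. k_smooth_on k U (\<lambda>x. frechet_derivative f (at x) b))"

text \<open>Only meaningful for open \<open>U\<close>.\<close>

definition smooth_on ::
    "'a::euclidean_space set \<Rightarrow> ('a \<Rightarrow> 'b::real_normed_vector) \<Rightarrow> bool" where
  "smooth_on U f \<longleftrightarrow> (\<forall>k. k_smooth_on k U f)"

definition local_param ::
    "'n::finite heis set \<Rightarrow> (real ^ 'm::finite) set \<Rightarrow> (real ^ 'm \<Rightarrow> 'n heis) \<Rightarrow> bool" where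
  "local_param M U \<phi> \<longleftrightarrow> open U \<and> smooth_on U \<phi> \<and>
     (\<forall>u\<in>U. inj (frechet_derivative \<phi> (at u))) \<and>
     (\<exists>W. open W \<and> \<phi> ` U = M \<inter> W) \<and> (\<exists>\<psi>. homeomorphism U (\<phi> ` U) \<phi> \<psi>)"

text \<open>Embedded smooth submanifolds without boundary, of dimension \<open>CARD('m)\<close>.\<close>

definition submanifold :: "'m::finite itself \<Rightarrow> 'n::finite heis set \<Rightarrow> bool" where
  "submanifold _ M \<longleftrightarrow> (\<forall>x\<in>M. \<exists>U (\<phi> :: real ^ 'm \<Rightarrow> 'n heis). local_param M U \<phi> \<and> x \<in> \<phi> ` U)"

definition tangent_space :: "'n::finite heis set \<Rightarrow> 'n heis \<Rightarrow> 'n heis set" where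
  "tangent_space M x = {v. \<exists>\<epsilon>>0. \<exists>\<gamma>. smooth_on {-\<epsilon><..<\<epsilon>} \<gamma> \<and> \<gamma> ` {-\<epsilon><..<\<epsilon>} \<subseteq> M \<and>
     \<gamma> 0 = x \<and> (\<gamma> has_vector_derivative v) (at 0)}"

definition non_horizontal :: "'n::finite heis set \<Rightarrow> bool" where
  "non_horizontal M \<longleftrightarrow>
     (\<forall>x\<in>M. {v + w |v w. v \<in> tangent_space M x \<and> w \<in> horizontal x} = UNIV)"

definition gram :: "(real ^ 'm::finite \<Rightarrow> 'n::finite heis) \<Rightarrow> real ^ 'm \<Rightarrow> real ^ 'm ^ 'm" where
  "gram \<phi> u = (\<chi> i j. hmetric (\<phi> u)
     (frechet_derivative \<phi> (at u) (axis i 1)) (frechet_derivative \<phi> (at u) (axis j 1)))"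

text \<open>
  The Riemannian volume of \<open>M\<close> for the metric induced by \<open>hmetric\<close>: the Borel measure on \<open>M\<close> that is
  \<open>sqrt (det g) du\<close> in every local parametrization.
\<close>

definition riemannian_volume :: "'m::finite itself \<Rightarrow> 'n::finite heis set \<Rightarrow> 'n heis measure" where
  "riemannian_volume _ M = (THE \<nu>. sets \<nu> = sets (restrict_space borel M) \<and>
     (\<forall>U (\<phi> :: real ^ 'm \<Rightarrow> 'n heis) A. local_param M U \<phi> \<longrightarrow> A \<in> sets borel \<longrightarrow> A \<subseteq> \<phi> ` U \<longrightarrow>
        emeasure \<nu> A = (\<integral>\<^sup>+u\<in>{u \<in> U. \<phi> u \<in> A}. ennreal (sqrt (det (gram \<phi> u))) \<partial>lborel)))"

text \<open>
  A multivector at a point is given by its coefficients \<open>\<xi> K\<close> in the basis of the wedge products of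
  \<open>frame k\<close>, \<open>k \<in> K\<close>, for \<open>K\<close> a set of indices. The factors are ordered by an arbitrarily fixed
  enumeration of \<open>K\<close>, which affects the basis elements only by a sign.
\<close>

type_synonym 'n mvec = "'n idx set \<Rightarrow> real"

definition enum_idx :: "'n idx set \<Rightarrow> 'm \<Rightarrow> 'n idx" where
  "enum_idx K = (SOME f. bij_betw f UNIV K)"

definition wedge :: "'n::finite heis \<Rightarrow> ('m::finite \<Rightarrow> 'n heis) \<Rightarrow> 'n mvec" where
  "wedge x v K = (if card K = CARD('m)
     then det ((\<chi> i j. coframe x (v i) (enum_idx K j)) :: real ^ 'm ^ 'm) else 0)"

definition mvec_norm :: "'n::finite mvec \<Rightarrow> real" where
  "mvec_norm \<xi> = sqrt (\<Sum>K\<in>UNIV. (\<xi> K)\<^sup>2)"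

fun idx_degree :: "'n idx \<Rightarrow> nat" where
  "idx_degree (Inl i) = 1"
| "idx_degree (Inr (Inl i)) = 1"
| "idx_degree (Inr (Inr u)) = 2"

definition degree_part :: "nat \<Rightarrow> 'n mvec \<Rightarrow> 'n mvec" where
  "degree_part d \<xi> = (\<lambda>K. if (\<Sum>k\<in>K. idx_degree k) = d then \<xi> K else 0)"

text \<open>The unit tangent multivector is determined up to sign, so its choice does not affect \<open>mu\<close>.\<close>

definition unit_tangent :: "'m::finite itself \<Rightarrow> 'n::finite heis set \<Rightarrow> 'n heis \<Rightarrow> 'n mvec" where
  "unit_tangent _ M x = (SOME \<xi>. mvec_norm \<xi> = 1 \<and>
     (\<exists>v :: 'm \<Rightarrow> 'n heis. (\<forall>i. v i \<in> tangent_space M x) \<and> \<xi> = wedge x v))"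

definition mu :: "'m::finite itself \<Rightarrow> nat \<Rightarrow> 'n::finite heis set \<Rightarrow> 'n heis measure" where
  "mu m d M = density (riemannian_volume m M)
     (\<lambda>x. ennreal (mvec_norm (degree_part d (unit_tangent m M x))))"

end

theory Submission
  imports Defs
begin

text \<open>
  The Carnot--Caratheodory norm of a group element depends only on the Euclidean norm of its horizontal
  part and on its vertical coordinate. Hence, for a vertical subspace \<open>V\<close> of dimension \<open>m\<close>, the supremum
  over \<open>c\<close> of the Lebesgue measure of \<open>V \<inter> B(c, 1)\<close> is a constant \<open>\<beta>\<close> that does not depend on \<open>V\<close>. It is the
  constant of the theorem. The left translate of \<open>M\<close> by the inverse of one of its points, blown up by the
  intrinsic dilations, converges to a vertical subspace, uniformly near that point. So the density
  \<open>\<bar>\<tau>\<^sup>d\<bar> d vol\<close> of \<open>\<mu>\<close> gives small balls of radius \<open>r\<close> mass at most about \<open>\<beta> r\<^sup>d\<close>, where \<open>d = m + 1\<close>, and suitable balls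
  near every point reach this value. The first fact bounds \<open>\<mu>\<close> by \<open>\<beta> S\<^sup>d\<close>. The second one gives, by packing
  balls repeatedly into the uncovered part, coverings that prove the reverse inequality.
\<close>

section \<open>The Heisenberg group\<close>

text \<open>The norm sees only the two quantities because unitary maps of the horizontal layer are
  isometric automorphisms and act transitively on its spheres. That \<beta> does not depend on
  \<open>V\<close> rests on a shear: left translation adds to the vertical coordinate a linear
  function on \<open>V\<close>, and removing it has determinant 1. What remains of the centre is its
  Euclidean distance to \<open>V\<close>, and this takes the same values for all \<open>V\<close> of
  one dimension. Covering balls may be centred off \<open>M\<close>, hence the supremum over all
  centres; neither its value nor a maximal centre is ever computed. The limit \<open>V\<close> is
  not the tangent space: it keeps the horizontal tangent vectors and replaces the remaining
  direction by the vertical one, so the surface has to be projected to \<open>V\<close> before areas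
  can be compared. Every local estimate carries a factor close to 1 and holds for all Borel subsets
  of one small coordinate ball. Such estimates add up over countable Borel partitions, so the factor
  is sent to 1 only at the end, in a chart. The same formula then supplies the Riemannian volume,
  which the definition gives only by its values in charts.\<close>

definition om :: "'n::finite heis \<Rightarrow> 'n heis \<Rightarrow> real" where
  "om x y = (\<Sum>i\<in>UNIV. x $ iX i * y $ iY i - y $ iX i * x $ iY i)"

definition eT :: "'n::finite heis" where
  "eT = axis iT 1"

definition hor :: "'n::finite heis \<Rightarrow> 'n heis" where
  "hor x = x - (x $ iT) *\<^sub>R eT"

text \<open>Multiplication by the imaginary unit, if \<open>iX i\<close> and \<open>iY i\<close>
  hold real and imaginary parts. It ties \<open>om\<close> to the Euclidean product by
  \<open>inner_symp_rot\<close>, so that Cauchy-Schwarz bounds \<open>om\<close>.\<close>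

definition symp_rot :: "'n::finite heis \<Rightarrow> 'n heis" where
  "symp_rot x = (\<chi> k. case k of Inl i \<Rightarrow> - x $ iY i | Inr l \<Rightarrow> (case l of Inl i \<Rightarrow> x $ iX i | Inr _ \<Rightarrow> 0))"

text \<open>The frame coefficients of \<open>v\<close> at \<open>x\<close>, collected in a vector;
  equivalently, the differential of left translation by \<open>- x\<close> applied to
  \<open>v\<close>. In this form \<open>hmetric\<close> is the Euclidean inner product.\<close>

definition cof :: "'n::finite heis \<Rightarrow> 'n heis \<Rightarrow> 'n heis" where
  "cof x v = v - (om x v / 2) *\<^sub>R eT"

lemma eT_nth [simp]: "eT $ iT = 1" "eT $ iX i = 0" "eT $ iY i = 0"
  by (simp_all add: eT_def axis_def)

lemma norm_eT [simp]: "norm (eT :: 'n::finite heis) = 1"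
  by (simp add: eT_def norm_axis_1)

lemma eT_inner [simp]: "inner eT x = x $ iT" "inner x eT = x $ iT"
  by (simp_all add: eT_def inner_axis inner_axis')

lemma heis_eqI: "\<lbrakk>\<And>i. x $ iX i = y $ iX i; \<And>i. x $ iY i = y $ iY i; x $ iT = y $ iT\<rbrakk> \<Longrightarrow> x = (y :: 'n::finite heis)"
  by (metis vec_eq_iff idx_cases)

lemma hor_nth [simp]: "hor x $ iT = 0" "hor x $ iX i = x $ iX i" "hor x $ iY i = x $ iY i"
  by (simp_all add: hor_def)

lemma linear_hor: "linear hor"
  by (rule linearI) (auto simp: hor_def algebra_simps)

lemma bounded_linear_hor: "bounded_linear hor"
  by (rule linear_linear[THEN iffD2, OF linear_hor])

lemmas hor_add = linear_add[OF linear_hor]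
lemmas hor_diff = linear_diff[OF linear_hor]
lemmas hor_scale = linear_scale[OF linear_hor]

lemma hor_uminus: "hor (- x) = - hor x"
  by (rule linear_neg[OF linear_hor])

lemma hor_zero [simp]: "hor 0 = 0"
  by (rule linear_0[OF linear_hor])

lemma hor_eT [simp]: "hor eT = 0"
  by (simp add: hor_def)

lemma hor_hor [simp]: "hor (hor x) = hor x"
  by (simp add: hor_def)

lemma hor_decomp: "x = hor x + (x $ iT) *\<^sub>R eT"
  by (simp add: hor_def)

lemma hor_id: "x $ iT = 0 \<Longrightarrow> hor x = x"
  by (simp add: hor_def)

lemma norm_hor_sq: "(norm x)\<^sup>2 = (norm (hor x))\<^sup>2 + (x $ iT)\<^sup>2"
proof -
  have "(norm (hor x + (x $ iT) *\<^sub>R eT))\<^sup>2 = (norm (hor x))\<^sup>2 + (norm ((x $ iT) *\<^sub>R (eT :: 'a heis)))\<^sup>2"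
    by (rule norm_add_Pythagorean) (simp add: orthogonal_def)
  then show ?thesis
    using hor_decomp[of x] by simp
qed

lemma norm_hor_le: "norm (hor x) \<le> norm x"
proof (rule power2_le_imp_le)
  show "(norm (hor x))\<^sup>2 \<le> (norm x)\<^sup>2"
    unfolding norm_hor_sq[of x] by simp
qed simp

lemma norm_le_hor_T: "norm x \<le> norm (hor x) + \<bar>x $ iT\<bar>"
  by (metis hor_decomp mult.right_neutral norm_eT norm_scaleR norm_triangle_ineq)

lemma abs_T_le: "\<bar>x $ iT\<bar> \<le> norm (x :: 'n::finite heis)"
  by (rule component_le_norm_cart)

lemma om_swap: "om y x = - om x y"
  by (simp add: om_def sum_subtractf)

lemma om_self [simp]: "om x x = 0"
  by (simp add: om_def)

lemma om_add: "om (x + y) z = om x z + om y z" "om z (x + y) = om z x + om z y"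
  by (simp_all add: om_def sum.distrib sum_subtractf algebra_simps)

lemma om_scale: "om (c *\<^sub>R x) z = c * om x z" "om z (c *\<^sub>R x) = c * om z x"
  by (simp_all add: om_def sum_distrib_left sum_subtractf algebra_simps)

lemma om_uminus: "om (- x) z = - om x z" "om z (- x) = - om z x"
  using om_scale(1)[of "-1" x z] om_scale(2)[of z "-1" x] by simp_all

lemma om_diff: "om (x - y) z = om x z - om y z" "om z (x - y) = om z x - om z y"
  using om_add(1)[of x "- y" z] om_add(2)[of z x "- y"] by (simp_all add: om_uminus)

lemma om_eT [simp]: "om eT x = 0" "om x eT = 0"
  by (simp_all add: om_def)

lemma om_0 [simp]: "om 0 x = 0" "om x 0 = 0"
  by (simp_all add: om_def)

lemma om_hor [simp]: "om (hor x) y = om x y" "om x (hor y) = om x y"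
  by (simp_all add: om_def)

lemmas om_simps = om_add om_scale om_uminus om_diff

lemma symp_rot_nth [simp]: "symp_rot x $ iT = 0" "symp_rot x $ iX i = - x $ iY i"
    "symp_rot x $ iY i = x $ iX i"
  by (simp_all add: symp_rot_def)

lemma inner_heis: "inner x y = (\<Sum>i\<in>UNIV. x $ iX i * y $ iX i) + (\<Sum>i\<in>UNIV. x $ iY i * y $ iY i) + x $ iT * y $ iT"
  for x y :: "'n::finite heis"
  by (simp add: inner_vec_def sum_idx)

lemma inner_symp_rot: "inner (symp_rot x) y = om x y"
  by (simp add: inner_heis om_def sum.distrib sum_subtractf sum_negf mult.commute)

lemma symp_rot_symp_rot: "symp_rot (symp_rot x) = - hor x"
  by (rule heis_eqI) simp_all

lemma om_symp_rot: "om (symp_rot x) y = - inner (hor x) y" "om x (symp_rot y) = inner (hor x) y"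
proof -
  show *: "om (symp_rot x) y = - inner (hor x) y" for x y :: "'a heis"
    by (metis inner_minus_left inner_symp_rot symp_rot_symp_rot)
  have "om x (symp_rot y) = inner (hor y) x"
    by (subst om_swap) (simp add: *)
  also have "\<dots> = inner (hor x) y"
    by (simp add: inner_heis mult.commute)
  finally show "om x (symp_rot y) = inner (hor x) y" .
qed

lemma norm_symp_rot: "norm (symp_rot x) = norm (hor x)"
  unfolding norm_eq_sqrt_inner by (simp add: inner_symp_rot om_symp_rot inner_heis)

lemma om_bound: "\<bar>om x y\<bar> \<le> norm (hor x) * norm (hor y)"
  by (metis Cauchy_Schwarz_ineq2 inner_symp_rot norm_symp_rot om_hor(2))

lemma om_bound': "\<bar>om x y\<bar> \<le> norm x * norm y"
  by (meson norm_hor_le om_bound mult_mono norm_ge_zero order_trans)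

lemma bilinear_om: "bilinear om"
  unfolding bilinear_def by (auto intro!: linearI simp: om_simps)

lemma bounded_bilinear_om: "bounded_bilinear om"
  by (rule bilinear_conv_bounded_bilinear[THEN iffD1, OF bilinear_om])

lemma heis_mult_om: "heis_mult x y = x + y + (om x y / 2) *\<^sub>R eT"
  by (simp add: heis_mult_def om_def eT_def)

text \<open>The group law is affine in each factor, so a left translation agrees with its
  differential up to a constant. Finite differences and velocities are therefore handled by the same
  map \<open>cof\<close>.\<close>

lemma ldiff_cof: "heis_mult (- x) y = cof x (y - x)"
  by (simp add: heis_mult_om cof_def om_simps)

lemma heis_assoc: "heis_mult (heis_mult x y) z = heis_mult x (heis_mult y z)"
  by (simp add: heis_mult_om om_simps scaleR_add_left add_divide_distrib algebra_simps)

lemma heis_inv [simp]: "heis_mult (- x) x = 0" "heis_mult x (- x) = 0"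
  by (simp_all add: heis_mult_om om_simps)

lemma heis_one [simp]: "heis_mult 0 x = x" "heis_mult x 0 = x"
  by (simp_all add: heis_mult_om)

lemma heis_inv_cancel [simp]: "heis_mult (- x) (heis_mult x y) = y" "heis_mult x (heis_mult (- x) y) = y"
  by (simp_all add: heis_assoc[symmetric])

lemma heis_inv_mult: "- heis_mult x y = heis_mult (- y) (- x)"
  by (simp add: heis_mult_om om_simps om_swap[of y x])

lemma heis_mult_nth [simp]: "heis_mult x y $ iT = x $ iT + y $ iT + om x y / 2"
    "hor (heis_mult x y) = hor x + hor y"
  by (auto simp: heis_mult_om intro!: heis_eqI)

lemma cof_nth: "cof x v $ k = coframe x v k"
  by (cases k rule: idx_cases)
    (auto simp: cof_def om_def sum_subtractf mult.commute diff_divide_distrib)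

lemma hmetric_cof: "hmetric x v w = inner (cof x v) (cof x w)"
  by (simp add: hmetric_def inner_vec_def cof_nth)

lemma sqrt_hmetric: "sqrt (hmetric x v v) = norm (cof x v)"
  by (simp add: hmetric_cof norm_eq_sqrt_inner)

lemma cof_T: "cof x v $ iT = v $ iT - om x v / 2"
  by (simp add: cof_def)

lemma hor_cof [simp]: "hor (cof x v) = hor v"
  by (simp add: cof_def hor_diff hor_scale)

lemma cof_0 [simp]: "cof x 0 = 0"
  by (simp add: cof_def)

lemma linear_cof: "linear (cof x)"
  by (rule linearI) (auto simp: cof_def om_simps algebra_simps add_divide_distrib scaleR_add_left)

lemma horizontal_iff: "v \<in> horizontal x \<longleftrightarrow> cof x v $ iT = 0"
proof
  assume "v \<in> horizontal x"
  then have "v \<in> span {frame k x |k. k \<noteq> iT}"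
    by (simp add: horizontal_def)
  then show "cof x v $ iT = 0"
  proof (induction rule: span_induct_alt)
    case base
    show ?case by simp
  next
    case (step c v w)
    then show ?case
      using coframe_frame[of x _ iT]
      by (auto simp: linear_add[OF linear_cof] linear_scale[OF linear_cof] cof_nth
          simp del: coframe.simps)
  qed
next
  assume *: "cof x v $ iT = 0"
  have "v = (\<Sum>k\<in>UNIV. coframe x v k *\<^sub>R frame k x)"
    by (rule frame_expansion)
  also have "\<dots> = (\<Sum>k\<in>UNIV - {iT}. coframe x v k *\<^sub>R frame k x)"
    using * by (subst sum.remove[of _ iT]) (simp_all add: cof_nth[symmetric] del: coframe.simps)
  also have "\<dots> \<in> horizontal x"
    unfolding horizontal_def by (intro span_sum span_scale span_base) auto
  finally show "v \<in> horizontal x" .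
qed

section \<open>The Carnot--Caratheodory distance\<close>

text \<open>Replaces \<open>vector_derivative\<close>, whose value is arbitrary where the path has
  no derivative, by a field \<open>D\<close> that is 0 at finitely many exceptional points. The
  endpoints count as exceptional because horizontality is demanded only inside the interval.\<close>

lemma horizontal_pathE:
  assumes "horizontal_path \<gamma>"
  obtains S D where "finite S" "0 \<in> S" "1 \<in> S"
    "\<And>t. t \<in> {0..1} - S \<Longrightarrow> (\<gamma> has_vector_derivative D t) (at t)"
    "\<And>t. t \<in> S \<Longrightarrow> D t = 0"
    "\<And>t. t \<in> {0..1} \<Longrightarrow> cof (\<gamma> t) (D t) $ iT = 0"
    "(\<lambda>t. norm (hor (D t)) * indicator {0..1} t) \<in> borel_measurable borel"
    "path_len \<gamma> = (\<integral>\<^sup>+t. ennreal (norm (hor (D t)) * indicator {0..1} t) \<partial>lborel)"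
    "continuous_on {0..1} \<gamma>"
proof -
  from assms obtain S0 D0 where S0: "finite S0" and c: "continuous_on {0..1} \<gamma>"
    and D0: "\<And>t. t \<in> {0..1} - S0 \<Longrightarrow> (\<gamma> has_vector_derivative D0 t) (at t)"
    and cD: "continuous_on ({0..1} - S0) D0"
    by (fastforce simp: horizontal_path_def valid_path_def piecewise_C1_differentiable_on_def
        C1_differentiable_on_def)
  define S where "S = insert 0 (insert 1 S0)"
  define D where "D t = (if t \<in> S then 0 else D0 t)" for t
  have S: "finite S" "0 \<in> S" "1 \<in> S" "S0 \<subseteq> S"
    using S0 by (auto simp: S_def)
  have D: "(\<gamma> has_vector_derivative D t) (at t)" if "t \<in> {0..1} - S" for t
    using that D0[of t] by (auto simp: D_def S_def)
  have hz: "cof (\<gamma> t) (D t) $ iT = 0" if "t \<in> {0..1}" for t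
  proof (cases "t \<in> S")
    case False
    with that S have "t \<in> {0<..<1}"
      by (cases "t = 0"; cases "t = 1") auto
    moreover have "(\<gamma> has_vector_derivative D t) (at t)"
      using False that D by auto
    ultimately have "D t \<in> horizontal (\<gamma> t)"
      using assms unfolding horizontal_path_def
      by (metis differentiableI_vector vector_derivative_at)
    then show ?thesis
      by (simp add: horizontal_iff)
  qed (simp add: D_def)
  have nc: "norm (cof (\<gamma> t) (D t)) = norm (hor (D t))" if "t \<in> {0..1}" for t
    using hz[OF that] by (metis hor_cof hor_id)
  have "continuous_on ({0..1} - S) (\<lambda>t. norm (hor (D0 t)))"
    by (intro continuous_intros bounded_linear.continuous_on[OF bounded_linear_hor]
        continuous_on_subset[OF cD]) (use S in auto)
  then have "(\<lambda>t. indicator ({0..1} - S) t *\<^sub>R norm (hor (D0 t))) \<in> borel_measurable borel"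
    by (rule borel_measurable_continuous_on_indicator[rotated])
      (use S in \<open>intro sets.Diff borel_closed finite_imp_closed closed_atLeastAtMost\<close>)
  also have "(\<lambda>t. indicator ({0..1} - S) t *\<^sub>R norm (hor (D0 t))) = (\<lambda>t. norm (hor (D t)) * indicator {0..1} t)"
    by (auto simp: D_def indicator_def)
  finally have meas: "(\<lambda>t. norm (hor (D t)) * indicator {0..1} t) \<in> borel_measurable borel" .
  have ae: "AE t in lborel. t \<notin> S"
    by (rule AE_not_in) (use S in \<open>simp add: finite_imp_null_set_lborel\<close>)
  have "path_len \<gamma> = (\<integral>\<^sup>+t. ennreal (norm (hor (D t)) * indicator {0..1} t) \<partial>lborel)"
    unfolding path_len_def sqrt_hmetric
  proof (rule nn_integral_cong_AE, use ae in \<open>rule AE_mp\<close>, rule AE_I2, rule impI)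
    fix t assume "t \<notin> S"
    then show "ennreal (norm (cof (\<gamma> t) (vector_derivative \<gamma> (at t)))) * indicator {0..1} t =
        ennreal (norm (hor (D t)) * indicator {0..1} t)"
      using D[of t] nc[of t] by (auto simp: indicator_def vector_derivative_at)
  qed
  with S D hz meas c show thesis
    by (intro that[of S D]) (auto simp: D_def[abs_def])
qed

lemma path_len_eqI:
  assumes "finite S" "\<And>t. t \<in> {0..1} - S \<Longrightarrow> (\<gamma> has_vector_derivative D t) (at t)"
  shows "path_len \<gamma> = (\<integral>\<^sup>+t. ennreal (norm (cof (\<gamma> t) (D t)) * indicator {0..1} t) \<partial>lborel)"
proof -
  have ae: "AE t in lborel. t \<notin> S"
    by (rule AE_not_in) (use assms in \<open>simp add: finite_imp_null_set_lborel\<close>)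
  show ?thesis
    unfolding path_len_def sqrt_hmetric
    by (rule nn_integral_cong_AE, use ae in \<open>rule AE_mp\<close>)
      (auto intro!: AE_I2 simp: indicator_def vector_derivative_at[OF assms(2)])
qed

lemma cc_dist_le: "\<lbrakk>horizontal_path \<gamma>; pathstart \<gamma> = x; pathfinish \<gamma> = y\<rbrakk> \<Longrightarrow> cc_dist x y \<le> path_len \<gamma>"
  unfolding cc_dist_def by (rule INF_lower) auto

text \<open>The common source of left invariance, dilations and isometries: an affine map that acts
  on frame coefficients through one fixed map \<open>A\<close> sends horizontal paths to horizontal
  paths and multiplies lengths by at most \<open>l\<close>.\<close>

lemma cc_dist_affine_le:
  fixes \<Lambda> A :: "'n::finite heis \<Rightarrow> 'n heis"
  assumes lin: "linear \<Lambda>" "inj \<Lambda>" and l: "l > 0"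
    and A: "\<And>x v. cof (b + \<Lambda> x) (\<Lambda> v) = A (cof x v)"
    and AT: "\<And>w. w $ iT = 0 \<longleftrightarrow> A w $ iT = 0"
    and An: "\<And>w. w $ iT = 0 \<Longrightarrow> norm (A w) \<le> l * norm w"
  shows "cc_dist (b + \<Lambda> x) (b + \<Lambda> y) \<le> ennreal l * cc_dist x y"
proof -
  have *: "cc_dist (b + \<Lambda> x) (b + \<Lambda> y) \<le> ennreal l * path_len \<gamma>"
    if \<gamma>: "horizontal_path \<gamma>" "pathstart \<gamma> = x" "pathfinish \<gamma> = y" for \<gamma>
  proof -
    define \<eta> where "\<eta> = ((+) b) \<circ> (\<Lambda> \<circ> \<gamma>)"
    \<comment> \<open>Horizontality is demanded wherever the image path is differentiable. The left
      inverse shows that the original path is differentiable there too, so nothing new has to be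
      checked.\<close>
    obtain G where G: "linear G" "G \<circ> \<Lambda> = id"
      using linear_injective_left_inverse[OF lin] by blast
    from \<gamma>(1) obtain S D where SD: "finite S" "0 \<in> S" "1 \<in> S"
      "\<And>t. t \<in> {0..1} - S \<Longrightarrow> (\<gamma> has_vector_derivative D t) (at t)"
      "\<And>t. t \<in> S \<Longrightarrow> D t = 0"
      "\<And>t. t \<in> {0..1} \<Longrightarrow> cof (\<gamma> t) (D t) $ iT = 0"
      "(\<lambda>t. norm (hor (D t)) * indicator {0..1} t) \<in> borel_measurable borel"
      "path_len \<gamma> = (\<integral>\<^sup>+t. ennreal (norm (hor (D t)) * indicator {0..1} t) \<partial>lborel)"
      "continuous_on {0..1} \<gamma>"
      by (rule horizontal_pathE) (rule that)
    have bl: "bounded_linear \<Lambda>" "bounded_linear G"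
      using lin G linear_linear by blast+
    have d: "(\<eta> has_vector_derivative \<Lambda> v) (at t)" if "(\<gamma> has_vector_derivative v) (at t)" for t v
      unfolding \<eta>_def comp_def
      using bounded_linear.has_vector_derivative[OF bl(1) that]
      by (auto intro!: derivative_eq_intros)
    have "valid_path \<eta>"
      unfolding \<eta>_def valid_path_translation_eq
      by (rule linear_image_valid_path) (use \<gamma> lin in \<open>auto simp: horizontal_path_def\<close>)
    moreover have "vector_derivative \<eta> (at t) \<in> horizontal (\<eta> t)"
      if t: "t \<in> {0<..<1}" "\<eta> differentiable (at t)" for t
    proof -
      have 1: "(\<eta> has_vector_derivative vector_derivative \<eta> (at t)) (at t)"
        using t vector_derivative_works by blast
      have "((\<lambda>t. G (\<eta> t - b)) has_vector_derivative G (vector_derivative \<eta> (at t))) (at t)"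
        by (rule bounded_linear.has_vector_derivative[OF bl(2)]) (auto intro!: derivative_eq_intros 1)
      moreover have "(\<lambda>t. G (\<eta> t - b)) = \<gamma>"
        using G by (auto simp: \<eta>_def comp_def fun_eq_iff)
      ultimately have 2: "(\<gamma> has_vector_derivative G (vector_derivative \<eta> (at t))) (at t)"
        by simp
      then have 3: "G (vector_derivative \<eta> (at t)) \<in> horizontal (\<gamma> t)"
        using t \<gamma> unfolding horizontal_path_def
        by (metis differentiableI_vector vector_derivative_at)
      have "vector_derivative \<eta> (at t) = \<Lambda> (G (vector_derivative \<eta> (at t)))"
        using d[OF 2] vector_derivative_at by blast
      with 3 show ?thesis
        by (metis (no_types, lifting) A AT \<eta>_def comp_apply horizontal_iff)
    qed
    ultimately have h: "horizontal_path \<eta>"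
      by (auto simp: horizontal_path_def)
    have "cc_dist (b + \<Lambda> x) (b + \<Lambda> y) \<le> path_len \<eta>"
      by (rule cc_dist_le[OF h]) (use \<gamma> in \<open>auto simp: \<eta>_def pathstart_def pathfinish_def\<close>)
    also have "path_len \<eta> = (\<integral>\<^sup>+t. ennreal (norm (cof (\<eta> t) (\<Lambda> (D t))) * indicator {0..1} t) \<partial>lborel)"
      by (rule path_len_eqI[OF \<open>finite S\<close>]) (use SD d in auto)
    also have "\<dots> \<le> (\<integral>\<^sup>+t. ennreal l * ennreal (norm (hor (D t)) * indicator {0..1} t) \<partial>lborel)"
    proof (rule nn_integral_mono)
      fix t :: real
      have "norm (A (cof (\<gamma> t) (D t))) \<le> l * norm (hor (D t))" if "t \<in> {0..1}"
        using An[OF SD(6)[OF that]] by (metis SD(6) hor_cof hor_id that)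
      then show "ennreal (norm (cof (\<eta> t) (\<Lambda> (D t))) * indicator {0..1} t)
          \<le> ennreal l * ennreal (norm (hor (D t)) * indicator {0..1} t)"
        using l by (auto simp: \<eta>_def A indicator_def ennreal_mult'[symmetric] intro!: ennreal_leI)
    qed
    also have "\<dots> = ennreal l * path_len \<gamma>"
      using SD by (simp add: nn_integral_cmult)
    finally show ?thesis .
  qed
  have "cc_dist (b + \<Lambda> x) (b + \<Lambda> y) / ennreal l \<le> cc_dist x y"
    unfolding cc_dist_def[of x y]
  proof (rule INF_greatest, clarify)
    fix \<gamma> assume "horizontal_path \<gamma>" "x = pathstart \<gamma>" "y = pathfinish \<gamma>"
    from *[OF this(1) this(2)[symmetric] this(3)[symmetric]] l
    show "cc_dist (b + \<Lambda> (pathstart \<gamma>)) (b + \<Lambda> (pathfinish \<gamma>)) / ennreal l \<le> path_len \<gamma>"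
      by (metis \<open>x = pathstart \<gamma>\<close> \<open>y = pathfinish \<gamma>\<close> divide_le_posI_ennreal ennreal_less_zero_iff mult.commute)
  qed
  then have "ennreal l * (cc_dist (b + \<Lambda> x) (b + \<Lambda> y) / ennreal l) \<le> ennreal l * cc_dist x y"
    by (rule mult_left_mono) simp
  then show ?thesis
    using l by (simp add: ennreal_times_divide mult.commute[of "ennreal l" "cc_dist (b + \<Lambda> x) (b + \<Lambda> y)"] mult_divide_eq_ennreal)
qed

lemma cc_dist_left_le: "cc_dist (heis_mult a x) (heis_mult a y) \<le> cc_dist x y"
proof -
  define L where "L y = y + (om a y / 2) *\<^sub>R eT" for y
  have L: "heis_mult a y = a + L y" for y
    by (simp add: L_def heis_mult_om)
  have "linear L"
    by (rule linearI) (auto simp: L_def om_simps algebra_simps add_divide_distrib scaleR_add_left)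
  moreover have "inj L"
    by (rule injI) (metis L heis_inv_cancel(1))
  moreover have "cof (a + L x) (L v) = cof x v" for x v
    by (simp add: cof_def L_def om_simps algebra_simps add_divide_distrib scaleR_add_left)
  ultimately have "cc_dist (a + L x) (a + L y) \<le> ennreal 1 * cc_dist x y"
    by (intro cc_dist_affine_le[where A = id]) auto
  then show ?thesis
    by (simp add: L)
qed

lemma cc_dist_left: "cc_dist (heis_mult a x) (heis_mult a y) = cc_dist x y"
  using cc_dist_left_le[of a x y] cc_dist_left_le[of "- a" "heis_mult a x" "heis_mult a y"] by simp

text \<open>Automorphisms that scale the symplectic form and the vertical coordinate by the same
  \<tau>: dilations (\<open>r\<^sup>2\<close>), unitary maps (1) and the orientation-reversing swap
  of coordinates (-1).\<close>

lemma cc_dist_auto_le: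
  fixes A :: "'n::finite heis \<Rightarrow> 'n heis"
  assumes "linear A" "inj A" "l > 0" "\<tau> \<noteq> 0"
    and om: "\<And>x y. om (A x) (A y) = \<tau> * om x y" and T: "\<And>x. A x $ iT = \<tau> * x $ iT"
    and n: "\<And>x. norm (hor (A x)) \<le> l * norm (hor x)" and e: "A eT = \<tau> *\<^sub>R eT"
  shows "cc_dist (A x) (A y) \<le> ennreal l * cc_dist x y"
proof -
  have "cc_dist (0 + A x) (0 + A y) \<le> ennreal l * cc_dist x y"
  proof (rule cc_dist_affine_le[where A = A])
    show "cof (0 + A x) (A v) = A (cof x v)" for x v
      by (simp add: cof_def om linear_diff[OF \<open>linear A\<close>] linear_scale[OF \<open>linear A\<close>] e)
    show "norm (A w) \<le> l * norm w" if "w $ iT = 0" for w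
      using n[of w] T[of w] that by (simp add: hor_id)
  qed (use assms in auto)
  then show ?thesis by simp
qed

lemma linepath_horizontal:
  assumes "v $ iT = 0"
  shows "horizontal_path (linepath 0 v)" "path_len (linepath 0 v) = ennreal (norm v)"
proof -
  have c: "cof (linepath 0 v t) v = v" "cof (t *\<^sub>R v) v = v" for t
    by (simp_all add: linepath_def cof_def om_simps)
  show "horizontal_path (linepath 0 v)"
    using assms by (auto simp: horizontal_path_def horizontal_iff c)
  have "path_len (linepath 0 v) = (\<integral>\<^sup>+t. ennreal (norm (cof (linepath 0 v t) v) * indicator {0..1} t) \<partial>lborel)"
    by (rule path_len_eqI[of "{}"]) (use has_vector_derivative_linepath_within[of 0 v _ UNIV] in auto)
  also have "\<dots> = (\<integral>\<^sup>+t. ennreal (norm v) * indicator {0..1::real} t \<partial>lborel)"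
    unfolding c by (intro nn_integral_cong) (auto simp: indicator_def)
  finally show "path_len (linepath 0 v) = ennreal (norm v)"
    by (simp add: nn_integral_cmult)
qed

lemma cc_dist_horizontal_le: "v $ iT = 0 \<Longrightarrow> cc_dist 0 v \<le> ennreal (norm v)"
  using cc_dist_le[of "linepath 0 v" 0 v] linepath_horizontal[of v] by simp

text \<open>Horizontality of the two pieces says nothing about their endpoints, yet the joined path
  may be differentiable at the seam 1/2; hypothesis \<open>j\<close> covers this point.\<close>

lemma join_horizontal:
  assumes h1: "horizontal_path \<gamma>1" and h2: "horizontal_path \<gamma>2" and e: "pathfinish \<gamma>1 = pathstart \<gamma>2"
    and j: "\<And>v. ((\<gamma>1 +++ \<gamma>2) has_vector_derivative v) (at (1/2)) \<Longrightarrow> v = 0"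
  shows "horizontal_path (\<gamma>1 +++ \<gamma>2)" "path_len (\<gamma>1 +++ \<gamma>2) = path_len \<gamma>1 + path_len \<gamma>2"
proof -
  let ?g = "\<gamma>1 +++ \<gamma>2"
  have h: "v \<in> horizontal (?g t)" if t: "t \<in> {0<..<1}" "(?g has_vector_derivative v) (at t)" for t v
  proof -
    consider "t < 1/2" | "t = 1/2" | "t > 1/2" by linarith
    then show ?thesis
    proof cases
      case 1
      have "((?g \<circ> (\<lambda>s. s/2)) has_vector_derivative (1/2) *\<^sub>R v) (at (2 * t))"
        by (rule vector_diff_chain_at) (auto intro!: derivative_eq_intros t simp flip: has_real_derivative_iff_has_vector_derivative)
      then have "(\<gamma>1 has_vector_derivative (1/2) *\<^sub>R v) (at (2 * t))"
        by (rule has_vector_derivative_transform_within_open[of _ _ _ "{..<1}"])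
          (use 1 in \<open>auto simp: joinpaths_def\<close>)
      then have "(1/2) *\<^sub>R v \<in> horizontal (\<gamma>1 (2 * t))"
        using h1 t 1 unfolding horizontal_path_def
        by (auto simp: differentiableI_vector dest!: bspec[of _ _ "2 * t"] simp: vector_derivative_at)
      then show ?thesis
        using 1 by (simp add: horizontal_iff joinpaths_def linear_scale[OF linear_cof])
    next
      case 2
      have "v = 0"
        using t(2) unfolding 2 by (rule j)
      then show ?thesis
        by (simp add: horizontal_iff)
    next
      case 3
      have eq: "(2 * t - 1) / 2 + 1 / 2 = t"
        by (simp add: field_simps)
      have "((?g \<circ> (\<lambda>s. s/2 + 1/2)) has_vector_derivative (1/2) *\<^sub>R v) (at (2 * t - 1))"
        by (rule vector_diff_chain_at) (auto intro!: derivative_eq_intros t simp: eq simp flip: has_real_derivative_iff_has_vector_derivative)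
      then have "(\<gamma>2 has_vector_derivative (1/2) *\<^sub>R v) (at (2 * t - 1))"
        by (rule has_vector_derivative_transform_within_open[of _ _ _ "{0<..}"])
          (use 3 in \<open>auto simp: joinpaths_def\<close>)
      then have "(1/2) *\<^sub>R v \<in> horizontal (\<gamma>2 (2 * t - 1))"
        using h2 t 3 unfolding horizontal_path_def
        by (auto simp: differentiableI_vector dest!: bspec[of _ _ "2 * t - 1"] simp: vector_derivative_at)
      then show ?thesis
        using 3 by (simp add: horizontal_iff joinpaths_def linear_scale[OF linear_cof])
    qed
  qed
  have "valid_path ?g"
    using h1 h2 e by (auto simp: horizontal_path_def intro: valid_path_join)
  then show "horizontal_path ?g"
    unfolding horizontal_path_def using h vector_derivative_works by blast
  obtain S1 D1 where SD1: "finite S1" "0 \<in> S1" "1 \<in> S1"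
    "\<And>t. t \<in> {0..1} - S1 \<Longrightarrow> (\<gamma>1 has_vector_derivative D1 t) (at t)"
    "\<And>t. t \<in> S1 \<Longrightarrow> D1 t = 0"
    "\<And>t. t \<in> {0..1} \<Longrightarrow> cof (\<gamma>1 t) (D1 t) $ iT = 0"
    "(\<lambda>t. norm (hor (D1 t)) * indicator {0..1} t) \<in> borel_measurable borel"
    "path_len \<gamma>1 = (\<integral>\<^sup>+t. ennreal (norm (hor (D1 t)) * indicator {0..1} t) \<partial>lborel)"
    "continuous_on {0..1} \<gamma>1"
    using h1 by (rule horizontal_pathE) (rule that)
  obtain S2 D2 where SD2: "finite S2" "0 \<in> S2" "1 \<in> S2"
    "\<And>t. t \<in> {0..1} - S2 \<Longrightarrow> (\<gamma>2 has_vector_derivative D2 t) (at t)"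
    "\<And>t. t \<in> S2 \<Longrightarrow> D2 t = 0"
    "\<And>t. t \<in> {0..1} \<Longrightarrow> cof (\<gamma>2 t) (D2 t) $ iT = 0"
    "(\<lambda>t. norm (hor (D2 t)) * indicator {0..1} t) \<in> borel_measurable borel"
    "path_len \<gamma>2 = (\<integral>\<^sup>+t. ennreal (norm (hor (D2 t)) * indicator {0..1} t) \<partial>lborel)"
    "continuous_on {0..1} \<gamma>2"
    using h2 by (rule horizontal_pathE) (rule that)
  define S where "S = insert (1/2) ((\<lambda>s. s/2) ` S1 \<union> (\<lambda>s. (s+1)/2) ` S2)"
  define D where "D t = (if t \<le> 1/2 then 2 *\<^sub>R D1 (2*t) else 2 *\<^sub>R D2 (2*t-1))" for t
  have fS: "finite S"
    using SD1 SD2 by (auto simp: S_def)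
  have nS: "t \<noteq> 1/2" "2 * t \<notin> S1" "2 * t - 1 \<notin> S2" if "t \<notin> S" for t
    using that imageI[of "2 * t" S1 "\<lambda>s. s/2"] imageI[of "2 * t - 1" S2 "\<lambda>s. (s+1)/2"]
    by (auto simp: S_def)
  have D: "(?g has_vector_derivative D t) (at t)" if t: "t \<in> {0..1} - S" for t
  proof (cases "t < 1/2")
    case True
    have "((\<gamma>1 \<circ> (\<lambda>s. 2 * s)) has_vector_derivative 2 *\<^sub>R D1 (2 * t)) (at t)"
      by (rule vector_diff_chain_at)
        (use t nS True in \<open>auto intro!: derivative_eq_intros SD1(4) simp flip: has_real_derivative_iff_has_vector_derivative\<close>)
    then have "(?g has_vector_derivative 2 *\<^sub>R D1 (2 * t)) (at t)"
      by (rule has_vector_derivative_transform_within_open[of _ _ _ "{..<1/2}"])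
        (use True in \<open>auto simp: joinpaths_def\<close>)
    then show ?thesis
      using True by (simp add: D_def)
  next
    case False
    then have f: "t > 1/2"
      using nS(1)[of t] t by auto
    have "((\<gamma>2 \<circ> (\<lambda>s. 2 * s - 1)) has_vector_derivative 2 *\<^sub>R D2 (2 * t - 1)) (at t)"
      by (rule vector_diff_chain_at)
        (use t nS f in \<open>auto intro!: derivative_eq_intros SD2(4) simp flip: has_real_derivative_iff_has_vector_derivative\<close>)
    then have "(?g has_vector_derivative 2 *\<^sub>R D2 (2 * t - 1)) (at t)"
      by (rule has_vector_derivative_transform_within_open[of _ _ _ "{1/2<..}"])
        (use f in \<open>auto simp: joinpaths_def\<close>)
    then show ?thesis
      using f by (simp add: D_def)
  qed
  let ?f1 = "\<lambda>t. ennreal (norm (hor (D1 t)) * indicator {0..1} t)"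
  let ?f2 = "\<lambda>t. ennreal (norm (hor (D2 t)) * indicator {0..1} t)"
  have m: "?f1 \<in> borel_measurable borel" "?f2 \<in> borel_measurable borel"
    using SD1(7) SD2(7) by measurable
  have ae: "AE t in lborel. t \<notin> S"
    by (rule AE_not_in) (use fS in \<open>simp add: finite_imp_null_set_lborel\<close>)
  have n1: "norm (cof (\<gamma>1 t) (D1 t)) = norm (hor (D1 t))" if "t \<in> {0..1}" for t
    using SD1(6)[OF that] by (metis hor_cof hor_id)
  have n2: "norm (cof (\<gamma>2 t) (D2 t)) = norm (hor (D2 t))" if "t \<in> {0..1}" for t
    using SD2(6)[OF that] by (metis hor_cof hor_id)
  have "path_len ?g = (\<integral>\<^sup>+t. ennreal (norm (cof (?g t) (D t)) * indicator {0..1} t) \<partial>lborel)"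
    by (rule path_len_eqI[OF fS D])
  \<comment> \<open>Each piece is run through at double speed; the integrand is brought to the shape
    that the affine substitution \<open>nn_integral_real_affine\<close> expects.\<close>
  also have "\<dots> = (\<integral>\<^sup>+t. ennreal \<bar>2\<bar> * ?f1 (0 + 2 * t) + ennreal \<bar>2\<bar> * ?f2 (- 1 + 2 * t) \<partial>lborel)"
  proof (rule nn_integral_cong_AE, use ae in \<open>rule AE_mp\<close>, rule AE_I2, rule impI)
    fix t assume t: "t \<notin> S"
    have n: "norm (2 *\<^sub>R v) = 2 * norm v" for v :: "'a heis"
      by simp
    show "ennreal (norm (cof (?g t) (D t)) * indicator {0..1} t) =
      ennreal \<bar>2\<bar> * ?f1 (0 + 2 * t) + ennreal \<bar>2\<bar> * ?f2 (- 1 + 2 * t)"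
      using nS(1)[OF t]
      by (cases "t < 1/2"; cases "t \<in> {0..1}")
        (auto simp: D_def joinpaths_def linear_scale[OF linear_cof] n1 n2 indicator_def ennreal_mult' n
          simp del: norm_scaleR)
  qed
  also have "\<dots> = (\<integral>\<^sup>+t. ennreal \<bar>2\<bar> * ?f1 (0 + 2 * t) \<partial>lborel) + (\<integral>\<^sup>+t. ennreal \<bar>2\<bar> * ?f2 (- 1 + 2 * t) \<partial>lborel)"
    by (rule nn_integral_add) (use m in measurable)
  also have "(\<integral>\<^sup>+t. ennreal \<bar>2\<bar> * ?f1 (0 + 2 * t) \<partial>lborel) = ennreal \<bar>2\<bar> * (\<integral>\<^sup>+t. ?f1 (0 + 2 * t) \<partial>lborel)"
    by (rule nn_integral_cmult) (use m in measurable)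
  also have "\<dots> = path_len \<gamma>1"
    unfolding SD1(8) by (rule nn_integral_real_affine[OF m(1), of 2 0, symmetric]) simp
  also have "(\<integral>\<^sup>+t. ennreal \<bar>2\<bar> * ?f2 (- 1 + 2 * t) \<partial>lborel) = ennreal \<bar>2\<bar> * (\<integral>\<^sup>+t. ?f2 (- 1 + 2 * t) \<partial>lborel)"
    by (rule nn_integral_cmult) (use m in measurable)
  also have "\<dots> = path_len \<gamma>2"
    unfolding SD2(8) by (rule nn_integral_real_affine[OF m(2), of 2 "-1", symmetric]) simp
  finally show "path_len ?g = path_len \<gamma>1 + path_len \<gamma>2" .
qed


lemma constant_path:
  "horizontal_path (linepath y y)" "path_len (linepath y y) = 0"
proof -
  show "horizontal_path (linepath y y)"
    by (auto simp: horizontal_path_def horizontal_iff)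
  have "path_len (linepath y y) = (\<integral>\<^sup>+t. ennreal (norm (cof (linepath y y t) 0) * indicator {0..1::real} t) \<partial>lborel)"
    by (rule path_len_eqI[of "{}"]) (use has_vector_derivative_linepath_within[of y y _ UNIV] in auto)
  then show "path_len (linepath y y) = 0"
    by simp
qed

text \<open>
  Two horizontal paths are joined through a constant path, so that wherever the joined path happens
  to be differentiable at a junction, its derivative there is 0 and hence horizontal.
\<close>

lemma cc_dist_path_triangle:
  assumes h: "horizontal_path \<gamma>1" "horizontal_path \<gamma>2" and e: "pathfinish \<gamma>1 = y" "pathstart \<gamma>2 = y"
  shows "cc_dist (pathstart \<gamma>1) (pathfinish \<gamma>2) \<le> path_len \<gamma>1 + path_len \<gamma>2"
proof -
  let ?g = "linepath y y +++ \<gamma>2"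
  have j: "v = 0" if v: "(?g has_vector_derivative v) (at (1/2))" for v
  proof (rule vector_derivative_unique_within_closed_interval[of 0 "1/2" "1/2"])
    show "(?g has_vector_derivative v) (at (1/2) within cbox 0 (1/2))"
      using v by (rule has_vector_derivative_at_within)
    show "(?g has_vector_derivative 0) (at (1/2) within cbox 0 (1/2))"
      by (rule has_vector_derivative_transform[where f = "\<lambda>_. y"])
        (auto simp: joinpaths_def linepath_refl)
  qed auto
  have g: "horizontal_path ?g" "path_len ?g = path_len \<gamma>2"
    using join_horizontal[OF constant_path(1) h(2) _ j] e by (simp_all add: constant_path)
  have j': "v = 0" if v: "((\<gamma>1 +++ ?g) has_vector_derivative v) (at (1/2))" for v
  proof (rule vector_derivative_unique_within_closed_interval[of "1/2" "3/4" "1/2"])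
    show "((\<gamma>1 +++ ?g) has_vector_derivative v) (at (1/2) within cbox (1/2) (3/4))"
      using v by (rule has_vector_derivative_at_within)
    show "((\<gamma>1 +++ ?g) has_vector_derivative 0) (at (1/2) within cbox (1/2) (3/4))"
      by (rule has_vector_derivative_transform[where f = "\<lambda>_. y"])
        (use e in \<open>auto simp: joinpaths_def linepath_refl pathfinish_def mult.commute[of 2]\<close>)
  qed auto
  have "pathfinish \<gamma>1 = pathstart ?g"
    using e by simp
  from join_horizontal[OF h(1) g(1) this j'] show ?thesis
    using cc_dist_le[of "\<gamma>1 +++ ?g" "pathstart \<gamma>1" "pathfinish \<gamma>2"] g(2) by simp
qed

lemma cc_dist_triangle: "cc_dist x z \<le> cc_dist x y + cc_dist y z"
proof (rule ennreal_le_epsilon)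
  fix e :: real
  assume fin: "cc_dist x y + cc_dist y z < top" and e: "0 < e"
  have *: "\<exists>\<gamma>. horizontal_path \<gamma> \<and> pathstart \<gamma> = a \<and> pathfinish \<gamma> = b \<and> path_len \<gamma> < cc_dist a b + ennreal (e/2)"
    if "cc_dist a b < top" for a b :: "'a heis"
  proof -
    have "cc_dist a b < cc_dist a b + ennreal (e/2)"
      using that e ennreal_add_left_cancel_less[of "cc_dist a b" 0 "ennreal (e/2)"] by (auto simp: less_top)
    then show ?thesis
      unfolding cc_dist_def[of a b] INF_less_iff by auto
  qed
  obtain \<gamma>1 \<gamma>2 where \<gamma>: "horizontal_path \<gamma>1" "pathstart \<gamma>1 = x" "pathfinish \<gamma>1 = y" "path_len \<gamma>1 < cc_dist x y + ennreal (e/2)"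
    "horizontal_path \<gamma>2" "pathstart \<gamma>2 = y" "pathfinish \<gamma>2 = z" "path_len \<gamma>2 < cc_dist y z + ennreal (e/2)"
    using *[of x y] *[of y z] fin by (auto simp: less_top[symmetric])
  have "cc_dist x z \<le> path_len \<gamma>1 + path_len \<gamma>2"
    using cc_dist_path_triangle[OF \<gamma>(1,5,3,6)] \<gamma> by simp
  also have "\<dots> \<le> (cc_dist x y + ennreal (e/2)) + (cc_dist y z + ennreal (e/2))"
    using \<gamma> by (intro add_mono) auto
  also have "\<dots> = cc_dist x y + cc_dist y z + ennreal e"
    using e by (simp add: ennreal_plus[symmetric] ac_simps del: ennreal_plus)
  finally show "cc_dist x z \<le> cc_dist x y + cc_dist y z + ennreal e" .
qed

text \<open>On a horizontal path the vertical velocity is half the symplectic product of position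
  and velocity. The vertical coordinate is thus a swept area and grows at most quadratically with
  the length.\<close>

lemma horizontal_path_bounds:
  assumes h: "horizontal_path \<gamma>" and \<gamma>0: "\<gamma> 0 = 0" and len: "path_len \<gamma> = ennreal l" and l: "l \<ge> 0"
  shows "norm (hor (\<gamma> 1)) \<le> l" "\<bar>\<gamma> 1 $ iT\<bar> \<le> l\<^sup>2"
proof -
  obtain S D where SD: "finite S" "0 \<in> S" "1 \<in> S"
    "\<And>t. t \<in> {0..1} - S \<Longrightarrow> (\<gamma> has_vector_derivative D t) (at t)"
    "\<And>t. t \<in> S \<Longrightarrow> D t = 0"
    "\<And>t. t \<in> {0..1} \<Longrightarrow> cof (\<gamma> t) (D t) $ iT = 0"
    "(\<lambda>t. norm (hor (D t)) * indicator {0..1} t) \<in> borel_measurable borel"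
    "path_len \<gamma> = (\<integral>\<^sup>+t. ennreal (norm (hor (D t)) * indicator {0..1} t) \<partial>lborel)"
    "continuous_on {0..1} \<gamma>"
    using h by (rule horizontal_pathE) (rule that)
  let ?f = "\<lambda>t. norm (hor (D t)) * indicator {0..1} t"
  have I: "integrable lborel ?f" "integral\<^sup>L lborel ?f = l"
    using has_bochner_integral_nn_integral[of ?f lborel l] SD(7,8) len l
    by (auto simp: has_bochner_integral_iff)
  then have fl: "(?f has_integral l) UNIV"
    using has_integral_integral_lborel[OF I(1)] by simp
  have nf: "?f integrable_on {0..s}" "integral {0..s} ?f \<le> l" for s
  proof -
    show 1: "?f integrable_on {0..s}"
      using fl integrable_on_subinterval[of ?f UNIV 0 s] by (auto simp: integrable_on_def)
    show "integral {0..s} ?f \<le> l"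
      using integral_subset_le[of "{0..s}" UNIV ?f] 1 fl by (auto simp: has_integral_iff)
  qed
  have z: "norm (hor (\<gamma> s)) \<le> l" if s: "s \<in> {0..1}" for s
  proof -
    have "((\<lambda>t. hor (D t)) has_integral (hor (\<gamma> s) - hor (\<gamma> 0))) {0..s}"
      by (rule fundamental_theorem_of_calculus_interior_strong[OF SD(1)])
        (use s SD in \<open>auto intro!: bounded_linear.has_vector_derivative[OF bounded_linear_hor] SD(4)
          bounded_linear.continuous_on[OF bounded_linear_hor] continuous_on_subset[OF SD(9)]\<close>)
    then have "norm (hor (\<gamma> s) - hor (\<gamma> 0)) \<le> integral {0..s} ?f"
      using s by (intro integral_norm_bound_integral[of "\<lambda>t. hor (D t)" "{0..s}" ?f, THEN order_trans[rotated]] nf)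
        (auto simp: has_integral_iff)
    then show ?thesis
      using nf(2)[of s] by (simp add: \<gamma>0)
  qed
  then show "norm (hor (\<gamma> 1)) \<le> l" by simp
  have DT: "D t $ iT = om (\<gamma> t) (D t) / 2" if "t \<in> {0..1}" for t
    using SD(6)[OF that] by (simp add: cof_T)
  have "((\<lambda>t. D t $ iT) has_integral (\<gamma> 1 $ iT - \<gamma> 0 $ iT)) {0..1}"
    by (rule fundamental_theorem_of_calculus_interior_strong[OF SD(1)])
      (use SD in \<open>auto intro!: bounded_linear.has_vector_derivative[OF bounded_linear_vec_nth] SD(4)
        bounded_linear.continuous_on[OF bounded_linear_vec_nth]\<close>)
  moreover have "norm (integral {0..1} (\<lambda>t. D t $ iT)) \<le> integral {0..1} (\<lambda>t. l * ?f t)"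
  proof (rule integral_norm_bound_integral)
    show "(\<lambda>t. D t $ iT) integrable_on {0..1}"
      using calculation by blast
    show "(\<lambda>t. l * ?f t) integrable_on {0..1}"
      using nf(1)[of 1] by (rule integrable_on_mult_right)
    fix t :: real assume t: "t \<in> {0..1}"
    have "\<bar>om (\<gamma> t) (D t)\<bar> \<le> norm (hor (\<gamma> t)) * norm (hor (D t))"
      by (rule om_bound)
    also have "\<dots> \<le> l * norm (hor (D t))"
      using z[OF t] by (intro mult_right_mono) auto
    finally have "\<bar>om (\<gamma> t) (D t) / 2\<bar> \<le> l * norm (hor (D t))"
      by (simp add: abs_divide)
    then show "norm (D t $ iT) \<le> l * ?f t"
      using t DT[OF t] by simp
  qed
  ultimately have "\<bar>\<gamma> 1 $ iT\<bar> \<le> l * integral {0..1} ?f"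
    by (simp add: \<gamma>0 has_integral_iff)
  also have "\<dots> \<le> l * l"
    using nf(2)[of 1] l by (intro mult_left_mono) auto
  finally show "\<bar>\<gamma> 1 $ iT\<bar> \<le> l\<^sup>2"
    by (simp add: power2_eq_square)
qed

section \<open>The homogeneous norm: finiteness and two-sided bounds\<close>

definition hn :: "'n::finite heis \<Rightarrow> real" where
  "hn x = enn2real (cc_dist 0 x)"

lemma cc_dist_mult_le: "cc_dist 0 (heis_mult x y) \<le> cc_dist 0 x + cc_dist 0 y"
  using cc_dist_triangle[of 0 "heis_mult x y" x] cc_dist_left[of x 0 y] by simp

text \<open>A commutator of horizontal elements \<open>u\<close>, \<open>v\<close> is the vertical
  element with coordinate \<open>om u v\<close>, so four segments of length
  \<open>sqrt \<bar>t\<bar>\<close> reach it. Exchanging \<open>u\<close> and \<open>v\<close>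
  reverses the sign of the coordinate.\<close>

lemma cc_dist_vertical_le: "cc_dist 0 (t *\<^sub>R (eT :: 'n::finite heis)) \<le> ennreal (4 * sqrt \<bar>t\<bar>)"
proof -
  have *: "cc_dist 0 (om u v *\<^sub>R (eT :: 'n heis)) \<le> ennreal (4 * a)"
    if "norm u = a" "norm v = a" "u $ iT = 0" "v $ iT = 0" for u v :: "'n heis" and a
  proof -
    have a: "a \<ge> 0" using that(1) by force
    have eq: "om u v *\<^sub>R (eT :: 'n heis) = heis_mult (heis_mult u v) (heis_mult (- u) (- v))"
      by (rule heis_eqI) (simp_all add: heis_mult_om om_simps om_swap[of v u])
    have "cc_dist 0 (om u v *\<^sub>R (eT :: 'n heis)) \<le> (cc_dist 0 u + cc_dist 0 v) + (cc_dist 0 (- u) + cc_dist 0 (- v))"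
      unfolding eq by (intro order_trans[OF cc_dist_mult_le] add_mono cc_dist_mult_le)
    also have "\<dots> \<le> (ennreal (norm u) + ennreal (norm v)) + (ennreal (norm (- u)) + ennreal (norm (- v)))"
      by (intro add_mono cc_dist_horizontal_le) (use that in auto)
    also have "\<dots> = ennreal (4 * a)"
      using that a by (simp add: ennreal_plus[symmetric] del: ennreal_plus)
    finally show ?thesis .
  qed
  define a where "a = sqrt \<bar>t\<bar>"
  have a: "a * a = \<bar>t\<bar>" "a \<ge> 0" by (auto simp: a_def)
  obtain i :: 'n where True by simp
  let ?X = "axis (iX i) 1 :: 'n heis" and ?Y = "axis (iY i) 1 :: 'n heis"
  have "symp_rot ?X = ?Y"
    by (rule heis_eqI) (auto simp: axis_def)
  then have XY: "om ?X ?Y = 1"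
    by (metis inner_symp_rot inner_axis_axis inner_real_def mult_1)
  have n: "norm (a *\<^sub>R ?X) = a" "norm (a *\<^sub>R ?Y) = a" "(a *\<^sub>R ?X) $ iT = 0" "(a *\<^sub>R ?Y) $ iT = 0"
  proof -
    have "?X $ iT = 0" "?Y $ iT = 0" by (simp_all add: axis_def)
    then show "norm (a *\<^sub>R ?X) = a" "norm (a *\<^sub>R ?Y) = a" "(a *\<^sub>R ?X) $ iT = 0" "(a *\<^sub>R ?Y) $ iT = 0"
      using a by (simp_all add: norm_axis_1)
  qed
  show ?thesis
  proof (cases "t \<ge> 0")
    case True
    with *[of "a *\<^sub>R ?X" a "a *\<^sub>R ?Y", OF n] a show ?thesis
      by (simp add: om_simps XY a_def)
  next
    case False
    with *[of "a *\<^sub>R ?Y" a "a *\<^sub>R ?X", OF n(2,1,4,3)] a show ?thesis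
      by (simp add: om_simps om_swap[of ?Y ?X] XY a_def)
  qed
qed

lemma heis_mult_hor_T: "x = heis_mult (hor x) ((x $ iT) *\<^sub>R eT)"
  by (simp add: heis_mult_om om_simps hor_decomp[symmetric])

lemma cc_dist_bound:
  fixes x :: "'n::finite heis"
  shows "cc_dist 0 x \<le> ennreal (norm (hor x) + 4 * sqrt \<bar>x $ iT\<bar>)"
proof -
  have "cc_dist 0 x \<le> cc_dist 0 (hor x) + cc_dist 0 ((x $ iT) *\<^sub>R (eT :: 'n heis))"
    using cc_dist_mult_le[of "hor x" "(x $ iT) *\<^sub>R eT"] by (simp add: heis_mult_hor_T[symmetric])
  also have "\<dots> \<le> ennreal (norm (hor x)) + ennreal (4 * sqrt \<bar>x $ iT\<bar>)"
    by (intro add_mono cc_dist_horizontal_le cc_dist_vertical_le) simp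
  finally show ?thesis by simp
qed

lemma cc_dist_0: "cc_dist 0 x = ennreal (hn x)"
proof -
  have "cc_dist 0 x < top"
    using cc_dist_bound[of x] by (rule le_less_trans) simp
  then show ?thesis
    by (simp add: hn_def)
qed

lemma cc_dist_hn: "cc_dist x y = ennreal (hn (heis_mult (- x) y))"
  using cc_dist_left[of "- x" x y] by (simp add: cc_dist_0)

lemma hn_nonneg [simp]: "hn x \<ge> 0"
  by (simp add: hn_def)

lemma hn_upper: "hn x \<le> norm (hor x) + 4 * sqrt \<bar>x $ iT\<bar>"
  using cc_dist_bound[of x] by (simp add: cc_dist_0 del: ennreal_plus)

lemma hn_0 [simp]: "hn (0 :: 'n::finite heis) = 0"
  using hn_upper[of "0 :: 'n heis"] hn_nonneg[of "0 :: 'n heis"] by (simp del: hn_nonneg)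

lemma hn_mult_le: "hn (heis_mult x y) \<le> hn x + hn y"
  using cc_dist_mult_le[of x y] by (simp add: cc_dist_0 ennreal_plus[symmetric] del: ennreal_plus)

lemma hn_lower: "norm (hor x) \<le> hn x" "\<bar>x $ iT\<bar> \<le> (hn x)\<^sup>2"
proof -
  have *: "norm (hor x) \<le> hn x + e \<and> sqrt \<bar>x $ iT\<bar> \<le> hn x + e" if e: "e > 0" for e
  proof -
    have "cc_dist 0 x < ennreal (hn x + e)"
      using e by (simp add: cc_dist_0 ennreal_less_iff)
    then obtain \<gamma> where g: "horizontal_path \<gamma>" "pathstart \<gamma> = 0" "pathfinish \<gamma> = x" "path_len \<gamma> < ennreal (hn x + e)"
      unfolding cc_dist_def INF_less_iff by auto
    then obtain l where l: "path_len \<gamma> = ennreal l" "l \<ge> 0"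
      by (metis ennreal_cases ennreal_less_top less_trans order_less_irrefl infinity_ennreal_def)
    have "l < hn x + e"
      using g(4) l by (simp add: ennreal_less_iff)
    moreover note horizontal_path_bounds[OF g(1) _ l]
    moreover have "\<gamma> 0 = 0" "\<gamma> 1 = x"
      using g by (auto simp: pathstart_def pathfinish_def)
    moreover have "sqrt \<bar>x $ iT\<bar> \<le> l" if "\<bar>x $ iT\<bar> \<le> l\<^sup>2"
      using that l by (simp add: real_le_lsqrt)
    ultimately show ?thesis by auto
  qed
  show "norm (hor x) \<le> hn x"
    by (rule field_le_epsilon) (use * in blast)
  have "sqrt \<bar>x $ iT\<bar> \<le> hn x"
    by (rule field_le_epsilon) (use * in blast)
  then show "\<bar>x $ iT\<bar> \<le> (hn x)\<^sup>2"
    by (simp add: sqrt_le_D)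
qed

lemma hn_auto_le:
  fixes A :: "'n::finite heis \<Rightarrow> 'n heis"
  assumes "linear A" "inj A" "l > 0" "\<tau> \<noteq> 0"
    and "\<And>x y. om (A x) (A y) = \<tau> * om x y" and "\<And>x. A x $ iT = \<tau> * x $ iT"
    and "\<And>x. norm (hor (A x)) \<le> l * norm (hor x)" and "A eT = \<tau> *\<^sub>R eT"
  shows "hn (A x) \<le> l * hn x"
  using cc_dist_auto_le[OF assms, of 0 x] linear_0[OF assms(1)] assms(3)
  by (simp add: cc_dist_0 ennreal_mult'[symmetric])

section \<open>Dilations, unitary maps and inversion\<close>

definition dil :: "real \<Rightarrow> 'n::finite heis \<Rightarrow> 'n heis" where
  "dil r x = r *\<^sub>R hor x + (r\<^sup>2 * x $ iT) *\<^sub>R eT"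

lemma dil_nth [simp]: "dil r x $ iT = r\<^sup>2 * x $ iT" "hor (dil r x) = r *\<^sub>R hor x"
  by (simp_all add: dil_def hor_add hor_scale)

lemma dil_mult: "dil r (heis_mult x y) = heis_mult (dil r x) (dil r y)"
  by (rule heis_eqI) (simp_all add: heis_mult_om dil_def om_simps power2_eq_square algebra_simps)

lemma dil_uminus: "dil r (- x) = - dil r x"
  by (simp add: dil_def hor_uminus)

lemma dil_dil: "dil r (dil s x) = dil (r * s) x"
  by (simp add: dil_def hor_add hor_scale power_mult_distrib)

lemma dil_1 [simp]: "dil 1 x = x"
  using hor_decomp[of x] by (simp add: dil_def)

lemma hn_dil:
  assumes "r > 0" shows "hn (dil r x) = r * hn x"
proof -
  have *: "hn (dil r x) \<le> r * hn x" if r: "r > 0" for r x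
  proof (rule hn_auto_le[where \<tau> = "r\<^sup>2"])
    show "linear (dil r)"
      by (rule linearI) (auto simp: dil_def hor_add hor_scale algebra_simps)
    show "inj (dil r)"
      using r by (intro inj_on_inverseI[where g = "dil (1 / r)"]) (simp add: dil_dil)
    show "om (dil r u) (dil r v) = r\<^sup>2 * om u v" for u v
      by (simp add: dil_def om_simps power2_eq_square)
  qed (use r in \<open>auto simp: dil_def hor_add hor_scale\<close>)
  have "hn (dil (1/r) (dil r x)) \<le> (1/r) * hn (dil r x)"
    using assms by (intro *) simp
  then have "r * hn x \<le> hn (dil r x)"
    using assms by (simp add: dil_dil field_simps)
  then show ?thesis
    using *[OF assms, of x] by simp
qed

text \<open>
  The isometries used here are the complex Householder reflections of the horizontal layer: with
  \<open>w = x - y\<close>, subtract from \<open>v\<close> the complex multiple of \<open>w\<close> that sends \<open>x\<close> to \<open>y\<close>.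
\<close>

lemma hn_rotation_le:
  fixes x y :: "'n::finite heis"
  assumes n: "norm (hor x) = norm (hor y)" and T: "x $ iT = y $ iT"
  shows "hn y \<le> hn x"
proof (cases "hor x = hor y")
  case True
  then have "x = y"
    using hor_decomp[of x] hor_decomp[of y] T by simp
  then show ?thesis by simp
next
  case False
  define w where "w = hor x - hor y"
  \<comment> \<open>For the Hermitian product \<open>inner v w - i * om v w\<close>, the number
    \<open>d1 + i * d2\<close> is its value at \<open>x\<close> and \<open>al v + i * be v\<close>
    is the quotient of its value at \<open>v\<close> by that at \<open>x\<close>, hence 1 for
    \<open>v = x\<close>. The map is unitary because \<open>inner w w = 2 * d1\<close>, which is
    where the equality of norms enters.\<close>
  define d1 where "d1 = inner (hor x) w"
  define d2 where "d2 = - om x w"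
  define N where "N = d1\<^sup>2 + d2\<^sup>2"
  define al where "al v = (inner v w * d1 - om v w * d2) / N" for v
  define be where "be v = (- inner v w * d2 - om v w * d1) / N" for v
  define A where "A v = v - al v *\<^sub>R w - be v *\<^sub>R symp_rot w" for v
  have wT: "w $ iT = 0" by (simp add: w_def)
  have hw: "hor w = w" using wT by (rule hor_id)
  have ww: "inner w w = 2 * d1"
    using n by (simp add: d1_def w_def inner_diff_left inner_diff_right norm_eq inner_commute)
  have "inner w w > 0"
    using False by (simp add: w_def)
  then have d1: "d1 > 0" using ww by simp
  then have N: "N > 0" by (simp add: N_def sum_power2_gt_zero_iff)
  have Jw: "inner v (symp_rot w) = - om v w" "inner (symp_rot w) v = - om v w" "om w v = - om v w"
      "om v (symp_rot w) = inner v w" "om (symp_rot w) v = - inner v w" for v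
  proof -
    show "inner (symp_rot w) v = - om v w" by (simp add: inner_symp_rot om_swap[of w v])
    then show "inner v (symp_rot w) = - om v w" by (simp add: inner_commute)
    show "om w v = - om v w" by (rule om_swap)
    have "inner (hor v) w = inner v w"
      by (simp add: inner_heis wT)
    then show "om v (symp_rot w) = inner v w" by (simp add: om_symp_rot)
    then show "om (symp_rot w) v = - inner v w" by (simp add: om_swap[of "symp_rot w" v])
  qed
  have linA: "linear A"
    by (rule linearI)
      (auto simp: A_def al_def be_def om_simps inner_add_left algebra_simps diff_divide_distrib
        add_divide_distrib scaleR_add_left scaleR_diff_left)
  have AT: "A v $ iT = v $ iT" for v
    by (simp add: A_def wT)
  have Anorm: "inner (A v) (A v) = inner v v" for v
  proof -
    have "inner (A v) (A v) = inner v v - 2 * al v * inner v w + 2 * be v * om v w + ((al v)\<^sup>2 + (be v)\<^sup>2) * (2 * d1)"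
      by (simp add: A_def inner_diff_left inner_diff_right Jw ww inner_commute[of w v]
          norm_symp_rot hw dot_square_norm[of "symp_rot w"] dot_square_norm[of w, symmetric]
          power2_eq_square om_simps algebra_simps)
    also have "\<dots> = inner v v"
      using N by (simp add: al_def be_def power_divide field_simps power2_eq_square)
        (simp add: N_def power2_eq_square algebra_simps)
    finally show ?thesis .
  qed
  have Aom: "om (A u) (A v) = om u v" for u v
  proof -
    have "om (A u) (A v) = om u v - al v * om u w - be v * inner u w + al u * om v w + be u * inner v w
        + 2 * d1 * (al u * be v - be u * al v)"
      by (simp add: A_def om_simps Jw ww algebra_simps)
    also have "\<dots> = om u v"
      using N by (simp add: al_def be_def field_simps)
        (simp add: N_def power2_eq_square algebra_simps)
    finally show ?thesis .
  qed
  have injA: "inj A"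
    using Anorm by (metis inner_eq_zero_iff linA linear_injective_0)
  have hA: "norm (hor (A v)) = norm (hor v)" for v
  proof -
    have "(norm (A v))\<^sup>2 = (norm v)\<^sup>2"
      using Anorm[of v] by (simp add: dot_square_norm)
    then show ?thesis
      using norm_hor_sq[of "A v"] norm_hor_sq[of v] AT[of v] by simp
  qed
  have "A x = y"
  proof -
    have xw: "inner x w = d1" "om x w = - d2"
      by (simp_all add: d1_def d2_def inner_heis wT)
    have "al x = 1" "be x = 0"
      using N by (simp_all add: al_def be_def xw, simp_all add: N_def power2_eq_square)
    then show ?thesis
      using T by (simp add: A_def w_def hor_def)
  qed
  moreover have "hn (A x) \<le> 1 * hn x"
    by (rule hn_auto_le[OF linA injA, where \<tau> = 1])
      (auto simp: Aom AT hA, simp add: A_def al_def be_def wT)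
  ultimately show ?thesis by simp
qed

lemma hn_rotation:
  fixes x y :: "'n::finite heis"
  shows "\<lbrakk>norm (hor x) = norm (hor y); x $ iT = y $ iT\<rbrakk> \<Longrightarrow> hn x = hn y"
  by (intro antisym hn_rotation_le) auto

text \<open>Exchanging the coordinates \<open>iX i\<close> and \<open>iY i\<close> reverses the
  symplectic form, so together with a sign change of the vertical coordinate it is an automorphism.
  It reaches the vertical coordinate of \<open>- x\<close>, and a rotation does the rest. Symmetry
  of the distance follows without reversing paths.\<close>

lemma hn_uminus [simp]: "hn (- x) = hn x"
proof -
  define swp :: "'a heis \<Rightarrow> 'a heis" where
    "swp v = (\<chi> k. case k of Inl i \<Rightarrow> v $ iY i | Inr l \<Rightarrow> (case l of Inl i \<Rightarrow> v $ iX i | Inr _ \<Rightarrow> - v $ iT))" for v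
  have s: "swp v $ iX i = v $ iY i" "swp v $ iY i = v $ iX i" "swp v $ iT = - v $ iT" for v i
    by (simp_all add: swp_def)
  have h: "norm (hor (swp v)) = norm (hor v)" for v
    by (simp add: norm_eq_sqrt_inner inner_heis s add.commute)
  have *: "hn (swp v) \<le> 1 * hn v" for v
  proof (rule hn_auto_le[where \<tau> = "-1"])
    show "linear swp"
      by (rule linearI) (auto intro!: heis_eqI simp: s)
    show "inj swp"
      by (rule inj_on_inverseI[where g = swp]) (auto intro!: heis_eqI simp: s)
    show "om (swp u) (swp v) = - 1 * om u v" for u v
      by (simp add: om_def s sum_subtractf mult.commute)
    show "swp eT = - 1 *\<^sub>R eT"
      by (rule heis_eqI) (simp_all add: s)
  qed (auto simp: s h)
  have "hn (- x) = hn (swp x)" for x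
    by (rule hn_rotation) (simp_all add: h s hor_uminus)
  then have "hn (- x) \<le> hn x" for x :: "'a heis"
    using *[of x] by simp
  from this[of x] this[of "- x"] show ?thesis by simp
qed

lemma hn_continuous: "continuous_on UNIV (hn :: 'n::finite heis \<Rightarrow> real)"
proof -
  have *: "\<bar>hn y - hn x\<bar> \<le> hn (cof x (y - x))" for x y :: "'n heis"
  proof -
    have "hn y \<le> hn x + hn (heis_mult (- x) y)"
      using hn_mult_le[of x "heis_mult (- x) y"] by simp
    moreover have "hn x \<le> hn y + hn (heis_mult (- y) x)"
      using hn_mult_le[of y "heis_mult (- y) x"] by simp
    moreover have "hn (heis_mult (- y) x) = hn (heis_mult (- x) y)"
      using hn_uminus[of "heis_mult (- y) x"] by (simp add: heis_inv_mult)
    ultimately show ?thesis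
      by (simp add: ldiff_cof abs_if)
  qed
  have "(hn \<longlongrightarrow> hn x) (at x)" for x :: "'n heis"
  proof -
    have "((\<lambda>y. norm (hor (y - x)) + 4 * sqrt \<bar>cof x (y - x) $ iT\<bar>) \<longlongrightarrow> norm (hor (x - x)) + 4 * sqrt \<bar>cof x (x - x) $ iT\<bar>) (at x)"
      by (intro tendsto_intros bounded_linear.tendsto[OF bounded_linear_hor]
          bounded_linear.tendsto[OF linear_linear[THEN iffD2, OF linear_cof]])
    then have "((\<lambda>y. norm (hor (y - x)) + 4 * sqrt \<bar>cof x (y - x) $ iT\<bar>) \<longlongrightarrow> 0) (at x)"
      by simp
    then have "((\<lambda>y. hn y - hn x) \<longlongrightarrow> 0) (at x)"
    proof (rule Lim_null_comparison[rotated])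
      show "\<forall>\<^sub>F y in at x. norm (hn y - hn x) \<le> norm (hor (y - x)) + 4 * sqrt \<bar>cof x (y - x) $ iT\<bar>"
      proof (intro always_eventually allI)
        fix y
        show "norm (hn y - hn x) \<le> norm (hor (y - x)) + 4 * sqrt \<bar>cof x (y - x) $ iT\<bar>"
          using *[of y x] hn_upper[of "cof x (y - x)"] by simp
      qed
    qed
    then show ?thesis
      by (rule LIM_zero_cancel)
  qed
  then show ?thesis
    by (simp add: continuous_on_def)
qed

section \<open>Spherical Hausdorff measure\<close>

locale distance =
  fixes rr :: "'a \<Rightarrow> 'a \<Rightarrow> real" and d :: nat
  assumes rr_nonneg: "rr x y \<ge> 0" and rr_refl: "rr x x = 0" and rr_sym: "rr x y = rr y x"
    and rr_tri: "rr x z \<le> rr x y + rr y z" and d_pos: "d > 0"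
begin

abbreviation sc :: "real \<Rightarrow> 'a set \<Rightarrow> ennreal" where
  "sc \<equiv> spherical_content (\<lambda>x y. ennreal (rr x y)) d"

abbreviation sh :: "'a set \<Rightarrow> ennreal" where
  "sh \<equiv> spherical_hausdorff (\<lambda>x y. ennreal (rr x y)) d"

definition Bl :: "'a \<Rightarrow> real \<Rightarrow> 'a set" where
  "Bl c r = {y. rr c y \<le> r}"

lemma ball_eq: "r > 0 \<Longrightarrow> {y. ennreal (rr c y) \<le> ennreal r} = Bl c r"
  by (auto simp: Bl_def)

lemma sc_le:
  assumes "\<And>i. 0 < r i" "\<And>i. r i \<le> \<delta>" "A \<subseteq> (\<Union>i. Bl (c i) (r i))"
  shows "sc \<delta> A \<le> (\<Sum>i. ennreal (r i ^ d))"
  unfolding spherical_content_def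
  by (rule INF_lower2[of "(c, r)"]) (use assms in \<open>auto simp: ball_eq\<close>)

lemma sc_less_ex:
  assumes "sc \<delta> A < a"
  shows "\<exists>c r. (\<forall>i. 0 < r i) \<and> (\<forall>i. r i \<le> \<delta>) \<and> A \<subseteq> (\<Union>i. Bl (c i) (r i)) \<and>
    (\<Sum>i::nat. ennreal (r i ^ d)) < a"
proof -
  from assms obtain c r where *: "\<forall>i. 0 < r i \<and> r i \<le> \<delta>"
    "A \<subseteq> (\<Union>i. {y. ennreal (rr (c i) y) \<le> ennreal (r i)})" "(\<Sum>i. ennreal (r i ^ d)) < a"
    unfolding spherical_content_def INF_less_iff by auto
  moreover have "{y. ennreal (rr (c i) y) \<le> ennreal (r i)} = Bl (c i) (r i)" for i
    using * by (intro ball_eq) auto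
  ultimately show ?thesis
    by (intro exI[of _ c] exI[of _ r]) auto
qed

lemma sc_mono: "A \<subseteq> B \<Longrightarrow> sc \<delta> A \<le> sc \<delta> B"
  unfolding spherical_content_def by (rule INF_superset_mono) auto

lemma sc_antimono: "\<delta> \<le> \<delta>' \<Longrightarrow> sc \<delta>' A \<le> sc \<delta> A"
  unfolding spherical_content_def by (rule INF_superset_mono) (auto intro: order_trans)

text \<open>A cover is an infinite sequence of balls of positive radius, so a single ball has to be
  padded. Since \<open>d > 0\<close>, padding by radii \<open>s * (1/2) ^ i\<close> with
  \<open>s \<le> 1\<close> costs at most \<open>s\<close>, which is as small as desired.\<close>

lemma sc_ball:
  assumes "0 < r" "r \<le> \<delta>"
  shows "sc \<delta> (Bl c r) \<le> ennreal (r ^ d)"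
proof (rule ennreal_le_epsilon)
  fix e :: real assume e: "0 < e"
  define s where "s = min (min r 1) (e / 2)"
  have s: "0 < s" "s \<le> r" "s \<le> 1" "s \<le> e / 2"
    using e assms by (auto simp: s_def)
  define q where "q i = (if i = 0 then r else s * (1/2) ^ i)" for i :: nat
  have q: "0 < q i" "q i \<le> \<delta>" for i
  proof -
    show "0 < q i" using s assms by (simp add: q_def)
    have "s * (1/2) ^ i \<le> s * 1"
      using s by (intro mult_left_mono power_le_one) auto
    then have "s * (1/2) ^ i \<le> \<delta>" using s assms by linarith
    then show "q i \<le> \<delta>" using assms by (simp add: q_def)
  qed
  have "sc \<delta> (Bl c r) \<le> (\<Sum>i. ennreal (q i ^ d))"
    by (rule sc_le[where c = "\<lambda>_. c"]) (use q in \<open>auto simp: q_def intro!: exI[of _ 0]\<close>)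
  also have "\<dots> = ennreal (r ^ d) + (\<Sum>i. ennreal (q (Suc i) ^ d))"
    using suminf_offset[of "\<lambda>i. ennreal (q i ^ d)" 1] by (simp add: q_def)
  also have "(\<Sum>i. ennreal (q (Suc i) ^ d)) \<le> (\<Sum>i. ennreal (s * (1/2) ^ Suc i))"
  proof (intro suminf_le ennreal_leI)
    fix i
    have q': "q (Suc i) = s * (1/2) ^ Suc i" by (simp add: q_def)
    have "s * (1/2) ^ Suc i \<le> 1"
      using s by (intro mult_le_one power_le_one) auto
    then have "(s * (1/2) ^ Suc i) ^ d \<le> (s * (1/2) ^ Suc i) ^ 1"
      using s d_pos by (intro power_decreasing) auto
    then show "q (Suc i) ^ d \<le> s * (1/2) ^ Suc i"
      by (simp only: q' power_one_right)
  qed auto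
  also have "\<dots> = ennreal s"
  proof (rule suminf_ennreal_eq)
    show "0 \<le> s * (1/2) ^ Suc i" for i using s by simp
    show "(\<lambda>i. s * (1/2) ^ Suc i) sums s"
      using sums_mult[OF power_half_series, of s] by simp
  qed
  also have "\<dots> \<le> ennreal e"
    using s by (intro ennreal_leI) auto
  finally show "sc \<delta> (Bl c r) \<le> ennreal (r ^ d) + ennreal e"
    by (simp add: add_left_mono)
qed

lemma sc_empty [simp]: "\<delta> > 0 \<Longrightarrow> sc \<delta> {} = 0"
proof -
  assume \<delta>: "\<delta> > 0"
  have *: "sc \<delta> {} \<le> 0 + ennreal e" if e: "e > 0" for e :: real
  proof -
    define r where "r = min (min \<delta> 1) e"
    have r: "0 < r" "r \<le> \<delta>" "r \<le> 1" "r \<le> e" using \<delta> e by (auto simp: r_def)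
    have "sc \<delta> {} \<le> sc \<delta> (Bl undefined r)" by (rule sc_mono) simp
    also have "\<dots> \<le> ennreal (r ^ d)" by (rule sc_ball) (use r in auto)
    also have "\<dots> \<le> ennreal e"
      using power_decreasing[of 1 d r] r d_pos by (intro ennreal_leI) auto
    finally show ?thesis by simp
  qed
  have "sc \<delta> {} \<le> 0"
    by (rule ennreal_le_epsilon) (rule *)
  then show ?thesis by simp
qed

lemma sc_subadd:
  fixes A :: "nat \<Rightarrow> 'a set"
  shows "sc \<delta> (\<Union>i. A i) \<le> (\<Sum>i. sc \<delta> (A i))"
proof (rule ennreal_le_epsilon)
  fix e :: real assume fin: "(\<Sum>i. sc \<delta> (A i)) < top" and e: "0 < e"
  have lt: "sc \<delta> (A i) < sc \<delta> (A i) + ennreal (e * (1/2) ^ Suc i)" for i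
  proof -
    have "sc \<delta> (A i) \<noteq> top"
      using ennreal_suminf_lessD[OF fin] by (simp add: less_top[symmetric])
    then show ?thesis
      using ennreal_add_left_cancel_less[of "sc \<delta> (A i)" 0 "ennreal (e * (1/2) ^ Suc i)"] e by auto
  qed
  define P where "P i c r \<longleftrightarrow> (\<forall>j. 0 < r j) \<and> (\<forall>j. r j \<le> \<delta>) \<and> A i \<subseteq> (\<Union>j. Bl (c j) (r j)) \<and>
    (\<Sum>j::nat. ennreal (r j ^ d)) < sc \<delta> (A i) + ennreal (e * (1/2) ^ Suc i)" for i c r
  have "\<forall>i. \<exists>c r. P i c r"
    unfolding P_def by (intro allI sc_less_ex lt)
  then obtain c r where "\<And>i. P i (c i) (r i)"
    by metis
  then have cr: "\<And>i j. 0 < r i j" "\<And>i j. r i j \<le> \<delta>"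
    "\<And>i. A i \<subseteq> (\<Union>j. Bl (c i j) (r i j))"
    "\<And>i. (\<Sum>j. ennreal (r i j ^ d)) < sc \<delta> (A i) + ennreal (e * (1/2) ^ Suc i)"
    unfolding P_def by blast+
  have "sc \<delta> (\<Union>i. A i) \<le> (\<Sum>n. ennreal (case_prod r (prod_decode n) ^ d))"
  proof (rule sc_le[where c = "\<lambda>n. case_prod c (prod_decode n)"])
    show "(\<Union>i. A i) \<subseteq> (\<Union>n. Bl (case_prod c (prod_decode n)) (case_prod r (prod_decode n)))"
    proof
      fix x assume "x \<in> (\<Union>i. A i)"
      then obtain i j where "x \<in> Bl (c i j) (r i j)" using cr(3) by blast
      then have "x \<in> Bl (case_prod c (prod_decode (prod_encode (i, j)))) (case_prod r (prod_decode (prod_encode (i, j))))"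
        by simp
      then show "x \<in> (\<Union>n. Bl (case_prod c (prod_decode n)) (case_prod r (prod_decode n)))"
        by blast
    qed
  qed (use cr in \<open>auto split: prod.split\<close>)
  also have "\<dots> = (\<Sum>i. \<Sum>j. ennreal (r i j ^ d))"
    using suminf_ennreal_2dimen[of "\<lambda>i. \<Sum>j. ennreal (r i j ^ d)" "\<lambda>p. ennreal (case_prod r p ^ d)"]
    by (simp add: comp_def)
  also have "\<dots> \<le> (\<Sum>i. sc \<delta> (A i) + ennreal (e * (1/2) ^ Suc i))"
    by (intro suminf_le less_imp_le[OF cr(4)]) auto
  also have "\<dots> = (\<Sum>i. sc \<delta> (A i)) + (\<Sum>i. ennreal (e * (1/2) ^ Suc i))"
    by (rule suminf_add[symmetric]) auto
  also have "(\<Sum>i. ennreal (e * (1/2) ^ Suc i)) = ennreal e"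
  proof (rule suminf_ennreal_eq)
    show "0 \<le> e * (1/2) ^ Suc i" for i using e by simp
    show "(\<lambda>i. e * (1/2) ^ Suc i) sums e"
      using sums_mult[OF power_half_series, of e] by simp
  qed
  finally show "sc \<delta> (\<Union>i. A i) \<le> (\<Sum>i. sc \<delta> (A i)) + ennreal e" .
qed

lemma sc_Un: "\<delta> > 0 \<Longrightarrow> sc \<delta> (A \<union> B) \<le> sc \<delta> A + sc \<delta> B"
proof -
  assume \<delta>: "\<delta> > 0"
  have "(\<Union>i. (\<lambda>i::nat. if i = 0 then A else if i = 1 then B else {}) i) = A \<union> B"
    by (auto split: if_splits)
  then have "sc \<delta> (A \<union> B) \<le> (\<Sum>i. sc \<delta> ((\<lambda>i::nat. if i = 0 then A else if i = 1 then B else {}) i))"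
    using sc_subadd[of \<delta> "\<lambda>i::nat. if i = 0 then A else if i = 1 then B else {}"] by simp
  also have "\<dots> = (\<Sum>i\<in>{0,1::nat}. sc \<delta> (if i = 0 then A else if i = 1 then B else {}))"
    by (rule suminf_finite) (use \<delta> in auto)
  finally show ?thesis by simp
qed

lemma sc_UN_finite: "\<lbrakk>finite I; \<delta> > 0\<rbrakk> \<Longrightarrow> sc \<delta> (\<Union>i\<in>I. A i) \<le> (\<Sum>i\<in>I. sc \<delta> (A i))"
proof (induction I rule: finite_induct)
  case (insert i I)
  have "sc \<delta> (\<Union>i\<in>insert i I. A i) \<le> sc \<delta> (A i) + sc \<delta> (\<Union>i\<in>I. A i)"
    using sc_Un[OF insert.prems] by simp
  also have "\<dots> \<le> sc \<delta> (A i) + (\<Sum>i\<in>I. sc \<delta> (A i))"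
    using insert by (intro add_left_mono) auto
  finally show ?case using insert by simp
qed simp

lemma sh_mono: "A \<subseteq> B \<Longrightarrow> sh A \<le> sh B"
  unfolding spherical_hausdorff_def by (rule SUP_mono) (use sc_mono in blast)

lemma sc_le_sh: "\<delta> > 0 \<Longrightarrow> sc \<delta> A \<le> sh A"
  unfolding spherical_hausdorff_def by (rule SUP_upper) simp

lemma sh_leI: "(\<And>\<delta>. \<delta> > 0 \<Longrightarrow> sc \<delta> A \<le> a) \<Longrightarrow> sh A \<le> a"
  unfolding spherical_hausdorff_def by (rule SUP_least) simp

lemma sh_empty [simp]: "sh {} = 0"
  by (rule antisym[OF sh_leI]) auto

lemma sh_subadd: "sh (\<Union>i::nat. A i) \<le> (\<Sum>i. sh (A i))"
proof (rule sh_leI)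
  fix \<delta> :: real assume "\<delta> > 0"
  have "sc \<delta> (\<Union>i. A i) \<le> (\<Sum>i. sc \<delta> (A i))" by (rule sc_subadd)
  also have "\<dots> \<le> (\<Sum>i. sh (A i))"
    by (intro suminf_le sc_le_sh \<open>\<delta> > 0\<close>) auto
  finally show "sc \<delta> (\<Union>i. A i) \<le> (\<Sum>i. sh (A i))" .
qed

lemma sh_Un: "sh (A \<union> B) \<le> sh A + sh B"
proof (rule sh_leI)
  fix \<delta> :: real assume "\<delta> > 0"
  then have "sc \<delta> (A \<union> B) \<le> sc \<delta> A + sc \<delta> B" by (rule sc_Un)
  also have "\<dots> \<le> sh A + sh B" by (intro add_mono sc_le_sh \<open>\<delta> > 0\<close>)
  finally show "sc \<delta> (A \<union> B) \<le> sh A + sh B" .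
qed

text \<open>Two points of a ball of radius at most \<delta> are at most
  \<open>2 * \<delta> < e\<close> apart. Each ball of a cover therefore meets only one of the two
  sets and is charged to that set alone.\<close>

lemma sc_separated:
  assumes sep: "\<And>a b. \<lbrakk>a \<in> A; b \<in> B\<rbrakk> \<Longrightarrow> rr a b \<ge> e" and \<delta>: "0 < \<delta>" "4 * \<delta> \<le> e"
  shows "sc \<delta> A + sc \<delta> B \<le> sc \<delta> (A \<union> B)"
proof (rule ccontr)
  assume "\<not> ?thesis"
  then have "sc \<delta> (A \<union> B) < sc \<delta> A + sc \<delta> B" by simp
  from sc_less_ex[OF this] obtain c r where "(\<forall>i. 0 < r i) \<and> (\<forall>i. r i \<le> \<delta>) \<and>
      A \<union> B \<subseteq> (\<Union>i. Bl (c i) (r i)) \<and> (\<Sum>i::nat. ennreal (r i ^ d)) < sc \<delta> A + sc \<delta> B"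
    by (elim exE) (rule that)
  then have cr: "\<And>i. 0 < r i" "\<And>i. r i \<le> \<delta>" "A \<union> B \<subseteq> (\<Union>i. Bl (c i) (r i))"
      "(\<Sum>i. ennreal (r i ^ d)) < sc \<delta> A + sc \<delta> B"
    by auto
  have "sc \<delta> A \<le> (\<Sum>i. sc \<delta> (A \<inter> Bl (c i) (r i)))" "sc \<delta> B \<le> (\<Sum>i. sc \<delta> (B \<inter> Bl (c i) (r i)))"
    using cr(3) by (auto intro!: order_trans[OF sc_mono sc_subadd])
  then have "sc \<delta> A + sc \<delta> B \<le> (\<Sum>i. sc \<delta> (A \<inter> Bl (c i) (r i)) + sc \<delta> (B \<inter> Bl (c i) (r i)))"
    by (subst suminf_add[symmetric]) (simp_all add: add_mono)
  also have "\<dots> \<le> (\<Sum>i. ennreal (r i ^ d))"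
  proof (intro suminf_le)
    fix i
    have "A \<inter> Bl (c i) (r i) = {} \<or> B \<inter> Bl (c i) (r i) = {}"
    proof (rule ccontr)
      assume "\<not> ?thesis"
      then obtain a b where ab: "a \<in> A" "b \<in> B" "rr (c i) a \<le> r i" "rr (c i) b \<le> r i"
        by (auto simp: Bl_def)
      then have "rr a b \<le> 2 * \<delta>"
        using rr_tri[of a b "c i"] rr_sym[of a "c i"] cr(2)[of i] by linarith
      then show False using sep[OF ab(1,2)] \<delta> by linarith
    qed
    moreover have C: "sc \<delta> (C \<inter> Bl (c i) (r i)) \<le> ennreal (r i ^ d)" for C
      by (rule order_trans[OF sc_mono sc_ball[OF cr(1,2), of "c i" i]]) simp
    ultimately show "sc \<delta> (A \<inter> Bl (c i) (r i)) + sc \<delta> (B \<inter> Bl (c i) (r i)) \<le> ennreal (r i ^ d)"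
      using C[of A] C[of B] sc_empty[OF \<delta>(1)] by (elim disjE) simp_all
  qed simp_all
  finally show False using cr(4) by simp
qed

lemma sh_separated:
  assumes sep: "\<And>a b. \<lbrakk>a \<in> A; b \<in> B\<rbrakk> \<Longrightarrow> rr a b \<ge> e" and e: "0 < e"
  shows "sh A + sh B \<le> sh (A \<union> B)"
proof -
  have "sh A + sh B = (SUP \<delta>\<in>{0<..}. sc \<delta> A + sc \<delta> B)"
    unfolding spherical_hausdorff_def
  proof (rule SUP_add_directed_ennreal[symmetric])
    fix i j :: real assume "i \<in> {0<..}" "j \<in> {0<..}"
    then show "\<exists>k\<in>{0<..}. sc i A + sc j B \<le> sc k A + sc k B"
      by (intro bexI[of _ "min i j"] add_mono sc_antimono) auto
  qed
  also have "\<dots> \<le> sh (A \<union> B)"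
  proof (rule SUP_least)
    fix \<delta> :: real assume "\<delta> \<in> {0<..}"
    define \<delta>' where "\<delta>' = min \<delta> (e / 4)"
    have \<delta>': "\<delta>' > 0" "\<delta>' \<le> \<delta>" "4 * \<delta>' \<le> e" using e \<open>\<delta> \<in> {0<..}\<close> by (auto simp: \<delta>'_def)
    have "sc \<delta> A + sc \<delta> B \<le> sc \<delta>' A + sc \<delta>' B"
      by (intro add_mono sc_antimono \<delta>')
    also have "\<dots> \<le> sc \<delta>' (A \<union> B)"
      by (rule sc_separated[OF sep]) (use \<delta>' in auto)
    also have "\<dots> \<le> sh (A \<union> B)" by (rule sc_le_sh) fact
    finally show "sc \<delta> A + sc \<delta> B \<le> sh (A \<union> B)" .
  qed
  finally show ?thesis .
qed

text \<open>
  Caratheodory's criterion: \<open>E - F\<close> is exhausted by sets \<open>Ek k\<close> at positive distance from \<open>F\<close>; the layers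
  \<open>R j\<close> that are left over have summable measure since those of equal parity are separated.
\<close>

lemma sh_measurable:
  assumes sep: "\<And>y. y \<notin> F \<Longrightarrow> \<exists>e>0. \<forall>x\<in>F. rr y x \<ge> e" and ne: "F \<noteq> {}"
  shows "sh (F \<inter> E) + sh (E - F) \<le> sh E"
proof (cases "sh E = top")
  case False
  define f where "f y = (INF x\<in>F. rr y x)" for y
  have bdd: "bdd_below ((\<lambda>x. rr y x) ` F)" for y
    by (rule bdd_belowI[of _ 0]) (auto simp: rr_nonneg)
  have f_le: "f y \<le> rr y x" if "x \<in> F" for x y
    unfolding f_def by (rule cINF_lower[OF bdd that])
  have f_ge: "f y \<ge> e" if "\<forall>x\<in>F. rr y x \<ge> e" for e y
    unfolding f_def using ne that by (intro cINF_greatest) auto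
  have f_lip: "f y \<le> rr y z + f z" for y z
  proof -
    have "f y - rr y z \<le> f z"
    proof (rule f_ge, rule ballI)
      fix x assume "x \<in> F"
      then show "f y - rr y z \<le> rr z x"
        using f_le[of x y] rr_tri[of y x z] by simp
    qed
    then show ?thesis by simp
  qed
  have f_pos: "f y > 0" if "y \<notin> F" for y
    using sep[OF that] f_ge by fastforce
  define a where "a k = 1 / (real k + 1)" for k
  have a: "a k > 0" "a (Suc k) < a k" for k
    by (auto simp: a_def field_simps)
  have a_mono: "j \<le> k \<Longrightarrow> a k \<le> a j" for j k
    by (auto simp: a_def field_simps)
  define Ek where "Ek k = {y\<in>E. f y \<ge> a k}" for k
  define R where "R k = {y\<in>E. a (Suc k) \<le> f y \<and> f y < a k}" for k
  have 1: "sh (F \<inter> E) + sh (Ek k) \<le> sh E" for k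
  proof -
    have "sh (F \<inter> E) + sh (Ek k) \<le> sh ((F \<inter> E) \<union> Ek k)"
    proof (rule sh_separated[where e = "a k"])
      fix x y assume "x \<in> F \<inter> E" "y \<in> Ek k"
      then show "a k \<le> rr x y"
        using f_le[of x y] rr_sym[of x y] by (auto simp: Ek_def)
    qed (use a in auto)
    also have "\<dots> \<le> sh E" by (rule sh_mono) (auto simp: Ek_def)
    finally show ?thesis .
  qed
  have odd_even: "(\<Sum>j<n. sh (R (2 * j + i))) \<le> sh E" for n i
  proof -
    have "(\<Sum>j<n. sh (R (2 * j + i))) \<le> sh (\<Union>j<n. R (2 * j + i))"
    proof (induction n)
      case (Suc n)
      have "(\<Sum>j<Suc n. sh (R (2 * j + i))) \<le> sh (\<Union>j<n. R (2 * j + i)) + sh (R (2 * n + i))"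
        using Suc by (simp add: add_right_mono)
      also have "\<dots> \<le> sh ((\<Union>j<n. R (2 * j + i)) \<union> R (2 * n + i))"
      proof (cases "n = 0")
        case False
        show ?thesis
        \<comment> \<open>Layers of equal parity have a whole layer between them: \<open>f\<close>
          is 1-Lipschitz, and it drops by at least this difference of thresholds from one to the
          other.\<close>
        proof (rule sh_separated[where e = "a (2 * n + i - 1) - a (2 * n + i)"])
          fix x y assume "x \<in> (\<Union>j<n. R (2 * j + i))" "y \<in> R (2 * n + i)"
          then obtain j where j: "j < n" "a (Suc (2 * j + i)) \<le> f x" and y: "f y < a (2 * n + i)"
            by (auto simp: R_def)
          have "a (2 * n + i - 1) \<le> a (Suc (2 * j + i))"
            using j by (intro a_mono) auto
          then show "a (2 * n + i - 1) - a (2 * n + i) \<le> rr x y"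
            using f_lip[of x y] j y by linarith
        next
          show "0 < a (2 * n + i - 1) - a (2 * n + i)"
            using a(2)[of "2 * n + i - 1"] False by simp
        qed
      qed simp
      also have "(\<Union>j<n. R (2 * j + i)) \<union> R (2 * n + i) = (\<Union>j<Suc n. R (2 * j + i))"
        by (auto simp: less_Suc_eq)
      finally show ?case .
    qed simp
    also have "\<dots> \<le> sh E" by (rule sh_mono) (auto simp: R_def)
    finally show ?thesis .
  qed
  have sum_R: "(\<Sum>j<n. sh (R j)) \<le> 2 * sh E" for n
  proof -
    have "(\<Sum>j<n. sh (R j)) \<le> (\<Sum>j<2*n. sh (R j))"
      by (rule sum_mono2) auto
    also have "\<dots> = (\<Sum>j<n. sh (R (2 * j + 0))) + (\<Sum>j<n. sh (R (2 * j + 1)))"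
      by (induction n) (auto simp: algebra_simps)
    also have "\<dots> \<le> sh E + sh E" by (intro add_mono odd_even)
    finally show ?thesis by (simp add: mult_2)
  qed
  then have "(\<Sum>j. sh (R j)) \<le> 2 * sh E"
    by (intro suminf_le_const) auto
  moreover have "2 * sh E < top"
    using False by (simp add: ennreal_mult_less_top less_top)
  ultimately have sumfin: "(\<Sum>j. sh (R j)) < top"
    by (rule le_less_trans)
  have 2: "sh (E - F) \<le> sh (Ek k) + (\<Sum>j. sh (R (j + k)))" for k
  proof -
    have "E - F \<subseteq> Ek k \<union> (\<Union>j. R (j + k))"
    proof
      fix y assume y: "y \<in> E - F"
      then have "f y > 0" using f_pos by auto
      then obtain n where "inverse (real (Suc n)) < f y"
        using reals_Archimedean by blast
      then have "a n \<le> f y"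
        by (simp add: a_def inverse_eq_divide add.commute)
      then have n: "a (LEAST n. a n \<le> f y) \<le> f y" by (rule LeastI)
      show "y \<in> Ek k \<union> (\<Union>j. R (j + k))"
      proof (cases "(LEAST n. a n \<le> f y) \<le> k")
        case True
        then show ?thesis using n a_mono[OF True] y by (auto simp: Ek_def)
      next
        case F: False
        define m where "m = (LEAST n. a n \<le> f y) - 1"
        have m: "Suc m = (LEAST n. a n \<le> f y)" "m \<ge> k" using F by (auto simp: m_def)
        have "\<not> a m \<le> f y" using m(1) not_less_Least[of m "\<lambda>n. a n \<le> f y"] by simp
        then have "y \<in> R ((m - k) + k)" using n m y by (auto simp: R_def)
        then show ?thesis by blast
      qed
    qed
    then have "sh (E - F) \<le> sh (Ek k \<union> (\<Union>j. R (j + k)))" by (rule sh_mono)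
    also have "\<dots> \<le> sh (Ek k) + sh (\<Union>j. R (j + k))" by (rule sh_Un)
    also have "\<dots> \<le> sh (Ek k) + (\<Sum>j. sh (R (j + k)))" by (intro add_left_mono sh_subadd)
    finally show ?thesis .
  qed
  have 3: "(\<Sum>j. sh (R j)) = (\<Sum>j<k. sh (R j)) + (\<Sum>j. sh (R (j + k)))" for k
    using suminf_offset[of "\<lambda>j. sh (R j)" k] by (simp add: add.commute)
  \<comment> \<open>The tail of the series cannot be subtracted in \<open>ennreal\<close>. Instead
    the head is added on the left, which completes the tail to the full sum, and the finite full sum
    is cancelled at the end.\<close>
  have "(\<lambda>k. (sh (F \<inter> E) + sh (E - F)) + (\<Sum>j<k. sh (R j))) \<longlonglongrightarrow> (sh (F \<inter> E) + sh (E - F)) + (\<Sum>j. sh (R j))"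
    by (intro tendsto_intros summable_LIMSEQ) auto
  then have "(sh (F \<inter> E) + sh (E - F)) + (\<Sum>j. sh (R j)) \<le> sh E + (\<Sum>j. sh (R j))"
  proof (rule LIMSEQ_le_const2, intro exI allI impI)
    fix k
    have "(sh (F \<inter> E) + sh (E - F)) + (\<Sum>j<k. sh (R j)) \<le>
        (sh (F \<inter> E) + (sh (Ek k) + (\<Sum>j. sh (R (j + k))))) + (\<Sum>j<k. sh (R j))"
      by (intro add_mono 2 order_refl)
    also have "\<dots> = (sh (F \<inter> E) + sh (Ek k)) + (\<Sum>j. sh (R j))"
      unfolding 3[of k] by (simp add: ac_simps)
    also have "\<dots> \<le> sh E + (\<Sum>j. sh (R j))"
      by (intro add_right_mono 1)
    finally show "(sh (F \<inter> E) + sh (E - F)) + (\<Sum>j<k. sh (R j)) \<le> sh E + (\<Sum>j. sh (R j))" .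
  qed
  then show ?thesis
    using less_imp_neq[OF sumfin] by (simp add: add.commute[of _ "\<Sum>j. sh (R j)"] ennreal_add_left_cancel_le)
qed auto

text \<open>The mass distribution principle, with the mass on a parameter space and \<open>g\<close>
  as the parametrization: any cover of the image splits the mass into pieces of at most
  \<open>C * r i ^ d\<close>.\<close>

lemma mass_le_sc:
  fixes N :: "'b measure"
  assumes E: "E \<in> sets N" and C: "C > 0"
    and m: "\<And>c r. \<lbrakk>0 < r; r \<le> \<delta>\<rbrakk> \<Longrightarrow> E \<inter> g -` Bl c r \<in> sets N"
    and le: "\<And>c r. \<lbrakk>0 < r; r \<le> \<delta>\<rbrakk> \<Longrightarrow> emeasure N (E \<inter> g -` Bl c r) \<le> ennreal (C * r ^ d)"
  shows "emeasure N E \<le> ennreal C * sc \<delta> (g ` E)"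
proof (rule ccontr)
  assume "\<not> ?thesis"
  then have "ennreal (1/C) * (ennreal C * sc \<delta> (g ` E)) < ennreal (1/C) * emeasure N E"
    using C by (intro ennreal_mult_strict_left_mono) (auto simp: not_le)
  moreover have inv: "ennreal (1/C) * (ennreal C * x) = x" "ennreal C * (ennreal (1/C) * x) = x" for x
    using C by (simp_all add: mult.assoc[symmetric] ennreal_mult'[symmetric])
  ultimately have "sc \<delta> (g ` E) < ennreal (1/C) * emeasure N E"
    by simp
  from sc_less_ex[OF this] obtain c r where "(\<forall>i. 0 < r i) \<and> (\<forall>i. r i \<le> \<delta>) \<and>
      g ` E \<subseteq> (\<Union>i. Bl (c i) (r i)) \<and> (\<Sum>i::nat. ennreal (r i ^ d)) < ennreal (1/C) * emeasure N E"
    by (elim exE) (rule that)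
  then have r: "\<And>i. 0 < r i" "\<And>i. r i \<le> \<delta>" and cov: "g ` E \<subseteq> (\<Union>i. Bl (c i) (r i))"
    and lt: "(\<Sum>i. ennreal (r i ^ d)) < ennreal (1/C) * emeasure N E"
    by auto
  have "E = (\<Union>i. E \<inter> g -` Bl (c i) (r i))"
    using cov by blast
  then have "emeasure N E = emeasure N (\<Union>i. E \<inter> g -` Bl (c i) (r i))"
    by simp
  also have "\<dots> \<le> (\<Sum>i. emeasure N (E \<inter> g -` Bl (c i) (r i)))"
    by (rule emeasure_subadditive_countably) (use m[OF r] in auto)
  also have "\<dots> \<le> (\<Sum>i. ennreal C * ennreal (r i ^ d))"
  proof (intro suminf_le)
    fix i show "emeasure N (E \<inter> g -` Bl (c i) (r i)) \<le> ennreal C * ennreal (r i ^ d)"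
      using le[OF r(1,2)] C by (simp only: ennreal_mult'[symmetric] less_imp_le)
  qed simp_all
  also have "\<dots> = ennreal C * (\<Sum>i. ennreal (r i ^ d))"
    by simp
  also have "\<dots> < ennreal C * (ennreal (1/C) * emeasure N E)"
    using lt C by (intro ennreal_mult_strict_left_mono) auto
  also have "\<dots> = emeasure N E" by (rule inv)
  finally show False by simp
qed

end

section \<open>The real-valued distance and the Borel additivity of its Hausdorff measure\<close>

definition hdist :: "'n::finite heis \<Rightarrow> 'n heis \<Rightarrow> real" where
  "hdist x y = hn (heis_mult (- x) y)"

lemma cc_dist_hdist: "cc_dist = (\<lambda>x y. ennreal (hdist x y))"
  by (simp add: fun_eq_iff cc_dist_hn hdist_def)

lemma hdist_left: "hdist (heis_mult a x) (heis_mult a y) = hdist x y"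
  by (simp add: hdist_def heis_inv_mult heis_assoc)

lemma hdist_distance:
  assumes "d > 0" shows "distance (hdist :: 'n::finite heis \<Rightarrow> 'n heis \<Rightarrow> real) d"
proof
  fix x y z :: "'n heis"
  have "hn (- heis_mult (- x) y) = hn (heis_mult (- x) y)" by (rule hn_uminus)
  then show "hdist x y = hdist y x"
    by (simp add: hdist_def heis_inv_mult)
  have "heis_mult (- x) z = heis_mult (heis_mult (- x) y) (heis_mult (- y) z)"
    by (simp add: heis_assoc)
  then show "hdist x z \<le> hdist x y + hdist y z"
    by (simp add: hdist_def hn_mult_le)
qed (use assms in \<open>auto simp: hdist_def\<close>)

lemma continuous_hdist: "continuous_on UNIV (hdist x)"
proof -
  have "continuous_on UNIV (\<lambda>y. cof x (y - x))"
    by (intro linear_continuous_on_compose[OF _ linear_cof] continuous_intros)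
  then have "continuous_on UNIV (\<lambda>y. hn (cof x (y - x)))"
    by (rule continuous_on_compose2[OF hn_continuous]) simp
  then show ?thesis
    by (simp add: hdist_def[abs_def] ldiff_cof)
qed

lemma closedin_hdist_ball:
  assumes "continuous_on W \<phi>"
  shows "\<exists>T. closed T \<and> {u \<in> W. hdist c (\<phi> u) \<le> r} = W \<inter> T"
proof -
  have "continuous_on W (\<lambda>u. hdist c (\<phi> u))"
    by (rule continuous_on_compose2[OF continuous_hdist assms]) simp
  then have "closedin (top_of_set W) (W \<inter> (\<lambda>u. hdist c (\<phi> u)) -` {..r})"
    by (rule continuous_closedin_preimage) simp
  moreover have "W \<inter> (\<lambda>u. hdist c (\<phi> u)) -` {..r} = {u \<in> W. hdist c (\<phi> u) \<le> r}"
    by auto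
  ultimately show ?thesis
    unfolding closedin_closed by metis
qed

text \<open>Makes Euclidean closed sets lie at positive \<open>hdist\<close> from each point
  outside, as Caratheodory's criterion in \<open>sh_measurable\<close> requires.\<close>

lemma hdist_small_imp_close:
  assumes "e > 0"
  shows "\<exists>d>0. \<forall>y. hdist x y < d \<longrightarrow> norm (y - x) < e"
proof -
  \<comment> \<open>In \<open>2 + norm x\<close> the 2 stands for the horizontal and the vertical
    part of the left quotient, and \<open>norm x\<close> for the twist that translation back by
    \<open>x\<close> adds. The second factor 2 makes the final bound strict.\<close>
  define d where "d = min 1 (e / (2 * (2 + norm x)))"
  have nx: "0 < 2 + norm x" by (simp add: add_pos_nonneg)
  have d: "0 < d" "d \<le> 1" "d * (2 + norm x) < e"
  proof -
    show "0 < d" "d \<le> 1" using assms nx by (auto simp: d_def)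
    have "d * (2 + norm x) \<le> e / (2 * (2 + norm x)) * (2 + norm x)"
      using nx by (intro mult_right_mono) (auto simp: d_def)
    also have "\<dots> = e / 2" using nx by (simp add: divide_simps)
    finally show "d * (2 + norm x) < e" using assms by simp
  qed
  have "norm (y - x) < e" if y: "hdist x y < d" for y
  proof -
    let ?g = "cof x (y - x)"
    have h: "hn ?g < d" using y by (simp add: hdist_def ldiff_cof)
    have "y - x = ?g + (om x ?g / 2) *\<^sub>R eT"
      by (simp add: cof_def om_simps)
    then have "norm (y - x) \<le> norm ?g + \<bar>om x ?g\<bar> / 2"
      by (metis abs_divide abs_numeral mult.right_neutral norm_eT norm_scaleR norm_triangle_ineq)
    also have "\<dots> \<le> (norm (hor ?g) + \<bar>?g $ iT\<bar>) + norm (hor x) * norm (hor ?g) / 2"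
      by (intro add_mono norm_le_hor_T divide_right_mono om_bound) simp
    also have "\<dots> \<le> (d + d) + norm x * d"
    proof (intro add_mono)
      show "norm (hor ?g) \<le> d" using hn_lower(1)[of ?g] h by linarith
      have "(hn ?g)\<^sup>2 \<le> hn ?g * 1"
        unfolding power2_eq_square using h d by (intro mult_left_mono) auto
      then show "\<bar>?g $ iT\<bar> \<le> d" using hn_lower(2)[of ?g] h by linarith
      have "norm (hor x) * norm (hor ?g) \<le> norm x * d"
        using hn_lower(1)[of ?g] h by (intro mult_mono norm_hor_le) auto
      moreover have "0 \<le> norm x * d" using d by simp
      ultimately show "norm (hor x) * norm (hor ?g) / 2 \<le> norm x * d" by linarith
    qed
    also have "\<dots> = d * (2 + norm x)" by (simp add: algebra_simps)
    finally have "norm (y - x) \<le> d * (2 + norm x)" .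
    then show ?thesis using d by linarith
  qed
  then show ?thesis using d by blast
qed

text \<open>\<open>measure_of\<close> has the intended values only for a countably additive set
  function; that \<open>spherical_hausdorff\<close> is one on Borel sets is the content of
  \<open>emeasure_hausdorff_measure\<close>.\<close>

definition hausdorff_measure :: "nat \<Rightarrow> 'n::finite heis measure" where
  "hausdorff_measure d = measure_of UNIV (sets borel) (spherical_hausdorff cc_dist d)"

lemma sets_hausdorff_measure [simp]: "sets (hausdorff_measure d) = sets borel"
  unfolding hausdorff_measure_def by (metis sets.sigma_sets_eq sets_measure_of_conv space_borel sets.space_closed)

lemma space_hausdorff_measure [simp]: "space (hausdorff_measure d) = UNIV"
  unfolding hausdorff_measure_def by (simp add: space_measure_of_conv)

lemma emeasure_hausdorff_measure:
  fixes A :: "'n::finite heis set"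
  assumes d: "d > 0" and A: "A \<in> sets borel"
  shows "emeasure (hausdorff_measure d) A = spherical_hausdorff cc_dist d A"
proof -
  interpret distance "hdist :: 'n heis \<Rightarrow> 'n heis \<Rightarrow> real" d
    by (rule hdist_distance[OF d])
  let ?L = "lambda_system UNIV (Pow UNIV) sh"
  interpret P: sigma_algebra UNIV "Pow UNIV :: 'n heis set set"
    by (rule sigma_algebra_Pow)
  have "outer_measure_space (Pow UNIV) sh"
    unfolding outer_measure_space_def positive_def increasing_def countably_subadditive_def
    by (auto intro: sh_mono sh_subadd)
  then have ms: "measure_space UNIV ?L sh"
    by (rule P.caratheodory_lemma)
  then have sL: "sigma_algebra UNIV ?L"
    by (simp add: measure_space_def)
  have "F \<in> ?L" if F: "closed F" for F
  proof (cases "F = {}")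
    case True
    then show ?thesis by (simp add: lambda_system_def)
  next
    case False
    have "sh (F \<inter> E) + sh ((UNIV - F) \<inter> E) = sh E" for E
    proof (rule antisym)
      have sep: "\<exists>e>0. \<forall>x\<in>F. hdist y x \<ge> e" if y: "y \<notin> F" for y
      proof -
        obtain e where e: "e > 0" "ball y e \<subseteq> - F"
          using F y open_contains_ball[of "- F"] by blast
        obtain \<delta> where \<delta>: "\<delta> > 0" "\<And>z. hdist y z < \<delta> \<Longrightarrow> norm (z - y) < e"
          using hdist_small_imp_close[OF e(1)] by blast
        have "\<delta> \<le> hdist y x" if "x \<in> F" for x
        proof (rule ccontr)
          assume "\<not> \<delta> \<le> hdist y x"
          then have "x \<in> ball y e"
            using \<delta>(2)[of x] by (simp add: dist_norm norm_minus_commute)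
          then show False using e that by auto
        qed
        then show ?thesis using \<delta>(1) by blast
      qed
      have "(UNIV - F) \<inter> E = E - F" by auto
      then show "sh (F \<inter> E) + sh ((UNIV - F) \<inter> E) \<le> sh E"
        using sh_measurable[OF sep False, of E] by simp
      have "E = (F \<inter> E) \<union> ((UNIV - F) \<inter> E)" by auto
      then show "sh E \<le> sh (F \<inter> E) + sh ((UNIV - F) \<inter> E)"
        by (metis sh_Un)
    qed
    then show ?thesis by (simp add: lambda_system_def)
  qed
  then have "Collect closed \<subseteq> ?L" by auto
  then have "sigma_sets UNIV (Collect closed) \<subseteq> ?L"
    by (rule sigma_algebra.sigma_sets_subset[OF sL])
  then have sub: "sets borel \<subseteq> ?L"
    by (simp add: borel_eq_closed)
  have "sigma_algebra UNIV (sets (borel :: 'n heis measure))"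
    using sets.sigma_algebra_axioms[of "borel :: 'n heis measure"] by simp
  then have "measure_space UNIV (sets borel) sh"
    by (rule measure_down[OF ms _ sub])
  then show ?thesis
    unfolding hausdorff_measure_def cc_dist_hdist using A
    by (intro emeasure_measure_of_sigma) (auto simp: measure_space_def)
qed

section \<open>Change of variables without a well-ordered index type\<close>

text \<open>
  The change of variables theorems of the library require the index type of the vectors to be
  well-ordered. A well-ordered type with as many elements as a given finite type removes this
  restriction.
\<close>

typedef (overloaded) 'm rnk = "{..<CARD('m::finite)}"
  by (rule exI[of _ 0]) (simp add: card_gt_0_iff)

instance rnk :: (finite) finite
proof
  have "(UNIV :: 'a rnk set) = Abs_rnk ` {..<CARD('a)}"
    by (metis Rep_rnk Rep_rnk_inverse UNIV_eq_I image_eqI)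
  then show "finite (UNIV :: 'a rnk set)" by (metis finite_imageI finite_lessThan)
qed

instantiation rnk :: (finite) wellorder
begin

definition "x \<le> y \<longleftrightarrow> Rep_rnk x \<le> Rep_rnk y" for x y :: "'a rnk"
definition "x < y \<longleftrightarrow> Rep_rnk x < Rep_rnk y" for x y :: "'a rnk"

instance
proof
  fix P :: "'a rnk \<Rightarrow> bool" and a :: "'a rnk"
  assume *: "\<And>x. (\<And>y. y < x \<Longrightarrow> P y) \<Longrightarrow> P x"
  show "P a"
    by (induction a rule: measure_induct_rule[of Rep_rnk]) (auto intro: * simp: less_rnk_def)
qed (auto simp: less_eq_rnk_def less_rnk_def Rep_rnk_inject)

end

lemma card_rnk: "CARD('m::finite rnk) = CARD('m)"
proof -
  have "bij_betw Rep_rnk (UNIV :: 'm rnk set) {..<CARD('m)}"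
    by (rule bij_betw_byWitness[where f' = Abs_rnk])
      (auto simp: Rep_rnk_inverse Abs_rnk_inverse intro: Rep_rnk[simplified lessThan_iff])
  then show ?thesis
    by (simp add: bij_betw_same_card)
qed

text \<open>Conjugation by a bijection turns transpositions into transpositions, even between two
  different index types.\<close>

lemma sign_conj:
  fixes \<pi> :: "'r::finite \<Rightarrow> 'm::finite"
  assumes \<pi>: "bij \<pi>" and p: "p permutes (UNIV :: 'm set)"
  shows "sign (inv \<pi> \<circ> p \<circ> \<pi>) = sign p"
  using p finite
proof (induction p rule: permutes_induct)
  case id
  have "inv \<pi> \<circ> id \<circ> \<pi> = id"
    using \<pi> by (simp add: bij_is_inj)
  then show ?case by simp
next
  case (swap a b p)
  have inv: "inv \<pi> (\<pi> x) = x" "\<pi> (inv \<pi> y) = y" for x y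
    using \<pi> by (simp_all add: bij_is_inj bij_is_surj surj_f_inv_f)
  have 1: "inv \<pi> \<circ> (Transposition.transpose a b \<circ> p) \<circ> \<pi> =
      Transposition.transpose (inv \<pi> a) (inv \<pi> b) \<circ> (inv \<pi> \<circ> p \<circ> \<pi>)"
    using inv by (auto simp: fun_eq_iff Transposition.transpose_def) metis+
  have "bij p" using swap by (simp add: permutes_bij)
  then have "bij (inv \<pi> \<circ> p \<circ> \<pi>)"
    using \<pi> by (intro bij_comp bij_imp_bij_inv)
  then have perm: "permutation (inv \<pi> \<circ> p \<circ> \<pi>)" "permutation p"
    using \<open>bij p\<close> by (simp_all add: permutation)
  have "inv \<pi> a = inv \<pi> b \<longleftrightarrow> a = b"
    using inv by metis
  then show ?case
    unfolding 1 using swap perm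
    by (simp add: sign_compose permutation_swap_id sign_swap_id del: comp_apply)
qed

lemma det_reindex:
  fixes A :: "real^'m::finite^'m" and \<pi> :: "'r::finite \<Rightarrow> 'm"
  assumes \<pi>: "bij \<pi>"
  shows "det (\<chi> i j. A $ \<pi> i $ \<pi> j :: real^'r^'r) = det A"
proof -
  have inv: "inv \<pi> (\<pi> x) = x" "\<pi> (inv \<pi> y) = y" for x y
    using \<pi> by (simp_all add: bij_is_inj bij_is_surj surj_f_inv_f)
  have "(\<Sum>p | p permutes (UNIV::'m set). of_int (sign p) * (\<Prod>i\<in>UNIV. A $ i $ p i)) =
      (\<Sum>q | q permutes (UNIV::'r set). of_int (sign q) * (\<Prod>i\<in>UNIV. A $ \<pi> i $ \<pi> (q i)))"
  proof (rule sum.reindex_bij_witness[where i = "\<lambda>q. \<pi> \<circ> q \<circ> inv \<pi>" and j = "\<lambda>p. inv \<pi> \<circ> p \<circ> \<pi>"])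
    fix p assume p: "p \<in> {p. p permutes (UNIV :: 'm set)}"
    show "\<pi> \<circ> (inv \<pi> \<circ> p \<circ> \<pi>) \<circ> inv \<pi> = p"
      using inv by (simp add: fun_eq_iff)
    show "inv \<pi> \<circ> p \<circ> \<pi> \<in> {q. q permutes UNIV}"
      using p \<pi> by (auto intro!: bij_imp_permutes bij_comp bij_imp_bij_inv dest: permutes_bij)
    have "(\<Prod>i\<in>UNIV. A $ \<pi> i $ \<pi> ((inv \<pi> \<circ> p \<circ> \<pi>) i)) = (\<Prod>i\<in>UNIV. A $ i $ p i)"
      using prod.reindex_bij_betw[OF \<pi>, of "\<lambda>i. A $ i $ p i"] by (simp add: inv)
    then show "of_int (sign (inv \<pi> \<circ> p \<circ> \<pi>)) * (\<Prod>i\<in>UNIV. A $ \<pi> i $ \<pi> ((inv \<pi> \<circ> p \<circ> \<pi>) i)) =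
        of_int (sign p) * (\<Prod>i\<in>UNIV. A $ i $ p i)"
      using sign_conj[OF \<pi>] p by simp
  next
    fix q assume q: "q \<in> {q. q permutes (UNIV :: 'r set)}"
    show "inv \<pi> \<circ> (\<pi> \<circ> q \<circ> inv \<pi>) \<circ> \<pi> = q"
      using inv by (simp add: fun_eq_iff)
    show "\<pi> \<circ> q \<circ> inv \<pi> \<in> {p. p permutes UNIV}"
      using q \<pi> by (auto intro!: bij_imp_permutes bij_comp bij_imp_bij_inv dest: permutes_bij)
  qed
  then show ?thesis
    by (simp add: det_def)
qed

definition reix :: "('r::finite \<Rightarrow> 'm::finite) \<Rightarrow> real^'m \<Rightarrow> real^'r" where
  "reix \<pi> x = (\<chi> i. x $ \<pi> i)"

lemma linear_reix: "linear (reix \<pi>)"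
  by (rule linearI) (auto simp: reix_def vec_eq_iff)

lemma reix_inv:
  assumes "bij \<pi>" shows "reix (inv \<pi>) (reix \<pi> x) = x" "reix \<pi> (reix (inv \<pi>) y) = y"
  using assms by (simp_all add: reix_def vec_eq_iff bij_is_inj bij_is_surj surj_f_inv_f)

lemma prod_Basis_cart: "(\<Prod>b\<in>Basis. f b) = (\<Prod>i\<in>UNIV. f (axis i 1))" for f :: "real^'n::finite \<Rightarrow> real"
proof -
  have B: "(Basis :: (real^'n) set) = range (\<lambda>i. axis i 1)"
    by (auto simp: Basis_vec_def)
  have "inj (\<lambda>i. axis i 1 :: real^'n)"
    by (auto simp: inj_def axis_eq_axis)
  then show ?thesis
    by (simp only: B prod.reindex comp_def)
qed

lemma lborel_reix:
  fixes \<pi> :: "'r::finite \<Rightarrow> 'm::finite"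
  assumes \<pi>: "bij \<pi>"
  shows "distr lborel lborel (reix \<pi>) = lborel"
proof -
  have m: "reix \<pi> \<in> borel_measurable borel"
    by (intro borel_measurable_continuous_onI linear_continuous_on linear_linear[THEN iffD2] linear_reix)
  have "lborel = distr lborel borel (reix \<pi>)"
  proof (rule lborel_eqI)
    fix l u :: "real^'r"
    assume lu: "\<And>b. b \<in> Basis \<Longrightarrow> l \<bullet> b \<le> u \<bullet> b"
    have inv: "inv \<pi> (\<pi> x) = x" "\<pi> (inv \<pi> y) = y" for x y
      using \<pi> by (simp_all add: bij_is_inj bij_is_surj surj_f_inv_f)
    have le: "l $ i \<le> u $ i" for i
      using lu[of "axis i 1"] by (simp add: inner_axis)
    have "reix \<pi> -` box l u = box (reix (inv \<pi>) l) (reix (inv \<pi>) u)"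
      by (auto simp: mem_box_cart reix_def) (metis inv)+
    then have "emeasure (distr lborel borel (reix \<pi>)) (box l u) =
        emeasure lborel (box (reix (inv \<pi>) l) (reix (inv \<pi>) u))"
      using m by (simp add: emeasure_distr)
    also have "\<dots> = ennreal (\<Prod>b\<in>Basis. (reix (inv \<pi>) u - reix (inv \<pi>) l) \<bullet> b)"
      by (rule emeasure_lborel_box) (auto simp: Basis_vec_def inner_axis reix_def le)
    also have "(\<Prod>b\<in>Basis. (reix (inv \<pi>) u - reix (inv \<pi>) l) \<bullet> b) = (\<Prod>i\<in>UNIV. u $ inv \<pi> i - l $ inv \<pi> i)"
      by (simp add: prod_Basis_cart inner_axis reix_def)
    also have "\<dots> = (\<Prod>i\<in>UNIV. u $ i - l $ i)"
      by (rule prod.reindex_bij_betw[of "inv \<pi>" UNIV UNIV "\<lambda>i. u $ i - l $ i"]) (use \<pi> in \<open>simp add: bij_imp_bij_inv\<close>)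
    also have "\<dots> = (\<Prod>b\<in>Basis. (u - l) \<bullet> b)"
      by (simp add: prod_Basis_cart inner_axis)
    finally show "emeasure (distr lborel borel (reix \<pi>)) (box l u) = ennreal (\<Prod>b\<in>Basis. (u - l) \<bullet> b)" .
  qed simp
  then show ?thesis
    by (metis distr_cong sets_lborel)
qed

lemma lebesgue_reix:
  fixes \<pi> :: "'r::finite \<Rightarrow> 'm::finite"
  assumes \<pi>: "bij \<pi>"
  shows "reix \<pi> \<in> lebesgue \<rightarrow>\<^sub>M lebesgue" "distr lebesgue lebesgue (reix \<pi>) = lebesgue"
proof -
  have m: "reix \<pi> \<in> lborel \<rightarrow>\<^sub>M lborel"
    using borel_measurable_continuous_onI[OF linear_continuous_on[OF linear_linear[THEN iffD2, OF linear_reix]], of \<pi>]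
    by simp
  have m': "reix \<pi> \<in> lebesgue \<rightarrow>\<^sub>M lborel"
    using m by (rule measurable_completion)
  have n: "distr lebesgue lborel (reix \<pi>) = lborel"
    using distr_completion[OF m] lborel_reix[OF \<pi>] by simp
  show "reix \<pi> \<in> lebesgue \<rightarrow>\<^sub>M lebesgue"
    by (rule completion.measurable_completion2[OF m']) (simp add: n)
  show "distr lebesgue lebesgue (reix \<pi>) = lebesgue"
    using completion.completion_distr_eq[OF m'] by (simp add: n)
qed

lemma lmeasurable_reix:
  assumes \<pi>: "bij \<pi>" and S: "S \<in> lmeasurable"
  shows "reix \<pi> ` S \<in> lmeasurable" "measure lebesgue (reix \<pi> ` S) = measure lebesgue S"
proof -
  have eq: "reix \<pi> ` S = reix (inv \<pi>) -` S"
    using reix_inv[OF \<pi>] by (auto simp: image_iff) metis+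
  have b: "bij (inv \<pi>)" using \<pi> by (rule bij_imp_bij_inv)
  have "reix (inv \<pi>) -` S \<inter> space lebesgue \<in> sets lebesgue"
    by (rule measurable_sets[OF lebesgue_reix(1)[OF b]]) (use S in auto)
  then have 1: "reix \<pi> ` S \<in> sets lebesgue" by (simp add: eq)
  have "emeasure lebesgue S = emeasure (distr lebesgue lebesgue (reix (inv \<pi>))) S"
    by (simp add: lebesgue_reix(2)[OF b])
  also have "\<dots> = emeasure lebesgue (reix \<pi> ` S)"
    unfolding eq by (subst emeasure_distr[OF lebesgue_reix(1)[OF b]]) (use S in auto)
  finally have 2: "emeasure lebesgue (reix \<pi> ` S) = emeasure lebesgue S" by simp
  with 1 S show "reix \<pi> ` S \<in> lmeasurable"
    by (metis fmeasurableD fmeasurableI fmeasurable_def less_top mem_Collect_eq)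
  show "measure lebesgue (reix \<pi> ` S) = measure lebesgue S"
    by (simp add: measure_def 2)
qed

text \<open>Later arguments use only upper and lower bounds for the Jacobian. Stated as bounds
  between measures of sets, the formula can be carried to another index type by moving sets, with no
  integral to transport.\<close>

lemma differentiable_image_bounds_wellorder:
  fixes f :: "real^'n::{finite,wellorder} \<Rightarrow> real^'n::_"
  assumes S: "S \<in> lmeasurable"
    and der: "\<And>x. x \<in> S \<Longrightarrow> (f has_derivative f' x) (at x within S)"
    and inj: "inj_on f S"
    and a: "\<And>x. x \<in> S \<Longrightarrow> a \<le> \<bar>det (matrix (f' x))\<bar>"
    and b: "\<And>x. x \<in> S \<Longrightarrow> \<bar>det (matrix (f' x))\<bar> \<le> b"
  shows "f ` S \<in> lmeasurable" "a * measure lebesgue S \<le> measure lebesgue (f ` S)"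
    "measure lebesgue (f ` S) \<le> b * measure lebesgue S"
proof -
  have Sl: "S \<in> sets lebesgue" using S by auto
  have int: "(\<lambda>x. \<bar>det (matrix (f' x))\<bar>) integrable_on S"
  proof (rule measurable_bounded_by_integrable_imp_integrable)
    show "(\<lambda>x. \<bar>det (matrix (f' x))\<bar>) \<in> borel_measurable (lebesgue_on S)"
      using borel_measurable_det_Jacobian[OF Sl der] by measurable
    show "(\<lambda>x. b) integrable_on S"
      by (rule integrable_on_const[OF S])
  qed (use b Sl in auto)
  show "f ` S \<in> lmeasurable"
    using measurable_differentiable_image_eq[OF Sl der inj] int by blast
  have eq: "measure lebesgue (f ` S) = integral S (\<lambda>x. \<bar>det (matrix (f' x))\<bar>)"
    by (rule measure_differentiable_image_eq[OF Sl der inj int])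
  have c: "integral S (\<lambda>x. c) = c * measure lebesgue S" "(\<lambda>x. c) integrable_on S" for c :: real
    using S by (simp_all add: lmeasure_integral integrable_on_const flip: integral_mult_right)
  show "a * measure lebesgue S \<le> measure lebesgue (f ` S)"
    unfolding eq c(1)[symmetric] by (rule integral_le[OF c(2) int a])
  show "measure lebesgue (f ` S) \<le> b * measure lebesgue S"
    unfolding eq c(1)[symmetric] by (rule integral_le[OF int c(2) b])
qed

lemma differentiable_image_bounds:
  fixes f :: "real^'m::finite \<Rightarrow> real^'m"
  assumes S: "S \<in> lmeasurable"
    and der: "\<And>x. x \<in> S \<Longrightarrow> (f has_derivative f' x) (at x within S)"
    and inj: "inj_on f S"
    and a: "\<And>x. x \<in> S \<Longrightarrow> a \<le> \<bar>det (matrix (f' x))\<bar>"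
    and b: "\<And>x. x \<in> S \<Longrightarrow> \<bar>det (matrix (f' x))\<bar> \<le> b"
  shows "f ` S \<in> lmeasurable" "a * measure lebesgue S \<le> measure lebesgue (f ` S)"
    "measure lebesgue (f ` S) \<le> b * measure lebesgue S"
proof -
  obtain \<pi> :: "'m rnk \<Rightarrow> 'm" where \<pi>: "bij \<pi>"
    using card_rnk[where 'm = 'm] finite_same_card_bij[of "UNIV :: 'm rnk set" "UNIV :: 'm set"] by auto
  define P where "P = reix \<pi>"
  define Q where "Q = reix (inv \<pi>)"
  have PQ: "P (Q y) = y" "Q (P x) = x" for x y
    by (simp_all add: P_def Q_def reix_inv[OF \<pi>])
  have linP: "linear P" "linear Q"
    by (simp_all add: P_def Q_def linear_reix)
  define g where "g = P \<circ> f \<circ> Q"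
  define g' where "g' y = P \<circ> f' (Q y) \<circ> Q" for y
  have QS: "Q ` (P ` S) = S" by (force simp: PQ image_iff)
  have gS: "g ` (P ` S) = P ` (f ` S)"
    by (simp add: g_def image_image PQ)
  have 1: "P ` S \<in> lmeasurable" "measure lebesgue (P ` S) = measure lebesgue S"
    using lmeasurable_reix[OF \<pi> S] by (simp_all add: P_def)
  have 2: "(g has_derivative g' y) (at y within P ` S)" if "y \<in> P ` S" for y
  proof -
    have Qy: "Q y \<in> S" using that by (auto simp: PQ)
    have "((f \<circ> Q) has_derivative (f' (Q y) \<circ> Q)) (at y within P ` S)"
      by (rule diff_chain_within) (use linP der[OF Qy] in \<open>simp_all add: QS linear_imp_has_derivative\<close>)
    then have "((P \<circ> (f \<circ> Q)) has_derivative (P \<circ> (f' (Q y) \<circ> Q))) (at y within P ` S)"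
      by (rule diff_chain_within) (use linP in \<open>simp add: linear_imp_has_derivative\<close>)
    then show ?thesis by (simp add: g_def g'_def comp_assoc)
  qed
  have 3: "inj_on g (P ` S)"
    using inj unfolding g_def inj_on_def by (auto simp: PQ) (metis PQ(2))
  have inv: "inv \<pi> (\<pi> x) = x" "\<pi> (inv \<pi> y) = y" for x y
    using \<pi> by (simp_all add: bij_is_inj bij_is_surj surj_f_inv_f)
  have Qax: "Q (axis j 1) = axis (\<pi> j) 1" for j
    by (auto simp: Q_def reix_def vec_eq_iff axis_def inv)
  have 4: "det (matrix (g' y)) = det (matrix (f' (Q y)))" for y
    using det_reindex[OF \<pi>, of "matrix (f' (Q y))"]
    by (simp add: matrix_def g'_def Qax) (simp add: P_def reix_def)
  have QPS: "Q y \<in> S" if "y \<in> P ` S" for y using that by (auto simp: PQ)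
  note * = differentiable_image_bounds_wellorder[of "P ` S" g g' a b, OF 1(1) 2 3, unfolded 4, OF _ a[OF QPS] b[OF QPS], unfolded gS 1(2)]
  have fS: "reix (inv \<pi>) ` (P ` (f ` S)) = f ` S"
    by (simp add: image_image Q_def[symmetric] PQ)
  have b': "bij (inv \<pi>)" using \<pi> by (rule bij_imp_bij_inv)
  have m: "f ` S \<in> lmeasurable" "measure lebesgue (f ` S) = measure lebesgue (P ` (f ` S))"
    using lmeasurable_reix[OF b' *(1)] unfolding fS by auto
  show "f ` S \<in> lmeasurable" "a * measure lebesgue S \<le> measure lebesgue (f ` S)"
    "measure lebesgue (f ` S) \<le> b * measure lebesgue S"
    using m * by auto
qed

section \<open>Areas of intersections of balls with vertical subspaces\<close>

text \<open>
  A vertical subspace of dimension \<open>CARD('m)\<close> is presented by an isometry \<open>\<Theta>\<close> of \<open>real ^ 'm\<close> onto it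
  that maps a distinguished unit vector to the vertical direction.
\<close>

definition vert_iso :: "'m::finite \<Rightarrow> (real^'m \<Rightarrow> 'n::finite heis) \<Rightarrow> bool" where
  "vert_iso i0 \<Theta> \<longleftrightarrow> linear \<Theta> \<and> (\<forall>k. norm (\<Theta> k) = norm k) \<and> \<Theta> (axis i0 1) = eT"

definition vpart :: "'m::finite \<Rightarrow> real^'m \<Rightarrow> real^'m" where
  "vpart i0 k = k - (k $ i0) *\<^sub>R axis i0 1"

text \<open>The adjoint of \<Theta>: orthogonal projection to the subspace, read in the coordinates
  \<open>real ^ 'm\<close>.\<close>

definition isoadj :: "(real^'m::finite \<Rightarrow> 'n::finite heis) \<Rightarrow> 'n heis \<Rightarrow> real^'m" where
  "isoadj \<Theta> y = (\<chi> i. inner y (\<Theta> (axis i 1)))"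

definition area :: "(real^'m::finite \<Rightarrow> 'n::finite heis) \<Rightarrow> 'n heis \<Rightarrow> real" where
  "area \<Theta> c = measure lebesgue {k. hdist c (\<Theta> k) \<le> 1}"

text \<open>The normal form of a unit ball cut by a vertical subspace, with \<open>s\<close> the
  squared distance from the centre to the subspace. The axis \<open>iX undefined\<close> is just
  some horizontal unit vector, and by \<open>hn_rotation\<close> every other one gives the same
  set.\<close>

definition profile :: "'n::finite itself \<Rightarrow> 'm::finite \<Rightarrow> real \<Rightarrow> (real^'m) set" where
  "profile _ i0 s = {k. hn (sqrt ((norm (vpart i0 k))\<^sup>2 + s) *\<^sub>R axis (iX undefined) 1 + (k $ i0) *\<^sub>R (eT :: 'n heis)) \<le> 1}"

lemma vpart_nth [simp]: "vpart i0 k $ i0 = 0"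
  by (simp add: vpart_def)

lemma vpart_decomp: "k = vpart i0 k + (k $ i0) *\<^sub>R axis i0 1"
  by (simp add: vpart_def)

lemma norm_vpart_sq: "(norm k)\<^sup>2 = (norm (vpart i0 k))\<^sup>2 + (k $ i0)\<^sup>2"
proof -
  have "(norm (vpart i0 k + (k $ i0) *\<^sub>R axis i0 1))\<^sup>2 = (norm (vpart i0 k))\<^sup>2 + (norm ((k $ i0) *\<^sub>R (axis i0 1 :: real^'a)))\<^sup>2"
    by (rule norm_add_Pythagorean) (simp add: orthogonal_def inner_axis)
  then show ?thesis
    by (simp add: vpart_decomp[symmetric] norm_axis_1)
qed

definition offs :: "(real^'m::finite \<Rightarrow> 'n::finite heis) \<Rightarrow> 'n heis \<Rightarrow> real" where
  "offs \<Theta> c = (norm (hor c))\<^sup>2 - (norm (isoadj \<Theta> (hor c)))\<^sup>2"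

lemma vec_expansion: "(\<Sum>i\<in>UNIV. (k $ i) *\<^sub>R axis i 1) = k" for k :: "real^'m::finite"
  using basis_expansion[of k] by (simp add: scalar_mult_eq_scaleR)

lemma inner_isoadj: "linear \<Theta> \<Longrightarrow> inner (isoadj \<Theta> y) k = inner y (\<Theta> k)"
proof -
  assume lin: "linear \<Theta>"
  have "\<Theta> k = \<Theta> (\<Sum>i\<in>UNIV. (k $ i) *\<^sub>R axis i 1)"
    by (simp add: vec_expansion)
  also have "\<dots> = (\<Sum>i\<in>UNIV. (k $ i) *\<^sub>R \<Theta> (axis i 1))"
    by (simp add: linear_sum[OF lin] linear_scale[OF lin])
  finally show ?thesis
    by (simp add: isoadj_def inner_vec_def[of _ k] inner_sum_right mult.commute)
qed

lemma linear_isoadj: "linear (isoadj \<Theta>)"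
  by (rule linearI) (auto simp: isoadj_def vec_eq_iff inner_add_left)

text \<open>The matrix arises from the identity by adding \<open>w\<close> to row \<open>i0\<close>,
  and \<open>w $ i0 = 0\<close> makes \<open>w\<close> a combination of the other rows.\<close>

lemma det_shear:
  fixes w :: "real^'m::finite" and i0 :: 'm
  assumes w: "w $ i0 = 0"
  shows "det (matrix (\<lambda>h. h + inner w h *\<^sub>R axis i0 1)) = 1"
proof -
  have "w \<in> vec.span {row j (mat 1 :: real^'m^'m) | j. j \<noteq> i0}"
  proof -
    have "w = (\<Sum>j\<in>UNIV - {i0}. w $ j *s row j (mat 1))"
      using w by (simp add: vec_eq_iff row_def mat_def if_mult sum.remove[of UNIV i0] cong: if_cong)
    then show ?thesis
      by (metis (mono_tags, lifting) DiffD2 insertI1 mem_Collect_eq vec.span_base vec.span_scale vec.span_sum)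
  qed
  then have "det (\<chi> k. if k = i0 then row i0 (mat 1) + w else row k (mat 1)) = det (mat 1 :: real^'m^'m)"
    by (rule det_row_span)
  also have "(\<chi> k. if k = i0 then row i0 (mat 1) + w else row k (mat 1)) = matrix (\<lambda>h. h + inner w h *\<^sub>R axis i0 1)"
    by (auto simp: vec_eq_iff matrix_def row_def mat_def axis_def inner_vec_def if_mult cong: if_cong)
  finally show ?thesis by simp
qed

context
  fixes i0 :: "'m::finite" and \<Theta> :: "real^'m \<Rightarrow> 'n::finite heis"
  assumes \<Theta>: "vert_iso i0 \<Theta>"
begin

lemma iso_lin: "linear \<Theta>" and iso_norm: "norm (\<Theta> k) = norm k" and iso_axis: "\<Theta> (axis i0 1) = eT"
  using \<Theta> by (auto simp: vert_iso_def)

lemma iso_inner: "inner (\<Theta> k) (\<Theta> l) = inner k l"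
  unfolding dot_norm by (simp add: linear_add[OF iso_lin, symmetric] iso_norm)

lemma iso_T: "\<Theta> k $ iT = k $ i0"
  using iso_inner[of k "axis i0 1"] by (simp add: iso_axis inner_axis)

lemma iso_hor: "hor (\<Theta> k) = \<Theta> (vpart i0 k)"
  by (simp add: hor_def vpart_def linear_diff[OF iso_lin] linear_scale[OF iso_lin] iso_axis iso_T)

lemma iso_inj: "inj \<Theta>"
  using iso_norm by (metis iso_lin linear_injective_0 norm_eq_zero)

lemma isoadj_iso: "isoadj \<Theta> (\<Theta> k) = k"
proof -
  have "inner (isoadj \<Theta> (\<Theta> k)) l = inner k l" for l
    by (simp add: inner_isoadj[OF iso_lin] iso_inner)
  then show ?thesis
    using vector_eq_rdot by blast
qed

lemma isoadj_T: "isoadj \<Theta> y $ i0 = y $ iT"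
  by (simp add: isoadj_def iso_axis)

lemma isoadj_norm: "norm (isoadj \<Theta> y) \<le> norm y"
proof -
  have "(norm (isoadj \<Theta> y))\<^sup>2 = inner y (\<Theta> (isoadj \<Theta> y))"
    using inner_isoadj[OF iso_lin, of y "isoadj \<Theta> y"] by (simp add: power2_norm_eq_inner)
  also have "\<dots> \<le> norm y * norm (isoadj \<Theta> y)"
    using norm_cauchy_schwarz[of y "\<Theta> (isoadj \<Theta> y)"] by (simp add: iso_norm)
  finally show ?thesis
    by (cases "isoadj \<Theta> y = 0") (auto simp: power2_eq_square)
qed

lemma offs_nonneg: "offs \<Theta> c \<ge> 0"
  using power_mono[OF isoadj_norm, of "hor c" 2] by (simp add: offs_def)

text \<open>
  Because \<open>hn\<close> depends only on the norm of the horizontal part and on the vertical coordinate, a shear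
  of the vertical subspace makes its intersection with the ball about \<open>c\<close> depend only on \<open>offs \<Theta> c\<close>, the
  squared distance of \<open>c\<close> to the subspace.
\<close>

lemma hdist_iso:
  fixes c :: "'n heis"
  defines "A k \<equiv> k - isoadj \<Theta> (hor c) - (c $ iT + om c (\<Theta> k) / 2) *\<^sub>R axis i0 1"
  shows "hdist c (\<Theta> k) \<le> 1 \<longleftrightarrow> A k \<in> profile TYPE('n) i0 (offs \<Theta> c)"
proof -
  let ?b = "isoadj \<Theta> (hor c)"
  have b0: "?b $ i0 = 0" by (simp add: isoadj_T)
  have vA: "vpart i0 (A k) = vpart i0 k - ?b"
    by (simp add: vpart_def A_def b0 algebra_simps scaleR_add_left)
  have TA: "A k $ i0 = k $ i0 - c $ iT - om c (\<Theta> k) / 2"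
    by (simp add: A_def b0)
  have "(norm (hor (\<Theta> k) - hor c))\<^sup>2 = (norm (vpart i0 k))\<^sup>2 - 2 * inner (hor c) (\<Theta> (vpart i0 k)) + (norm (hor c))\<^sup>2"
    by (simp add: iso_hor power2_norm_eq_inner inner_diff_left inner_diff_right iso_inner inner_commute algebra_simps)
  also have "inner (hor c) (\<Theta> (vpart i0 k)) = inner ?b (vpart i0 k)"
    by (simp add: inner_isoadj iso_lin)
  also have "(norm (vpart i0 k))\<^sup>2 - 2 * inner ?b (vpart i0 k) + (norm (hor c))\<^sup>2 = (norm (vpart i0 (A k)))\<^sup>2 + offs \<Theta> c"
    by (simp add: vA offs_def power2_norm_eq_inner inner_diff_left inner_diff_right inner_commute algebra_simps)
  finally have n: "(norm (hor (\<Theta> k) - hor c))\<^sup>2 = (norm (vpart i0 (A k)))\<^sup>2 + offs \<Theta> c" .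
  have X: "(axis (iX undefined) 1 :: 'n heis) $ iT = 0" by (simp add: axis_def)
  have "hn (heis_mult (- c) (\<Theta> k)) =
      hn (sqrt ((norm (vpart i0 (A k)))\<^sup>2 + offs \<Theta> c) *\<^sub>R axis (iX undefined) 1 + (A k $ i0) *\<^sub>R (eT :: 'n heis))"
  proof (rule hn_rotation)
    show "norm (hor (heis_mult (- c) (\<Theta> k))) =
        norm (hor (sqrt ((norm (vpart i0 (A k)))\<^sup>2 + offs \<Theta> c) *\<^sub>R axis (iX undefined) 1 + (A k $ i0) *\<^sub>R (eT :: 'n heis)))"
      unfolding n[symmetric] by (simp add: hor_uminus hor_add hor_scale hor_id X norm_axis_1 algebra_simps)
    show "heis_mult (- c) (\<Theta> k) $ iT =
      (sqrt ((norm (vpart i0 (A k)))\<^sup>2 + offs \<Theta> c) *\<^sub>R axis (iX undefined) 1 + (A k $ i0) *\<^sub>R (eT :: 'n heis)) $ iT"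
      by (simp add: X TA om_simps iso_T)
  qed
  then show ?thesis
    by (simp add: hdist_def profile_def)
qed

lemma compact_iso_ball: "compact {k. hdist c (\<Theta> k) \<le> r}"
proof -
  have "continuous_on UNIV (\<lambda>k. hdist c (\<Theta> k))"
    by (rule continuous_on_compose2[OF continuous_hdist linear_continuous_on])
      (use iso_lin in \<open>auto simp: linear_linear\<close>)
  then have "closed {k. hdist c (\<Theta> k) \<le> r}"
    using continuous_closed_preimage[of UNIV "\<lambda>k. hdist c (\<Theta> k)" "{..r}"] by (simp add: vimage_def)
  moreover have "norm k \<le> (hn c + r) + (hn c + r)\<^sup>2" if "hdist c (\<Theta> k) \<le> r" for k
  proof -
    have "hn (\<Theta> k) \<le> hn c + r"
      using hn_mult_le[of c "heis_mult (- c) (\<Theta> k)"] that by (simp add: hdist_def)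
    moreover have "norm k \<le> norm (hor (\<Theta> k)) + \<bar>\<Theta> k $ iT\<bar>"
      using norm_le_hor_T[of "\<Theta> k"] by (simp add: iso_norm)
    moreover have "(hn (\<Theta> k))\<^sup>2 \<le> (hn c + r)\<^sup>2"
      using calculation by (intro power_mono) auto
    ultimately show ?thesis
      using hn_lower[of "\<Theta> k"] by linarith
  qed
  then have "bounded {k. hdist c (\<Theta> k) \<le> r}"
    by (auto simp: bounded_iff)
  ultimately show ?thesis
    by (simp add: compact_eq_bounded_closed)
qed

lemma lmeasurable_iso_ball: "{k. hdist c (\<Theta> k) \<le> r} \<in> lmeasurable"
  by (rule lmeasurable_compact[OF compact_iso_ball])

text \<open>The map \<open>A\<close> of \<open>hdist_iso\<close> is a translation after a shear
  along \<open>axis i0 1\<close>. It is a shear because \<open>om\<close> vanishes on the vertical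
  direction, and so it preserves Lebesgue measure.\<close>

lemma area_profile: "profile TYPE('n) i0 (offs \<Theta> c) \<in> lmeasurable" "area \<Theta> c = measure lebesgue (profile TYPE('n) i0 (offs \<Theta> c))"
proof -
  define A where "A k = k - isoadj \<Theta> (hor c) - (c $ iT + om c (\<Theta> k) / 2) *\<^sub>R axis i0 1" for k
  define w where "w = (\<chi> i. - om c (\<Theta> (axis i 1)) / 2)"
  define B where "B h = h + inner w h *\<^sub>R axis i0 1" for h
  have lom: "linear (\<lambda>k. om c (\<Theta> k))"
    by (rule linearI) (auto simp: linear_add[OF iso_lin] linear_scale[OF iso_lin] om_simps)
  have iw: "inner w h = - om c (\<Theta> h) / 2" for h
  proof -
    have "om c (\<Theta> h) = om c (\<Theta> (\<Sum>i\<in>UNIV. (h $ i) *\<^sub>R axis i 1))"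
      by (simp add: vec_expansion)
    also have "\<dots> = (\<Sum>i\<in>UNIV. (h $ i) * om c (\<Theta> (axis i 1)))"
      by (subst linear_sum[OF lom]) (simp add: linear_scale[OF lom])
    finally show ?thesis
      by (simp add: w_def inner_vec_def sum_negf sum_divide_distrib mult.commute)
  qed
  have AB: "A k = B k - (isoadj \<Theta> (hor c) + (c $ iT) *\<^sub>R axis i0 1)" for k
    by (simp add: A_def B_def iw algebra_simps scaleR_add_left)
  have w0: "w $ i0 = 0" by (simp add: w_def iso_axis)
  have BB: "B (h - inner w h *\<^sub>R axis i0 1) = h" "B h - inner w (B h) *\<^sub>R axis i0 1 = h" for h
    using w0 by (simp_all add: B_def inner_diff_right inner_add_right inner_axis)
  have linB: "linear B"
    by (rule linearI) (auto simp: B_def inner_add_right algebra_simps scaleR_add_left)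
  have blB: "bounded_linear B" using linB by (simp add: linear_linear)
  have injA: "inj A"
    by (rule injI) (metis AB BB(2) diff_add_cancel)
  have surA: "surj A"
    by (rule surjI[where f = "\<lambda>h. let g = h + (isoadj \<Theta> (hor c) + (c $ iT) *\<^sub>R axis i0 1) in g - inner w g *\<^sub>R axis i0 1"])
      (simp only: AB Let_def BB(1) add_diff_cancel_right')
  let ?E = "{k. hdist c (\<Theta> k) \<le> 1}" and ?Z = "profile TYPE('n) i0 (offs \<Theta> c)"
  have E: "?E = A -` ?Z"
    using hdist_iso by (auto simp: A_def)
  have AE: "A ` ?E = ?Z"
    unfolding E using surA by (simp add: surj_image_vimage_eq)
  have det: "det (matrix B) = 1"
    unfolding B_def by (rule det_shear[OF w0])
  have der: "(A has_derivative B) (at k within ?E)" for k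
    unfolding AB[abs_def]
    by (rule has_derivative_eq_rhs[OF has_derivative_diff[OF bounded_linear.has_derivative[OF blB has_derivative_ident] has_derivative_const]]) simp
  note * = differentiable_image_bounds[OF lmeasurable_iso_ball[of c 1] der inj_on_subset[OF injA], of 1 1, unfolded AE det]
  show "?Z \<in> lmeasurable" using * by simp
  show "area \<Theta> c = measure lebesgue ?Z" using *(2,3) by (simp add: area_def)
qed

lemma area_le: "area \<Theta> c \<le> measure lebesgue (cball 0 2 :: (real^'m) set)"
proof -
  have "profile TYPE('n) i0 (offs \<Theta> c) \<subseteq> cball 0 2"
  proof
    fix k assume k: "k \<in> profile TYPE('n) i0 (offs \<Theta> c)"
    define x where "x = sqrt ((norm (vpart i0 k))\<^sup>2 + offs \<Theta> c) *\<^sub>R axis (iX undefined) 1 + (k $ i0) *\<^sub>R (eT :: 'n heis)"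
    have h: "hn x \<le> 1" using k by (simp add: profile_def x_def)
    have X: "(axis (iX undefined) 1 :: 'n heis) $ iT = 0" by (simp add: axis_def)
    have "norm (hor x) = sqrt ((norm (vpart i0 k))\<^sup>2 + offs \<Theta> c)"
      using offs_nonneg[of c] by (simp add: x_def hor_add hor_scale hor_id X norm_axis_1)
    then have "(norm (vpart i0 k))\<^sup>2 \<le> (norm (hor x))\<^sup>2"
      using offs_nonneg[of c] by simp
    also have "\<dots> \<le> 1\<^sup>2"
      using hn_lower(1)[of x] h by (intro power_mono) auto
    finally have 1: "(norm (vpart i0 k))\<^sup>2 \<le> 1" by simp
    have "\<bar>x $ iT\<bar> \<le> 1\<^sup>2"
      using hn_lower(2)[of x] power_mono[OF h, of 2] by simp
    moreover have "x $ iT = k $ i0" by (simp add: x_def X)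
    ultimately have "(k $ i0)\<^sup>2 \<le> 1" by (simp add: abs_square_le_1)
    with 1 have "(norm k)\<^sup>2 \<le> 2\<^sup>2" using norm_vpart_sq[of k i0] by simp
    then have "norm k \<le> 2" by (rule power2_le_imp_le) simp
    then show "k \<in> cball 0 2" by simp
  qed
  then show ?thesis
    unfolding area_profile(2) by (intro measure_mono_fmeasurable) (use area_profile(1) in auto)
qed

lemma bdd_area: "bdd_above (range (area \<Theta>))"
  using area_le by (intro bdd_aboveI2)

lemma area_0_pos: "area \<Theta> 0 > 0"
proof -
  \<comment> \<open>With radius 1/64 the bound of \<open>hn_upper\<close> becomes 1/64 + 4/8, which
    is below 1.\<close>
  have "ball 0 (1/64) \<subseteq> {k. hdist 0 (\<Theta> k) \<le> 1}"
  proof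
    fix k :: "real^'m" assume "k \<in> ball 0 (1/64)"
    then have k: "norm k \<le> 1/64" by simp
    have "hn (\<Theta> k) \<le> norm (hor (\<Theta> k)) + 4 * sqrt \<bar>\<Theta> k $ iT\<bar>" by (rule hn_upper)
    also have "\<dots> \<le> 1/64 + 4 * sqrt (1/64)"
    proof (intro add_mono mult_left_mono real_sqrt_le_mono)
      show "norm (hor (\<Theta> k)) \<le> 1/64" using norm_hor_le[of "\<Theta> k"] k iso_norm[of k] by linarith
      show "\<bar>\<Theta> k $ iT\<bar> \<le> 1/64" using abs_T_le[of "\<Theta> k"] k iso_norm[of k] by linarith
    qed simp
    also have "sqrt (1/64) = 1/8" by (rule real_sqrt_unique) (auto simp: power2_eq_square)
    finally show "k \<in> {k. hdist 0 (\<Theta> k) \<le> 1}" by (simp add: hdist_def)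
  qed
  then have "measure lebesgue (ball 0 (1/64) :: (real^'m) set) \<le> area \<Theta> 0"
    unfolding area_def by (intro measure_mono_fmeasurable lmeasurable_iso_ball) auto
  moreover have "measure lebesgue (ball 0 (1/64) :: (real^'m) set) > 0"
    using content_ball_pos[of "1/64" "0 :: real^'m"] by simp
  ultimately show ?thesis by linarith
qed

lemma iso_dil: "\<Theta> (r *\<^sub>R vpart i0 k + (r\<^sup>2 * k $ i0) *\<^sub>R axis i0 1) = dil r (\<Theta> k)"
  by (simp add: dil_def iso_hor iso_T linear_add[OF iso_lin] linear_scale[OF iso_lin] iso_axis)

lemma hdist_dil: "r > 0 \<Longrightarrow> hdist (dil r x) (dil r y) = r * hdist x y"
  by (simp add: hdist_def dil_uminus[symmetric] dil_mult[symmetric] hn_dil)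

text \<open>On the subspace the dilation multiplies the coordinate \<open>i0\<close> by
  \<open>r\<^sup>2\<close> and the remaining ones by \<open>r\<close>. This is where the Hausdorff
  dimension \<open>CARD('m) + 1\<close> comes from.\<close>

lemma measure_iso_ball:
  assumes r: "r > 0"
  shows "measure lebesgue {k. hdist (dil r c) (\<Theta> k) \<le> r} = r ^ (CARD('m) + 1) * area \<Theta> c"
proof -
  define B where "B k = r *\<^sub>R vpart i0 k + (r\<^sup>2 * k $ i0) *\<^sub>R axis i0 1" for k
  have linB: "linear B"
    by (rule linearI) (auto simp: B_def vpart_def algebra_simps scaleR_add_left)
  have Bn: "B k $ i = (if i = i0 then r\<^sup>2 else r) * k $ i" for k i
    by (simp add: B_def vpart_def axis_def)
  have injB: "inj B"
    using r by (auto simp: inj_def vec_eq_iff Bn split: if_splits)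
  have Bsurj: "\<exists>k. B k = l" for l
    using r by (intro exI[of _ "\<chi> i. l $ i / (if i = i0 then r\<^sup>2 else r)"]) (simp add: vec_eq_iff Bn)
  have "det (matrix B) = (\<Prod>i\<in>UNIV. matrix B $ i $ i)"
    by (rule det_diagonal) (simp add: matrix_def Bn axis_def)
  also have "\<dots> = (\<Prod>i\<in>UNIV. if i = i0 then r\<^sup>2 else r)"
    by (simp add: matrix_def Bn axis_def)
  also have "\<dots> = r\<^sup>2 * r ^ (CARD('m) - 1)"
    by (subst prod.remove[of _ i0]) (simp_all add: card_Diff_singleton)
  also have "\<dots> = r ^ (2 + (CARD('m) - 1))"
    by (rule power_add[symmetric])
  also have "2 + (CARD('m) - 1) = CARD('m) + 1"
    using zero_less_card_finite[where 'a = 'm] by simp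
  finally have det: "\<bar>det (matrix B)\<bar> = r ^ (CARD('m) + 1)"
    using r by simp
  let ?E = "{k. hdist c (\<Theta> k) \<le> 1}"
  have "hdist (dil r c) (\<Theta> (B k)) \<le> r \<longleftrightarrow> hdist c (\<Theta> k) \<le> 1" for k
    using r by (simp add: B_def iso_dil hdist_dil)
  then have BE: "B ` ?E = {k. hdist (dil r c) (\<Theta> k) \<le> r}"
    using Bsurj by (auto simp: image_iff) metis
  have der: "(B has_derivative B) (at k within ?E)" for k
    using linB by (rule linear_imp_has_derivative)
  note * = differentiable_image_bounds[OF lmeasurable_iso_ball[of c 1] der inj_on_subset[OF injB],
      of "r ^ (CARD('m) + 1)" "r ^ (CARD('m) + 1)", unfolded BE det]
  show ?thesis using *(2,3) by (simp add: area_def)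
qed

lemma measure_iso_ball_le:
  assumes r: "r > 0"
  shows "measure lebesgue {k. hdist c (\<Theta> k) \<le> r} \<le> (SUP c. area \<Theta> c) * r ^ (CARD('m) + 1)"
proof -
  have "c = dil r (dil (1/r) c)" using r by (simp add: dil_dil)
  then have "measure lebesgue {k. hdist c (\<Theta> k) \<le> r} = r ^ (CARD('m) + 1) * area \<Theta> (dil (1/r) c)"
    using measure_iso_ball[OF r, of "dil (1/r) c"] by simp
  also have "\<dots> \<le> r ^ (CARD('m) + 1) * (SUP c. area \<Theta> c)"
    using r by (intro mult_left_mono cSUP_upper bdd_area) auto
  finally show ?thesis by (simp add: mult.commute)
qed

lemma sup_area_pos: "(SUP c. area \<Theta> c) > 0"
  using area_0_pos cSUP_upper[OF UNIV_I bdd_area, of 0] by linarith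

text \<open>A nearly optimal centre chosen at unit scale serves all scales after dilation, so
  \<open>c\<close> can be fixed before \<open>r\<close>.\<close>

lemma measure_iso_ball_ge:
  assumes "e > 0"
  obtains c where "\<And>r. r > 0 \<Longrightarrow> measure lebesgue {k. hdist (dil r c) (\<Theta> k) \<le> r} \<ge> (1 - e) * (SUP c. area \<Theta> c) * r ^ (CARD('m) + 1)"
proof -
  have "(1 - e) * (SUP c. area \<Theta> c) < (SUP c. area \<Theta> c)"
    using sup_area_pos assms by (simp add: algebra_simps)
  then obtain c where c: "(1 - e) * (SUP c. area \<Theta> c) < area \<Theta> c"
    using less_cSUP_iff[OF _ bdd_area] by auto
  show thesis
  proof (rule that)
    fix r :: real assume r: "r > 0"
    have "(1 - e) * (SUP c. area \<Theta> c) * r ^ (CARD('m) + 1) \<le> area \<Theta> c * r ^ (CARD('m) + 1)"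
      using c r by (intro mult_right_mono) auto
    then show "measure lebesgue {k. hdist (dil r c) (\<Theta> k) \<le> r} \<ge> (1 - e) * (SUP c. area \<Theta> c) * r ^ (CARD('m) + 1)"
      by (simp add: measure_iso_ball[OF r] mult.commute)
  qed
qed

lemma dim_range_iso: "dim (range \<Theta>) = CARD('m)"
  using dim_image_eq[OF iso_lin, of UNIV] iso_inj by (simp add: inj_on_subset)

end

text \<open>A nonzero value shows that the first subspace is proper, hence the second one, being of
  equal dimension, is proper too. It then has a normal direction, horizontal because the subspace
  contains the vertical one, along which every distance occurs.\<close>

lemma offs_attained:
  fixes \<Theta> \<Theta>' :: "real^'m::finite \<Rightarrow> 'n::finite heis"
  assumes \<Theta>: "vert_iso i0 \<Theta>" and \<Theta>': "vert_iso i0 \<Theta>'"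
  shows "\<exists>c'. offs \<Theta>' c' = offs \<Theta> c"
proof (cases "offs \<Theta> c = 0")
  case True
  have "isoadj \<Theta>' 0 = 0" by (simp add: isoadj_def vec_eq_iff)
  then have "offs \<Theta>' 0 = 0"
    by (simp add: offs_def)
  with True show ?thesis by metis
next
  case False
  have "hor c \<notin> range \<Theta>"
  proof
    assume "hor c \<in> range \<Theta>"
    then obtain k where "hor c = \<Theta> k" by blast
    then have "offs \<Theta> c = 0"
      by (simp add: offs_def isoadj_iso[OF \<Theta>] iso_norm[OF \<Theta>])
    with False show False ..
  qed
  then have "range \<Theta> \<noteq> UNIV" by blast
  then have "dim (range \<Theta>) \<noteq> DIM('n heis)"
    using linear_subspace_image[OF iso_lin[OF \<Theta>] subspace_UNIV] by (metis dim_eq_full span_eq_iff)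
  then have "dim (range \<Theta>') < DIM('n heis)"
    using dim_subset_UNIV[of "range \<Theta>"] by (simp add: dim_range_iso[OF \<Theta>] dim_range_iso[OF \<Theta>'])
  then obtain w where w: "w \<noteq> 0" "\<And>y. y \<in> span (range \<Theta>') \<Longrightarrow> orthogonal w y"
    by (rule orthogonal_to_subspace_exists) blast
  then have o: "inner w (\<Theta>' k) = 0" for k
    by (simp add: orthogonal_def span_base)
  have wT: "w $ iT = 0"
    using o[of "axis i0 1"] by (simp add: iso_axis[OF \<Theta>'])
  define c' where "c' = (sqrt (offs \<Theta> c) / norm w) *\<^sub>R w"
  have "isoadj \<Theta>' (hor c') = 0"
    by (simp add: isoadj_def vec_eq_iff c'_def hor_scale hor_id wT o)
  then have "offs \<Theta>' c' = offs \<Theta> c"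
    using w(1) offs_nonneg[OF \<Theta>, of c] by (simp add: offs_def c'_def hor_scale hor_id wT)
  then show ?thesis ..
qed

lemma sup_area_eq:
  fixes \<Theta> \<Theta>' :: "real^'m::finite \<Rightarrow> 'n::finite heis"
  assumes "vert_iso i0 \<Theta>" "vert_iso i0 \<Theta>'"
  shows "(SUP c. area \<Theta> c) = (SUP c. area \<Theta>' c)"
proof -
  have "range (area \<Theta>) \<subseteq> range (area \<Theta>')" if "vert_iso i0 \<Theta>" "vert_iso i0 \<Theta>'" for \<Theta> \<Theta>' :: "real^'m \<Rightarrow> 'n heis"
    using offs_attained[OF that] area_profile(2)[OF that(1)] area_profile(2)[OF that(2)] by auto (metis rangeI)
  then have "range (area \<Theta>) = range (area \<Theta>')"
    using assms by (intro antisym) auto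
  then show ?thesis by simp
qed

lemma vert_iso_exists:
  fixes N :: "'n::finite heis set" and i0 :: "'m::finite"
  assumes N: "subspace N" "\<And>x. x \<in> N \<Longrightarrow> x $ iT = 0" and d: "dim N = CARD('m) - 1"
  obtains \<Theta> :: "real^'m \<Rightarrow> 'n heis" where "vert_iso i0 \<Theta>" "\<Theta> ` {k. k $ i0 = 0} = N"
proof -
  have dS: "dim {k :: real^'m. k $ i0 = 0} = CARD('m) - 1"
    using dim_hyperplane[of "axis i0 1 :: real^'m"] by (simp add: inner_axis' axis_eq_0_iff)
  have sS: "subspace {k :: real^'m. k $ i0 = 0}"
    by (simp add: subspace_def)
  obtain f where f: "linear f" "f ` {k :: real^'m. k $ i0 = 0} = N"
    "\<And>k. k \<in> {k :: real^'m. k $ i0 = 0} \<Longrightarrow> norm (f k) = norm k"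
    using isometries_subspaces[OF sS N(1)] dS d by metis
  define \<Theta> where "\<Theta> k = f (vpart i0 k) + (k $ i0) *\<^sub>R eT" for k
  have fN: "f (vpart i0 k) \<in> N" for k
    using f(2) by (metis (mono_tags, lifting) image_eqI mem_Collect_eq vpart_nth)
  have "linear \<Theta>"
    by (rule linearI)
      (auto simp: \<Theta>_def vpart_def linear_add[OF f(1)] linear_diff[OF f(1)] linear_scale[OF f(1)] algebra_simps scaleR_add_left)
  moreover have "norm (\<Theta> k) = norm k" for k
  proof -
    have "(norm (\<Theta> k))\<^sup>2 = (norm (f (vpart i0 k)))\<^sup>2 + (norm ((k $ i0) *\<^sub>R (eT :: 'n heis)))\<^sup>2"
      unfolding \<Theta>_def by (rule norm_add_Pythagorean) (simp add: orthogonal_def N(2)[OF fN])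
    also have "\<dots> = (norm k)\<^sup>2"
      using f(3)[of "vpart i0 k"] norm_vpart_sq[of k i0] by simp
    finally show ?thesis by simp
  qed
  moreover have "\<Theta> (axis i0 1) = eT"
    by (simp add: \<Theta>_def vpart_def linear_0[OF f(1)])
  ultimately have "vert_iso i0 \<Theta>" by (simp add: vert_iso_def)
  moreover have "\<Theta> ` {k. k $ i0 = 0} = N"
    using f(2) by (auto simp: \<Theta>_def vpart_def image_iff)
  ultimately show thesis by (rule that)
qed

section \<open>Blow-up at a non-horizontal point\<close>

lemma vertical_decomposition:
  fixes L :: "real^'m::finite \<Rightarrow> 'n::finite heis" and i0 :: 'm
  assumes lin: "linear L" and inj: "inj L" and nh: "L h0 $ iT \<noteq> 0"
  obtains \<Theta> q \<kappa> where "vert_iso i0 \<Theta>" "\<kappa> > 0"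
    "\<And>h. L h = \<Theta> (isoadj \<Theta> (L h)) + (L h $ iT) *\<^sub>R q"
    "\<And>h. \<kappa> * norm h \<le> norm (isoadj \<Theta> (L h))"
proof -
  define K where "K = {h. L h $ iT = 0}"
  define a where "a = (\<chi> i. L (axis i 1) $ iT)"
  have linT: "linear (\<lambda>h. L h $ iT)"
    by (rule linearI) (auto simp: linear_add[OF lin] linear_scale[OF lin])
  have a: "L h $ iT = inner a h" for h
  proof -
    have "L h $ iT = L (\<Sum>i\<in>UNIV. (h $ i) *\<^sub>R axis i 1) $ iT" by (simp add: vec_expansion)
    also have "\<dots> = (\<Sum>i\<in>UNIV. (h $ i) * L (axis i 1) $ iT)"
      by (subst linear_sum[OF linT]) (simp add: linear_scale[OF lin])
    finally show ?thesis by (simp add: a_def inner_vec_def mult.commute)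
  qed
  have "a \<noteq> 0" using nh a[of h0] by auto
  then have dK: "dim K = CARD('m) - 1"
    using dim_hyperplane[of a] by (simp add: K_def a)
  have sK: "subspace K"
    by (auto simp: K_def subspace_def linear_0[OF lin] linear_add[OF lin] linear_scale[OF lin])
  have sN: "subspace (L ` K)"
    by (rule linear_subspace_image[OF lin sK])
  have dN: "dim (L ` K) = CARD('m) - 1"
    using dim_image_eq[OF lin, of K] inj dK by (simp add: inj_on_subset)
  obtain \<Theta> :: "real^'m \<Rightarrow> 'n heis" where \<Theta>: "vert_iso i0 \<Theta>" "\<Theta> ` {k. k $ i0 = 0} = L ` K"
    using vert_iso_exists[OF sN _ dN] by (metis (mono_tags, lifting) K_def imageE mem_Collect_eq)
  define R where "R h = L h - \<Theta> (isoadj \<Theta> (L h))" for h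
  have linR: "linear R"
    by (rule linearI) (auto simp: R_def linear_add[OF lin] linear_scale[OF lin] linear_add[OF linear_isoadj]
        linear_scale[OF linear_isoadj] linear_add[OF iso_lin[OF \<Theta>(1)]] linear_scale[OF iso_lin[OF \<Theta>(1)]] algebra_simps)
  have RK: "R h = 0" if "L h $ iT = 0" for h
  proof -
    have "L h \<in> \<Theta> ` {k. k $ i0 = 0}" using that \<Theta>(2) by (auto simp: K_def)
    then obtain k where "L h = \<Theta> k" by blast
    then show ?thesis by (simp add: R_def isoadj_iso[OF \<Theta>(1)])
  qed
  define w where "w = (1 / (L h0 $ iT)) *\<^sub>R h0"
  have wT: "L w $ iT = 1" using nh by (simp add: w_def linear_scale[OF lin])
  have R: "R h = (L h $ iT) *\<^sub>R R w" for h
  proof -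
    have "R (h - (L h $ iT) *\<^sub>R w) = 0"
      by (rule RK) (simp add: linear_diff[OF lin] linear_scale[OF lin] wT)
    then show ?thesis by (simp add: linear_diff[OF linR] linear_scale[OF linR])
  qed
  have linM: "linear (\<lambda>h. isoadj \<Theta> (L h))"
    using linear_compose[OF lin linear_isoadj] by (simp add: comp_def)
  have "inj (\<lambda>h. isoadj \<Theta> (L h))"
  proof (rule linear_injective_0[OF linM, THEN iffD2], intro allI impI)
    fix h assume h: "isoadj \<Theta> (L h) = 0"
    then have "L h $ iT = 0" using isoadj_T[OF \<Theta>(1), of "L h"] by simp
    then have "L h = 0" using RK[of h] h linear_0[OF iso_lin[OF \<Theta>(1)]] by (simp add: R_def)
    then show "h = 0" using inj linear_injective_0[OF lin] by blast
  qed
  then obtain \<kappa> where \<kappa>: "\<kappa> > 0" "\<And>h. \<kappa> * norm h \<le> norm (isoadj \<Theta> (L h))"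
    using linear_inj_bounded_below_pos[OF linM] by (metis mult.commute)
  show thesis
  proof (rule that[OF \<Theta>(1) \<kappa>(1)])
    show "L h = \<Theta> (isoadj \<Theta> (L h)) + (L h $ iT) *\<^sub>R R w" for h
      unfolding R[of h, symmetric] by (simp add: R_def)
  qed (rule \<kappa>(2))
qed

text \<open>The projection keeps the vertical coordinate, so the error \<open>g - \<Theta> F\<close>
  is horizontal. The vertical part of the left quotient is then only the symplectic twist of
  \<open>\<Theta> F\<close> with the error, and \<open>hn_upper\<close> takes its square
  root.\<close>

lemma hdist_isoadj_le:
  assumes \<Theta>: "vert_iso i0 \<Theta>" and F: "F = isoadj \<Theta> g"
  shows "hdist (\<Theta> F) g \<le> norm (g - \<Theta> F) + 4 * sqrt (norm F * norm (g - \<Theta> F))"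
proof -
  let ?e = "g - \<Theta> F"
  have eT0: "?e $ iT = 0"
    by (simp add: F iso_T[OF \<Theta>] isoadj_T[OF \<Theta>])
  have "hdist (\<Theta> F) g = hn (cof (\<Theta> F) ?e)"
    by (simp add: hdist_def ldiff_cof)
  also have "\<dots> \<le> norm (hor (cof (\<Theta> F) ?e)) + 4 * sqrt \<bar>cof (\<Theta> F) ?e $ iT\<bar>"
    by (rule hn_upper)
  also have "\<dots> \<le> norm ?e + 4 * sqrt (norm F * norm ?e)"
  proof (intro add_mono mult_left_mono real_sqrt_le_mono)
    show "norm (hor (cof (\<Theta> F) ?e)) \<le> norm ?e" by (simp only: hor_cof norm_hor_le)
    have "\<bar>om (\<Theta> F) ?e\<bar> \<le> norm F * norm ?e"
      using om_bound'[of "\<Theta> F" ?e] by (simp add: iso_norm[OF \<Theta>])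
    moreover have "\<bar>cof (\<Theta> F) ?e $ iT\<bar> = \<bar>om (\<Theta> F) ?e\<bar> / 2"
      using eT0 by (simp add: cof_T)
    ultimately show "\<bar>cof (\<Theta> F) ?e $ iT\<bar> \<le> norm F * norm ?e" by linarith
  qed simp
  finally show ?thesis .
qed

locale blow_up =
  fixes i0 :: "'m::finite" and \<Theta> L :: "real^'m \<Rightarrow> 'n::finite heis" and Q \<kappa> :: real
  assumes \<Theta>: "vert_iso i0 \<Theta>" and linL: "linear L" and Q: "Q \<ge> 0" and \<kappa>: "\<kappa> > 0"
    and resid: "\<And>h. norm (L h - \<Theta> (isoadj \<Theta> (L h))) \<le> Q * \<bar>L h $ iT\<bar>"
    and expand: "\<And>h. \<kappa> * norm h \<le> norm (isoadj \<Theta> (L h))"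
begin

text \<open>The projection \<open>isoadj \<Theta>\<close> does not increase norms, so a relative
  error up to \<open>\<kappa> / 2\<close> consumes at most half of the expansion \<kappa> of the
  linear map.\<close>

lemma expand':
  assumes g: "norm (g - L h) \<le> \<epsilon> * norm h" and \<epsilon>: "\<epsilon> \<le> \<kappa> / 2"
  shows "norm h \<le> 2 / \<kappa> * norm (isoadj \<Theta> g)"
proof -
  have "norm (isoadj \<Theta> g - isoadj \<Theta> (L h)) \<le> norm (g - L h)"
    using isoadj_norm[OF \<Theta>, of "g - L h"] by (simp add: linear_diff[OF linear_isoadj])
  also have "\<dots> \<le> \<kappa> / 2 * norm h"
    using g \<epsilon> by (meson mult_right_mono norm_ge_zero order_trans)
  finally have "norm (isoadj \<Theta> g - isoadj \<Theta> (L h)) \<le> \<kappa> / 2 * norm h" .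
  moreover have "norm (isoadj \<Theta> (L h)) \<le> norm (isoadj \<Theta> g) + norm (isoadj \<Theta> g - isoadj \<Theta> (L h))"
    by (metis add.commute diff_add_cancel norm_minus_commute norm_triangle_ineq)
  ultimately have "\<kappa> / 2 * norm h \<le> norm (isoadj \<Theta> g)"
    using expand[of h] by linarith
  then show ?thesis using \<kappa> by (simp add: field_simps)
qed

lemma linear_iso_L: "linear (\<lambda>h. isoadj \<Theta> (L h))"
  using linear_compose[OF linL linear_isoadj] by (simp add: comp_def)

lemma inj_iso_L: "inj (\<lambda>h. isoadj \<Theta> (L h))"
proof (rule linear_injective_0[OF linear_iso_L, THEN iffD2], intro allI impI)
  fix h assume "isoadj \<Theta> (L h) = 0"
  then show "h = 0" using expand[of h] \<kappa> by (simp add: mult_le_0_iff)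
qed

text \<open>
  Near the identity a horizontal error of size \<open>e\<close> in a point at Euclidean distance \<open>O(r)\<close> costs the
  distance only \<open>O(e + sqrt (r * e))\<close>, which is \<open>o(r)\<close> as soon as \<open>e = o(r)\<close>: strict differentiability
  suffices, and no second-order information on the surface is needed.
\<close>

lemma near_vertical:
  assumes C: "C \<ge> 1" and \<eta>: "\<eta> > 0"
  obtains \<epsilon> where "0 < \<epsilon>" "\<epsilon> \<le> \<kappa> / 2" "\<epsilon> \<le> 1"
    "\<And>g h r. \<lbrakk>norm (g - L h) \<le> \<epsilon> * norm h; 0 < r; r \<le> \<epsilon>; norm (isoadj \<Theta> g) \<le> C * r; \<bar>g $ iT\<bar> \<le> C * r\<^sup>2\<rbrakk>
      \<Longrightarrow> hdist (\<Theta> (isoadj \<Theta> g)) g \<le> \<eta> * r"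
proof -
  \<comment> \<open>Chosen so that the error \<open>g - \<Theta> (isoadj \<Theta> g)\<close> is at
    most \<open>\<epsilon> * r * C1\<close>: the term \<open>Q * C\<close> comes from the vertical
    coordinate of \<open>g\<close>, using \<open>r \<le> \<epsilon>\<close>, and
    \<open>2 * C / \<kappa>\<close> bounds \<open>norm h / r\<close>.\<close>
  define C1 where "C1 = Q * C + (Q + 2) * (2 * C / \<kappa>)"
  have C1: "C1 > 0" using C Q \<kappa> by (simp add: C1_def add_nonneg_pos)
  have "((\<lambda>\<epsilon>. \<epsilon> * C1 + 4 * sqrt (C * C1 * \<epsilon>)) \<longlongrightarrow> 0 * C1 + 4 * sqrt (C * C1 * 0)) (at_right 0)"
    by (intro tendsto_intros)
  then have "((\<lambda>\<epsilon>. \<epsilon> * C1 + 4 * sqrt (C * C1 * \<epsilon>)) \<longlongrightarrow> 0) (at_right 0)" by simp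
  then have "\<forall>\<^sub>F \<epsilon> in at_right 0. \<epsilon> * C1 + 4 * sqrt (C * C1 * \<epsilon>) < \<eta>"
    using \<eta> by (rule order_tendstoD)
  moreover have "\<forall>\<^sub>F \<epsilon> in at_right (0::real). \<epsilon> < min (\<kappa> / 2) 1"
    using \<kappa> by (intro eventually_at_right_real[THEN eventually_mono, of 0 "min (\<kappa> / 2) 1"]) auto
  moreover have "\<forall>\<^sub>F \<epsilon> in at_right (0::real). 0 < \<epsilon>"
    by (rule eventually_at_right_less)
  ultimately have ev: "\<forall>\<^sub>F \<epsilon> in at_right 0. \<epsilon> * C1 + 4 * sqrt (C * C1 * \<epsilon>) < \<eta> \<and> \<epsilon> < min (\<kappa> / 2) 1 \<and> 0 < \<epsilon>"
    by eventually_elim auto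
  obtain \<epsilon> where \<epsilon>: "\<epsilon> * C1 + 4 * sqrt (C * C1 * \<epsilon>) < \<eta>" "\<epsilon> < min (\<kappa> / 2) 1" "0 < \<epsilon>"
    using eventually_happens'[OF trivial_limit_at_right_real ev] by blast
  show thesis
  proof (rule that[of \<epsilon>])
    fix g h r assume g: "norm (g - L h) \<le> \<epsilon> * norm h" and r: "0 < r" "r \<le> \<epsilon>"
      and F: "norm (isoadj \<Theta> g) \<le> C * r" and T: "\<bar>g $ iT\<bar> \<le> C * r\<^sup>2"
    let ?F = "isoadj \<Theta> g"
    let ?e = "g - \<Theta> ?F"
    have h: "norm h \<le> 2 * C / \<kappa> * r"
    proof -
      have "norm h \<le> 2 / \<kappa> * norm ?F" using g \<epsilon> by (intro expand') auto
      also have "\<dots> \<le> 2 / \<kappa> * (C * r)" using F \<kappa> by (intro mult_left_mono) auto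
      finally show ?thesis by simp
    qed
    have d: "norm (\<Theta> (isoadj \<Theta> (g - L h))) \<le> \<epsilon> * norm h"
      using isoadj_norm[OF \<Theta>, of "g - L h"] g by (simp add: iso_norm[OF \<Theta>])
    have eq: "?e = (L h - \<Theta> (isoadj \<Theta> (L h))) + (g - L h) - \<Theta> (isoadj \<Theta> (g - L h))"
      by (simp add: linear_diff[OF linear_isoadj] linear_diff[OF iso_lin[OF \<Theta>]])
    have "norm ?e \<le> norm (L h - \<Theta> (isoadj \<Theta> (L h))) + norm (g - L h) + norm (\<Theta> (isoadj \<Theta> (g - L h)))"
      unfolding eq
      using norm_triangle_ineq4[of "(L h - \<Theta> (isoadj \<Theta> (L h))) + (g - L h)" "\<Theta> (isoadj \<Theta> (g - L h))"]
        norm_triangle_ineq[of "L h - \<Theta> (isoadj \<Theta> (L h))" "g - L h"] by linarith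
    also have "\<dots> \<le> Q * \<bar>L h $ iT\<bar> + \<epsilon> * norm h + \<epsilon> * norm h"
      using resid g d by (intro add_mono)
    also have "\<bar>L h $ iT\<bar> \<le> C * r\<^sup>2 + \<epsilon> * norm h"
    proof -
      have "\<bar>(g - L h) $ iT\<bar> \<le> \<epsilon> * norm h" using abs_T_le[of "g - L h"] g by linarith
      then show ?thesis using T by simp
    qed
    also have "Q * (C * r\<^sup>2 + \<epsilon> * norm h) + \<epsilon> * norm h + \<epsilon> * norm h = Q * C * r\<^sup>2 + (Q + 2) * (\<epsilon> * norm h)"
      by (simp add: algebra_simps)
    also have "\<dots> \<le> Q * C * (\<epsilon> * r) + (Q + 2) * (\<epsilon> * (2 * C / \<kappa> * r))"
    proof (intro add_mono mult_left_mono h)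
      show "r\<^sup>2 \<le> \<epsilon> * r" using r by (simp add: power2_eq_square)
    qed (use Q C \<epsilon> in auto)
    also have "\<dots> = \<epsilon> * r * C1" by (simp add: C1_def algebra_simps)
    finally have e: "norm ?e \<le> \<epsilon> * r * C1" using Q by (simp add: mult_left_mono)
    have "hdist (\<Theta> ?F) g \<le> norm ?e + 4 * sqrt (norm ?F * norm ?e)"
      by (rule hdist_isoadj_le[OF \<Theta> refl])
    also have "\<dots> \<le> \<epsilon> * r * C1 + 4 * sqrt ((C * r) * (\<epsilon> * r * C1))"
      using e F C r by (intro add_mono mult_left_mono real_sqrt_le_mono mult_mono) auto
    also have "(C * r) * (\<epsilon> * r * C1) = (C * C1 * \<epsilon>) * r\<^sup>2" by (simp add: power2_eq_square)
    also have "sqrt ((C * C1 * \<epsilon>) * r\<^sup>2) = sqrt (C * C1 * \<epsilon>) * r"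
      using r by (simp add: real_sqrt_mult)
    also have "\<epsilon> * r * C1 + 4 * (sqrt (C * C1 * \<epsilon>) * r) = (\<epsilon> * C1 + 4 * sqrt (C * C1 * \<epsilon>)) * r"
      by (simp add: algebra_simps)
    also have "\<dots> \<le> \<eta> * r" using \<epsilon> r by (intro mult_right_mono) auto
    finally show "hdist (\<Theta> ?F) g \<le> \<eta> * r" .
  qed (use \<epsilon> in auto)
qed

end

text \<open>
  Since \<open>heis_mult (- x) y = cof x (y - x)\<close>, assumption \<open>close\<close> is strict differentiability of \<open>\<phi>\<close> at
  \<open>u0\<close>, read in the left translates by the inverses of the points \<open>\<phi> u1\<close>.
\<close>

locale blow_up_chart = blow_up i0 \<Theta> L Q \<kappa>
  for i0 :: "'m::finite" and \<Theta> L :: "real^'m \<Rightarrow> 'n::finite heis" and Q \<kappa> :: real +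
  fixes \<phi> :: "real^'m \<Rightarrow> 'n heis" and D :: "real^'m \<Rightarrow> real^'m \<Rightarrow> 'n heis" and u0 :: "real^'m"
    and s \<epsilon> \<tau> J0 :: real
  assumes s: "s > 0" and \<epsilon>: "0 < \<epsilon>" "\<epsilon> \<le> \<kappa> / 2" and \<tau>: "0 < \<tau>" "\<tau> < 1"
    and J0: "J0 = \<bar>det (matrix (\<lambda>h. isoadj \<Theta> (L h)))\<bar>"
    and der: "\<And>u. u \<in> ball u0 s \<Longrightarrow> (\<phi> has_derivative D u) (at u)"
    and close: "\<And>u1 u u'. \<lbrakk>u1 \<in> ball u0 s; u \<in> ball u0 s; u' \<in> ball u0 s\<rbrakk> \<Longrightarrow>
      norm (cof (\<phi> u1) (\<phi> u - \<phi> u') - L (u - u')) \<le> \<epsilon> * norm (u - u')"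
    and jac: "\<And>u1 u. \<lbrakk>u1 \<in> ball u0 s; u \<in> ball u0 s\<rbrakk> \<Longrightarrow>
      \<bar>\<bar>det (matrix (\<lambda>h. isoadj \<Theta> (cof (\<phi> u1) (D u h))))\<bar> - J0\<bar> \<le> \<tau> * J0"
begin

abbreviation W where "W \<equiv> ball u0 s"

text \<open>The surface seen from \<open>\<phi> u1\<close>: this point is translated to the identity
  and the surface is projected to the limit subspace. \<open>F u1\<close> is injective with Jacobian
  close to \<open>J0\<close>, so measures of subsets of \<open>W\<close> can be compared with areas
  in the subspace.\<close>

definition F where "F u1 u = isoadj \<Theta> (cof (\<phi> u1) (\<phi> u - \<phi> u1))"

definition beta where "beta = (SUP c. area \<Theta> c)"

definition E where "E c r = {u \<in> W. hdist c (\<phi> u) \<le> r}"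

lemma beta_pos: "beta > 0"
  unfolding beta_def by (rule sup_area_pos[OF \<Theta>])

lemma cont: "continuous_on W \<phi>"
  using der by (meson continuous_at_imp_continuous_on has_derivative_continuous)

lemma closed_E: "\<exists>T. closed T \<and> E c r = W \<inter> T"
  unfolding E_def by (rule closedin_hdist_ball[OF cont])

lemma lmeasurable_E: "E c r \<in> lmeasurable"
proof -
  obtain T where "closed T" "E c r = W \<inter> T" using closed_E by blast
  then have "E c r \<in> sets lebesgue" by auto
  moreover have "bounded (E c r)" by (rule bounded_subset[of W]) (auto simp: E_def)
  ultimately show ?thesis by (rule bounded_set_imp_lmeasurable[rotated])
qed

lemma F_eq: "F u1 u - F u1 u' = isoadj \<Theta> (cof (\<phi> u1) (\<phi> u - \<phi> u'))"
  by (simp add: F_def linear_diff[OF linear_isoadj, symmetric] linear_diff[OF linear_cof, symmetric])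

lemma F_expand:
  assumes "u1 \<in> W" "u \<in> W" "u' \<in> W"
  shows "norm (u - u') \<le> 2 / \<kappa> * norm (F u1 u - F u1 u')"
  unfolding F_eq by (rule expand'[OF close[OF assms] \<epsilon>(2)])

lemma F_inj: "u1 \<in> W \<Longrightarrow> inj_on (F u1) W"
  using F_expand[of u1] by (fastforce simp: inj_on_def)

lemma F_image:
  assumes u1: "u1 \<in> W" and S: "S \<subseteq> W" "S \<in> lmeasurable"
  shows "F u1 ` S \<in> lmeasurable" "(1 - \<tau>) * J0 * measure lebesgue S \<le> measure lebesgue (F u1 ` S)"
    "measure lebesgue (F u1 ` S) \<le> (1 + \<tau>) * J0 * measure lebesgue S"
proof -
  have bl: "bounded_linear (\<lambda>v. isoadj \<Theta> (cof (\<phi> u1) v))"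
    using linear_compose[OF linear_cof linear_isoadj] by (simp add: comp_def linear_linear)
  have d: "(F u1 has_derivative (\<lambda>h. isoadj \<Theta> (cof (\<phi> u1) (D u h)))) (at u within S)" if "u \<in> S" for u
  proof -
    have "u \<in> W" using that S(1) by blast
    then have "((\<lambda>u. \<phi> u - \<phi> u1) has_derivative D u) (at u)"
      using has_derivative_diff[OF der has_derivative_const[of "\<phi> u1"], of u] by simp
    then have "((\<lambda>u. \<phi> u - \<phi> u1) has_derivative D u) (at u within S)"
      by (rule has_derivative_at_withinI)
    from bounded_linear.has_derivative[OF bl this] show ?thesis
      by (simp add: F_def[abs_def])
  qed
  have b: "(1 - \<tau>) * J0 \<le> \<bar>det (matrix (\<lambda>h. isoadj \<Theta> (cof (\<phi> u1) (D u h))))\<bar>"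
    "\<bar>det (matrix (\<lambda>h. isoadj \<Theta> (cof (\<phi> u1) (D u h))))\<bar> \<le> (1 + \<tau>) * J0" if "u \<in> S" for u
    using jac[OF u1, of u] S that by (auto simp: algebra_simps abs_le_iff)
  note * = differentiable_image_bounds[OF S(2) d inj_on_subset[OF F_inj[OF u1] S(1)] b]
  show "F u1 ` S \<in> lmeasurable" "(1 - \<tau>) * J0 * measure lebesgue S \<le> measure lebesgue (F u1 ` S)"
    "measure lebesgue (F u1 ` S) \<le> (1 + \<tau>) * J0 * measure lebesgue S"
    using * by simp_all
qed

lemma hdist_F:
  assumes "u1 \<in> W" "u \<in> W"
  shows "hdist (\<phi> u1) (\<phi> u) = hn (cof (\<phi> u1) (\<phi> u - \<phi> u1))"
  by (simp add: hdist_def ldiff_cof)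

lemma hn_bounds:
  assumes "hn g \<le> t" "0 \<le> t" "t \<le> 1"
  shows "norm g \<le> 2 * t" "\<bar>g $ iT\<bar> \<le> t\<^sup>2"
proof -
  have "(hn g)\<^sup>2 \<le> t\<^sup>2" using assms by (intro power_mono) auto
  then show T: "\<bar>g $ iT\<bar> \<le> t\<^sup>2" using hn_lower(2)[of g] by linarith
  have "t\<^sup>2 \<le> t" using assms by (simp add: power2_eq_square mult_left_le)
  then show "norm g \<le> 2 * t" using norm_le_hor_T[of g] hn_lower(1)[of g] T assms by linarith
qed

lemma dist_le_hdist:
  assumes u: "u1 \<in> W" "u \<in> W" and t: "hdist (\<phi> u1) (\<phi> u) \<le> t" "t \<le> 1"
  shows "norm (u - u1) \<le> 4 / \<kappa> * t"
proof -
  have t0: "0 \<le> t" using t(1) hn_nonneg by (metis hdist_F order_trans u)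
  have "norm (u - u1) \<le> 2 / \<kappa> * norm (F u1 u)"
    using F_expand[OF u(1) u(2) u(1)] by (simp add: F_def linear_0[OF linear_isoadj])
  also have "\<dots> \<le> 2 / \<kappa> * (2 * t)"
  proof (intro mult_left_mono)
    show "norm (F u1 u) \<le> 2 * t"
      using hn_bounds(1)[of "cof (\<phi> u1) (\<phi> u - \<phi> u1)" t] isoadj_norm[OF \<Theta>] t t0
      by (simp add: F_def hdist_F[OF u]) (meson order_trans)
  qed (use \<kappa> in auto)
  finally show ?thesis by simp
qed

text \<open>The centre \<open>c\<close> may lie off the surface, so the translation is by a point
  \<open>u1\<close> of the set itself. The whole set is then within \<open>2 * r\<close> of the
  identity, which explains \<open>C \<ge> 4\<close>, and the projection moves it into a ball of
  radius \<open>(1 + \<tau>) * r\<close> about the translated centre.\<close>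

lemma ball_measure_le:
  assumes nv: "\<And>g h r. \<lbrakk>norm (g - L h) \<le> \<epsilon> * norm h; 0 < r; r \<le> \<epsilon>; norm (isoadj \<Theta> g) \<le> C * r; \<bar>g $ iT\<bar> \<le> C * r\<^sup>2\<rbrakk>
      \<Longrightarrow> hdist (\<Theta> (isoadj \<Theta> g)) g \<le> \<tau> * r"
    and C: "C \<ge> 4" and r: "0 < r" "r \<le> \<epsilon>" "2 * r \<le> 1"
  shows "(1 - \<tau>) * J0 * measure lebesgue (E c r) \<le> (1 + \<tau>) ^ (CARD('m) + 1) * beta * r ^ (CARD('m) + 1)"
proof (cases "E c r = {}")
  case True
  then show ?thesis using beta_pos \<tau> r by (simp add: less_imp_le)
next
  case False
  then obtain u1 where u1: "u1 \<in> E c r" by blast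
  then have u1W: "u1 \<in> W" by (simp add: E_def)
  let ?c = "heis_mult (- \<phi> u1) c"
  interpret distance "hdist :: 'n heis \<Rightarrow> 'n heis \<Rightarrow> real" 1 by (rule hdist_distance) simp
  have sub: "F u1 ` E c r \<subseteq> {k. hdist ?c (\<Theta> k) \<le> (1 + \<tau>) * r}"
  proof clarify
    fix u assume u: "u \<in> E c r"
    then have uW: "u \<in> W" by (simp add: E_def)
    let ?g = "heis_mult (- \<phi> u1) (\<phi> u)"
    have g: "?g = cof (\<phi> u1) (\<phi> u - \<phi> u1)" by (rule ldiff_cof)
    have "hdist (\<phi> u1) (\<phi> u) \<le> 2 * r"
      using rr_tri[of "\<phi> u1" "\<phi> u" c] rr_sym[of "\<phi> u1" c] u u1 by (simp add: E_def)
    then have hg: "hn ?g \<le> 2 * r" by (simp add: hdist_def)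
    have "hdist (\<Theta> (isoadj \<Theta> ?g)) ?g \<le> \<tau> * r"
    proof (rule nv)
      show "norm (?g - L (u - u1)) \<le> \<epsilon> * norm (u - u1)" unfolding g by (rule close[OF u1W uW u1W])
      have "norm (isoadj \<Theta> ?g) \<le> 4 * r"
        using hn_bounds(1)[OF hg] isoadj_norm[OF \<Theta>, of ?g] r by linarith
      also have "\<dots> \<le> C * r" using C r by (intro mult_right_mono) auto
      finally show "norm (isoadj \<Theta> ?g) \<le> C * r" .
      have "\<bar>?g $ iT\<bar> \<le> (2 * r)\<^sup>2" using hn_bounds(2)[OF hg] r by linarith
      also have "\<dots> = 4 * r\<^sup>2" by (simp add: power_mult_distrib)
      also have "\<dots> \<le> C * r\<^sup>2" using C r by (intro mult_right_mono) auto
      finally show "\<bar>?g $ iT\<bar> \<le> C * r\<^sup>2" .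
    qed (use r in auto)
    moreover have "hdist ?c ?g \<le> r" using u by (simp add: hdist_left E_def)
    ultimately show "hdist ?c (\<Theta> (F u1 u)) \<le> (1 + \<tau>) * r"
      using rr_tri[of ?c "\<Theta> (isoadj \<Theta> ?g)" ?g] rr_sym[of ?g "\<Theta> (isoadj \<Theta> ?g)"]
      by (simp add: F_def g algebra_simps)
  qed
  have "E c r \<subseteq> W" by (auto simp: E_def)
  then have "(1 - \<tau>) * J0 * measure lebesgue (E c r) \<le> measure lebesgue (F u1 ` E c r)"
    using F_image[OF u1W] lmeasurable_E by blast
  also have "\<dots> \<le> measure lebesgue {k. hdist ?c (\<Theta> k) \<le> (1 + \<tau>) * r}"
    using F_image(1)[OF u1W \<open>E c r \<subseteq> W\<close> lmeasurable_E] sub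
    by (intro measure_mono_fmeasurable lmeasurable_iso_ball[OF \<Theta>]) auto
  also have "\<dots> \<le> beta * ((1 + \<tau>) * r) ^ (CARD('m) + 1)"
    unfolding beta_def using \<tau> r by (intro measure_iso_ball_le[OF \<Theta>]) auto
  finally show ?thesis by (simp only: power_mult_distrib mult_ac)
qed

text \<open>A lower bound for areas needs the projected surface to have no holes. With
  \<open>N\<close> the inverse of the linear part, \<open>N (F u1 y)\<close> differs from
  \<open>y - u1\<close> by at most \<open>\<rho> / 2\<close> on a ball of radius \<rho>, and
  \<open>N k\<close> has norm at most \<open>\<rho> / 2\<close>. Brouwer's theorem then solves the
  equation.\<close>

lemma F_surj:
  assumes u1: "u1 \<in> ball u0 (s/2)" and \<rho>: "2 / \<kappa> * norm k \<le> \<rho>" "\<rho> < s / 2" "0 < \<rho>"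
  shows "\<exists>u\<in>W. F u1 u = k"
proof -
  have cb: "cball u1 \<rho> \<subseteq> W"
  proof
    fix y assume "y \<in> cball u1 \<rho>"
    then show "y \<in> W" using u1 \<rho>(2) dist_triangle[of u0 y u1] by simp
  qed
  have "u1 \<in> cball u1 \<rho>" using \<rho>(3) by simp
  then have u1W: "u1 \<in> W" using cb by blast
  let ?M = "\<lambda>h. isoadj \<Theta> (L h)"
  note linM = linear_iso_L and injM = inj_iso_L
  have "surj ?M" using linM injM by (rule linear_injective_imp_surjective) simp
  then obtain N where N: "linear N" "?M \<circ> N = id"
    using linear_surjective_right_inverse[OF linM] by blast
  have MN: "?M (N v) = v" for v using N(2) by (simp add: fun_eq_iff)
  have NM: "N (?M h) = h" for h using MN injM by (metis injD)
  have Nn: "norm (N v) \<le> norm v / \<kappa>" for v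
    using expand[of "N v"] \<kappa> by (simp add: MN field_simps)
  have contF: "continuous_on W (F u1)"
    unfolding F_def
    by (intro linear_continuous_on_compose[OF _ linear_isoadj] linear_continuous_on_compose[OF _ linear_cof] continuous_intros cont)
  have "\<exists>y\<in>cball u1 \<rho>. u1 + N (F u1 y) = u1 + N k"
  proof (rule brouwer_surjective_cball[where S = "{u1 + N k}"])
    show "continuous_on (cball u1 \<rho>) (\<lambda>y. u1 + N (F u1 y))"
      by (intro continuous_intros linear_continuous_on_compose[OF _ N(1)] continuous_on_subset[OF contF] cb)
    fix x y assume x: "x \<in> {u1 + N k}" and y: "y \<in> cball u1 \<rho>"
    have "norm (?M (y - u1) - F u1 y) \<le> \<kappa> / 2 * norm (y - u1)"
    proof -
      have "norm (?M (y - u1) - F u1 y) = norm (isoadj \<Theta> (cof (\<phi> u1) (\<phi> y - \<phi> u1) - L (y - u1)))"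
        by (simp add: F_def linear_diff[OF linear_isoadj] norm_minus_commute)
      also have "\<dots> \<le> \<epsilon> * norm (y - u1)"
        using isoadj_norm[OF \<Theta>] close[OF u1W _ u1W, of y] y cb by (meson order_trans subsetD)
      also have "\<dots> \<le> \<kappa> / 2 * norm (y - u1)" using \<epsilon> by (intro mult_right_mono) auto
      finally show ?thesis .
    qed
    also have "\<dots> \<le> \<kappa> / 2 * \<rho>"
      using y \<kappa> by (intro mult_left_mono) (auto simp: dist_norm norm_minus_commute)
    finally have "norm (?M (y - u1) - F u1 y) / \<kappa> \<le> \<rho> / 2"
      using \<kappa> by (simp add: field_simps)
    moreover have "norm (N (?M (y - u1) - F u1 y)) \<le> norm (?M (y - u1) - F u1 y) / \<kappa>" by (rule Nn)
    moreover have "norm (N k) \<le> \<rho> / 2" using Nn[of k] \<rho>(1) by simp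
    moreover have "x + (y - (u1 + N (F u1 y))) - u1 = N k + N (?M (y - u1) - F u1 y)"
      using x NM[of "y - u1"] by (simp add: linear_diff[OF N(1)])
    ultimately have "norm (x + (y - (u1 + N (F u1 y))) - u1) \<le> \<rho>"
      by (smt (verit) norm_triangle_ineq field_sum_of_halves)
    then show "x + (y - (u1 + N (F u1 y))) \<in> cball u1 \<rho>"
      unfolding mem_cball dist_norm by (subst norm_minus_commute)
  qed (use \<rho> in auto)
  then obtain y where y: "y \<in> cball u1 \<rho>" "N (F u1 y) = N k" by auto
  then have "F u1 y = k" by (metis MN)
  then show ?thesis using y cb by blast
qed

text \<open>The centre \<open>c0\<close>, nearly optimal in the limit subspace at unit scale, is
  dilated and then translated to \<open>\<phi> u1\<close>. The resulting ball need not be centred on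
  the surface, only within \<open>hn c0 * r\<close> of the given point.\<close>

lemma ball_measure_ge:
  assumes nv: "\<And>g h r. \<lbrakk>norm (g - L h) \<le> \<epsilon> * norm h; 0 < r; r \<le> \<epsilon>; norm (isoadj \<Theta> g) \<le> C * r; \<bar>g $ iT\<bar> \<le> C * r\<^sup>2\<rbrakk>
      \<Longrightarrow> hdist (\<Theta> (isoadj \<Theta> g)) g \<le> \<tau> * r"
    and c0: "\<And>r. r > 0 \<Longrightarrow> measure lebesgue {k. hdist (dil r c0) (\<Theta> k) \<le> r} \<ge> (1 - \<tau>) * beta * r ^ (CARD('m) + 1)"
    and C: "C = (1 + hn c0) + (1 + hn c0)\<^sup>2" and r: "0 < r" "r \<le> \<epsilon>" "r \<le> 1" "2 / \<kappa> * (C * r) < s / 2"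
    and u1: "u1 \<in> ball u0 (s/2)"
  shows "\<exists>c. hdist c (\<phi> u1) \<le> hn c0 * r \<and>
    (1 - \<tau>) * (1 - \<tau>) ^ (CARD('m) + 1) * beta * r ^ (CARD('m) + 1) \<le> (1 + \<tau>) * J0 * measure lebesgue (E c r)"
proof -
  interpret distance "hdist :: 'n heis \<Rightarrow> 'n heis \<Rightarrow> real" 1 by (rule hdist_distance) simp
  \<comment> \<open>The smaller radius leaves room for the projection error:
    \<open>r' + \<tau> * r = r\<close>.\<close>
  define r' where "r' = (1 - \<tau>) * r"
  have r': "0 < r'" "r' \<le> r" using \<tau> r by (auto simp: r'_def mult_le_cancel_right1 algebra_simps)
  have u1W: "u1 \<in> W" using u1 s by simp
  let ?c = "heis_mult (\<phi> u1) (dil r' c0)"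
  let ?G = "{k. hdist (dil r' c0) (\<Theta> k) \<le> r'}"
  have C0: "C > 0" using C hn_nonneg[of c0] by (simp add: add_pos_nonneg)
  have sub: "?G \<subseteq> F u1 ` E ?c r"
  proof
    fix k assume k: "k \<in> ?G"
    \<comment> \<open>Points of \<open>?G\<close> have \<open>hn\<close> at most
      \<open>A * r\<close>, hence Euclidean norm at most
      \<open>A * r + A\<^sup>2 * r\<^sup>2\<close>. This is what dictates
      \<open>C = A + A\<^sup>2\<close>.\<close>
    define A where "A = 1 + hn c0"
    have A: "A \<ge> 1" by (simp add: A_def)
    have "hn (\<Theta> k) \<le> hn (dil r' c0) + r'"
      using hn_mult_le[of "dil r' c0" "heis_mult (- dil r' c0) (\<Theta> k)"] k by (simp add: hdist_def)
    also have "\<dots> = A * r'" using hn_dil[OF r'(1)] by (simp add: A_def algebra_simps)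
    also have "\<dots> \<le> A * r" using A r' by (intro mult_left_mono) auto
    finally have h: "hn (\<Theta> k) \<le> A * r" .
    then have "(hn (\<Theta> k))\<^sup>2 \<le> (A * r)\<^sup>2" by (intro power_mono) auto
    then have kT: "\<bar>k $ i0\<bar> \<le> A\<^sup>2 * r\<^sup>2"
      using hn_lower(2)[of "\<Theta> k"] by (simp add: iso_T[OF \<Theta>] power_mult_distrib)
    have "A\<^sup>2 * r\<^sup>2 \<le> A\<^sup>2 * (r * 1)"
      unfolding power2_eq_square[of r] using r by (intro mult_left_mono) auto
    then have kn: "norm k \<le> C * r"
      using norm_le_hor_T[of "\<Theta> k"] hn_lower(1)[of "\<Theta> k"] h kT
      by (simp add: iso_norm[OF \<Theta>] iso_T[OF \<Theta>] C A_def[symmetric] algebra_simps)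
    have "A\<^sup>2 * r\<^sup>2 \<le> C * r\<^sup>2" using A by (intro mult_right_mono) (auto simp: C A_def[symmetric])
    then have kT': "\<bar>k $ i0\<bar> \<le> C * r\<^sup>2" using kT by linarith
    have "\<exists>u\<in>W. F u1 u = k"
    proof (rule F_surj[OF u1])
      show "2 / \<kappa> * norm k \<le> 2 / \<kappa> * (C * r)" using kn \<kappa> by (intro mult_left_mono) auto
    qed (use r C0 \<kappa> in auto)
    then obtain u where u: "u \<in> W" "F u1 u = k" by blast
    let ?g = "heis_mult (- \<phi> u1) (\<phi> u)"
    have g: "?g = cof (\<phi> u1) (\<phi> u - \<phi> u1)" by (rule ldiff_cof)
    have Fk: "isoadj \<Theta> ?g = k" using u by (simp add: F_def g)
    have "hdist (\<Theta> (isoadj \<Theta> ?g)) ?g \<le> \<tau> * r"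
    proof (rule nv)
      show "norm (?g - L (u - u1)) \<le> \<epsilon> * norm (u - u1)" unfolding g by (rule close[OF u1W u(1) u1W])
      show "\<bar>?g $ iT\<bar> \<le> C * r\<^sup>2" using kT' isoadj_T[OF \<Theta>, of ?g] Fk by simp
    qed (use r kn Fk in auto)
    then have "hdist (dil r' c0) ?g \<le> r' + \<tau> * r"
      using rr_tri[of "dil r' c0" ?g "\<Theta> k"] k Fk by simp
    then have "hdist ?c (\<phi> u) \<le> r"
      using hdist_left[of "\<phi> u1" "dil r' c0" ?g] by (simp add: r'_def algebra_simps)
    then show "k \<in> F u1 ` E ?c r" using u by (auto simp: E_def)
  qed
  have "E ?c r \<subseteq> W" by (auto simp: E_def)
  have "(1 - \<tau>) * beta * r' ^ (CARD('m) + 1) \<le> measure lebesgue ?G" by (rule c0[OF r'(1)])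
  also have "\<dots> \<le> measure lebesgue (F u1 ` E ?c r)"
    using F_image(1)[OF u1W \<open>E ?c r \<subseteq> W\<close> lmeasurable_E] lmeasurable_iso_ball[OF \<Theta>] sub
    by (intro measure_mono_fmeasurable) auto
  also have "\<dots> \<le> (1 + \<tau>) * J0 * measure lebesgue (E ?c r)"
    by (rule F_image(3)[OF u1W \<open>E ?c r \<subseteq> W\<close> lmeasurable_E])
  finally have "(1 - \<tau>) * (1 - \<tau>) ^ (CARD('m) + 1) * beta * r ^ (CARD('m) + 1) \<le> (1 + \<tau>) * J0 * measure lebesgue (E ?c r)"
    by (simp only: r'_def power_mult_distrib mult_ac)
  moreover have "hdist ?c (\<phi> u1) \<le> hn c0 * r"
  proof -
    have "hdist ?c (\<phi> u1) = hdist (dil r' c0) 0"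
      using hdist_left[of "\<phi> u1" "dil r' c0" 0] by simp
    also have "\<dots> = r' * hn c0" using hn_dil[OF r'(1), of c0] by (simp add: hdist_def)
    also have "\<dots> \<le> r * hn c0" using r' by (intro mult_right_mono) auto
    finally show ?thesis by (simp add: mult.commute)
  qed
  ultimately show ?thesis by blast
qed

end

section \<open>Covering by balls of nearly optimal density\<close>

lemma lmeasurable_outer_open:
  fixes S :: "'a::euclidean_space set"
  assumes S: "S \<in> lmeasurable" and e: "e > 0"
  obtains T where "open T" "S \<subseteq> T" "T \<in> lmeasurable" "measure lebesgue T < measure lebesgue S + e"
proof -
  have "S \<in> sets lebesgue" using S by auto
  then obtain T where T: "open T" "S \<subseteq> T" "T - S \<in> lmeasurable" "emeasure lebesgue (T - S) < ennreal e"
    using sets_lebesgue_outer_open[OF _ e] by blast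
  have eq: "T = S \<union> (T - S)" using T by blast
  have "T \<in> lmeasurable"
    by (subst eq) (rule fmeasurable.Un[OF S T(3)])
  moreover have "measure lebesgue (T - S) < e"
    using T(3,4) e by (simp add: fmeasurable_def emeasure_eq_ennreal_measure less_top[symmetric] ennreal_less_iff)
  moreover have "measure lebesgue T \<le> measure lebesgue S + measure lebesgue (T - S)"
    by (subst eq) (rule measure_Un_le, use S T in auto)
  ultimately show thesis using that[of T] T by auto
qed

lemma emeasure_lborel_lmeasurable:
  fixes S :: "'a::euclidean_space set"
  assumes "S \<in> lmeasurable" "S \<in> sets borel"
  shows "emeasure lborel S = ennreal (measure lebesgue S)"
proof -
  have "emeasure lborel S = emeasure lebesgue S"
    using assms(2) by simp
  also have "\<dots> = ennreal (measure lebesgue S)"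
    by (rule emeasure_eq_measure2[OF assms(1)])
  finally show ?thesis .
qed

text \<open>What the covering argument uses of the geometry: \<open>upper\<close> holds for all
  balls, \<open>lower\<close> provides one dense ball near each point of \<open>W0\<close>, and
  \<open>near\<close> makes preimages of small balls small. Points of \<open>W0\<close> have room
  inside \<open>W\<close>, which the construction of the dense balls requires.\<close>

locale density_chart = distance "hdist :: 'n::finite heis \<Rightarrow> 'n::finite heis \<Rightarrow> real" d for d :: nat +
  fixes \<phi> :: "real^'m::finite \<Rightarrow> 'n::finite heis" and W W0 :: "(real^'m) set" and a b C \<delta>0 :: real
  assumes W: "open W0" "W0 \<subseteq> W" "bounded W" "W \<in> sets borel" and cont: "continuous_on W \<phi>"
    and pos: "a > 0" "b > 0" "C > 0" "\<delta>0 > 0"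
    and upper: "\<And>c r. \<lbrakk>0 < r; r \<le> \<delta>0\<rbrakk> \<Longrightarrow> measure lebesgue {u \<in> W. hdist c (\<phi> u) \<le> r} \<le> b * r ^ d"
    and lower: "\<And>u1 r. \<lbrakk>u1 \<in> W0; 0 < r; r \<le> \<delta>0\<rbrakk> \<Longrightarrow> \<exists>c. hdist c (\<phi> u1) \<le> C * r \<and>
        a * r ^ d \<le> measure lebesgue {u \<in> W. hdist c (\<phi> u) \<le> r}"
    and near: "\<And>u1 u t. \<lbrakk>u1 \<in> W; u \<in> W; hdist (\<phi> u1) (\<phi> u) \<le> t; t \<le> 1\<rbrakk> \<Longrightarrow> norm (u - u1) \<le> C * t"
begin

definition E where "E c r = {u \<in> W. hdist c (\<phi> u) \<le> r}"

lemma closed_E: "\<exists>T. closed T \<and> E c r = W \<inter> T"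
  unfolding E_def by (rule closedin_hdist_ball[OF cont])

lemma lmeasurable_sub: "\<lbrakk>S \<subseteq> W; S \<in> sets borel\<rbrakk> \<Longrightarrow> S \<in> lmeasurable"
  using bounded_subset[OF W(3)] by (intro bounded_set_imp_lmeasurable) auto

lemma borel_E: "E c r \<in> sets borel"
  using closed_E[of c r] W(4) by (auto intro: sets.Int borel_closed)

lemma lmeasurable_E: "E c r \<in> lmeasurable"
  by (rule lmeasurable_sub[OF _ borel_E]) (auto simp: E_def)

lemma measure_le_hausdorff:
  assumes A: "A \<subseteq> W" "A \<in> sets borel"
  shows "emeasure lborel A \<le> ennreal b * sh (\<phi> ` A)"
proof -
  have "emeasure lborel A \<le> ennreal b * sc \<delta>0 (\<phi> ` A)"
  proof (rule mass_le_sc)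
    fix c :: "'n heis" and r :: real
    assume r: "0 < r" "r \<le> \<delta>0"
    have eq: "A \<inter> \<phi> -` Bl c r = A \<inter> E c r"
      using A(1) by (auto simp: Bl_def E_def)
    show 1: "A \<inter> \<phi> -` Bl c r \<in> sets lborel"
      unfolding eq using A(2) borel_E by auto
    have "emeasure lborel (A \<inter> E c r) \<le> emeasure lborel (E c r)"
      by (rule emeasure_mono) (use borel_E in auto)
    also have "\<dots> = ennreal (measure lebesgue (E c r))"
      by (rule emeasure_lborel_lmeasurable[OF lmeasurable_E borel_E])
    also have "\<dots> \<le> ennreal (b * r ^ d)"
      using upper[OF r] by (intro ennreal_leI) (simp add: E_def)
    finally show "emeasure lborel (A \<inter> \<phi> -` Bl c r) \<le> ennreal (b * r ^ d)"
      unfolding eq .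
  qed (use A pos in auto)
  also have "\<dots> \<le> ennreal b * sh (\<phi> ` A)"
    by (intro mult_left_mono sc_le_sh pos) simp
  finally show ?thesis .
qed

text \<open>A dense ball stays within \<open>(C + 1) * r\<close> of its base point, so if two of
  them meet, the base points are at most \<open>C3 * r\<close> apart.\<close>

definition C3 where "C3 = 2 * (C + 1)"

lemma C3: "C3 > 0" using pos by (simp add: C3_def)

lemma sum_E:
  assumes "finite P" "disjoint_family_on (\<lambda>p. E (c p) r) P"
  shows "(\<Sum>p\<in>P. measure lebesgue (E (c p) r)) = measure lebesgue (\<Union>p\<in>P. E (c p) r)"
proof (rule measure_finite_Union[symmetric])
  show "emeasure lebesgue (E (c p) r) \<noteq> \<infinity>" for p
    using fmeasurableD2[OF lmeasurable_E] by simp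
qed (use assms lmeasurable_E in auto)

text \<open>
  The bounds \<open>upper\<close> and \<open>lower\<close> are uniform on \<open>W0\<close>, so a maximal separated set at a single scale
  replaces Vitali's selection of balls of varying radii.
\<close>

lemma packing:
  assumes K: "compact K" "K \<subseteq> G" and G: "open G" "G \<subseteq> W0" and \<delta>: "\<delta> > 0"
  obtains r P c where "0 < r" "r \<le> \<delta>" "r \<le> \<delta>0" "C3 * r \<le> \<delta>" "C3 * r \<le> \<delta>0" "finite P" "P \<subseteq> K"
    "disjoint_family_on (\<lambda>p. E (c p) r) P" "\<And>p. p \<in> P \<Longrightarrow> E (c p) r \<subseteq> G"
    "\<And>p. p \<in> P \<Longrightarrow> a * r ^ d \<le> measure lebesgue (E (c p) r)"
    "K \<subseteq> (\<Union>p\<in>P. E (\<phi> p) (C3 * r))"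
proof -
  obtain e where e: "e > 0" "(\<Union>x\<in>K. ball x e) \<subseteq> G"
    using compact_subset_open_imp_ball_epsilon_subset[OF K(1) G(1) K(2)] by blast
  \<comment> \<open>The quotients by \<open>C3\<close> make the enlarged balls admissible,
    \<open>1 / (C + 1)\<close> allows \<open>near\<close> to be applied with
    \<open>t = (C + 1) * r\<close>, and the last bound keeps the dense balls inside
    \<open>G\<close>.\<close>
  define r where "r = min (min (min \<delta> \<delta>0) (min (\<delta> / C3) (\<delta>0 / C3))) (min (1 / (C + 1)) (e / (2 * C * (C + 1))))"
  have r: "0 < r" "r \<le> \<delta>" "r \<le> \<delta>0" "r \<le> \<delta> / C3" "r \<le> \<delta>0 / C3" "r \<le> 1 / (C + 1)" "r \<le> e / (2 * C * (C + 1))"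
    using \<delta> pos C3 e by (auto simp: r_def)
  have r': "C3 * r \<le> \<delta>" "C3 * r \<le> \<delta>0" "(C + 1) * r \<le> 1" "C * ((C + 1) * r) < e"
  proof -
    show "C3 * r \<le> \<delta>" "C3 * r \<le> \<delta>0" using r C3 by (simp_all add: field_simps)
    show "(C + 1) * r \<le> 1" using r pos by (simp add: field_simps)
    have "C * ((C + 1) * r) \<le> C * ((C + 1) * (e / (2 * C * (C + 1))))"
      using r pos by (intro mult_left_mono) auto
    also have "\<dots> = e / 2"
      using pos by (simp add: divide_simps)
    finally show "C * ((C + 1) * r) < e" using e by simp
  qed
  have KW: "K \<subseteq> W0" using K G by blast
  have "\<forall>p\<in>K. \<exists>c. hdist c (\<phi> p) \<le> C * r \<and> a * r ^ d \<le> measure lebesgue (E c r)"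
    using lower[OF _ r(1,3)] KW by (auto simp: E_def)
  then obtain c where c: "\<And>p. p \<in> K \<Longrightarrow> hdist (c p) (\<phi> p) \<le> C * r"
    "\<And>p. p \<in> K \<Longrightarrow> a * r ^ d \<le> measure lebesgue (E (c p) r)"
    by metis
  have nr: "hdist (\<phi> p) (\<phi> u) \<le> (C + 1) * r" if "p \<in> K" "u \<in> E (c p) r" for p u
    using rr_tri[of "\<phi> p" "\<phi> u" "c p"] rr_sym[of "\<phi> p" "c p"] c(1)[OF that(1)] that(2)
    by (simp add: E_def algebra_simps)
  have EG: "E (c p) r \<subseteq> G" if p: "p \<in> K" for p
  proof
    fix u assume u: "u \<in> E (c p) r"
    have "norm (u - p) \<le> C * ((C + 1) * r)"
      by (rule near) (use nr[OF p u] r' p KW W u in \<open>auto simp: E_def\<close>)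
    then have "u \<in> ball p e" using r' by (simp add: dist_norm norm_minus_commute)
    then show "u \<in> G" using e p by blast
  qed
  define sep where "sep P \<longleftrightarrow> finite P \<and> P \<subseteq> K \<and> (\<forall>p\<in>P. \<forall>q\<in>P. p \<noteq> q \<longrightarrow> hdist (\<phi> p) (\<phi> q) > C3 * r)" for P
  have disj: "disjoint_family_on (\<lambda>p. E (c p) r) P" if P: "sep P" for P
    unfolding disjoint_family_on_def
  proof (intro ballI impI)
    fix p q assume pq: "p \<in> P" "q \<in> P" "p \<noteq> q"
    show "E (c p) r \<inter> E (c q) r = {}"
    proof (rule ccontr)
      assume "E (c p) r \<inter> E (c q) r \<noteq> {}"
      then obtain u where u: "u \<in> E (c p) r" "u \<in> E (c q) r" by blast
      have "hdist (\<phi> p) (\<phi> q) \<le> (C + 1) * r + (C + 1) * r"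
        using rr_tri[of "\<phi> p" "\<phi> q" "\<phi> u"] rr_sym[of "\<phi> q" "\<phi> u"] nr[OF _ u(1)] nr[OF _ u(2)] pq P
        unfolding sep_def by (metis add_mono order_trans subsetD)
      moreover have "hdist (\<phi> p) (\<phi> q) > C3 * r" using P pq by (auto simp: sep_def)
      ultimately show False by (simp add: C3_def algebra_simps)
    qed
  qed
  have Gm: "G \<in> lmeasurable" by (rule lmeasurable_sub) (use G W in auto)
  \<comment> \<open>Only boundedly many disjoint sets of measure at least \<open>a * r ^ d\<close>
    fit into \<open>G\<close>; hence a separated set of largest cardinality exists.\<close>
  have card: "real (card P) * (a * r ^ d) \<le> measure lebesgue G" if P: "sep P" for P
  proof -
    have fin: "finite P" "P \<subseteq> K" using P by (auto simp: sep_def)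
    have "real (card P) * (a * r ^ d) = (\<Sum>p\<in>P. a * r ^ d)" by simp
    also have "\<dots> \<le> (\<Sum>p\<in>P. measure lebesgue (E (c p) r))"
      using c(2) fin by (intro sum_mono) auto
    also have "\<dots> = measure lebesgue (\<Union>p\<in>P. E (c p) r)"
      by (rule sum_E) (use fin disj[OF P] in auto)
    also have "\<dots> \<le> measure lebesgue G"
      using fin EG Gm lmeasurable_E by (intro measure_mono_fmeasurable) (auto intro!: sets.finite_UN)
    finally show ?thesis .
  qed
  have ard: "a * r ^ d > 0" using pos r by simp
  have bnd: "card P \<le> nat \<lceil>measure lebesgue G / (a * r ^ d)\<rceil>" if "sep P" for P
  proof -
    have "real (card P) \<le> measure lebesgue G / (a * r ^ d)"
      using card[OF that] ard by (simp add: pos_le_divide_eq)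
    then show ?thesis by linarith
  qed
  have "sep {}" by (simp add: sep_def)
  then obtain P where P: "sep P" "\<And>P'. sep P' \<Longrightarrow> card P' \<le> card P"
    using ex_has_greatest_nat[of sep "{}" card] bnd by (metis le_imp_less_Suc)
  have fin: "finite P" "P \<subseteq> K" using P by (auto simp: sep_def)
  have "K \<subseteq> (\<Union>p\<in>P. E (\<phi> p) (C3 * r))"
  proof
    fix u assume u: "u \<in> K"
    then have uW: "u \<in> W" using KW W by blast
    show "u \<in> (\<Union>p\<in>P. E (\<phi> p) (C3 * r))"
    proof (rule ccontr)
      assume "u \<notin> (\<Union>p\<in>P. E (\<phi> p) (C3 * r))"
      then have far: "hdist (\<phi> p) (\<phi> u) > C3 * r" if "p \<in> P" for p
        using that uW by (force simp: E_def)
      have "0 < C3 * r" using C3 r by simp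
      then have "u \<notin> P" using far[of u] rr_refl[of "\<phi> u"] by auto
      moreover have "sep (insert u P)"
        using P(1) u far rr_sym by (auto simp: sep_def)
      ultimately show False using P(2)[of "insert u P"] fin by simp
    qed
  qed
  then show thesis
    using that[of r P c] r r' fin disj[OF P(1)] EG c(2) by blast
qed

text \<open>A crude rate: each enlarged ball costs \<open>(C3 * r) ^ d\<close> and its dense ball
  has measure at least \<open>a * r ^ d\<close>. Any finite value would do, since the rate is later
  applied to a remainder that tends to 0.\<close>

definition C2 where "C2 = C3 ^ d / a"

lemma C2: "C2 > 0" using C3 pos by (simp add: C2_def)

lemma sc_finite_cover:
  assumes "finite P" "0 < r" "r \<le> \<delta>" "A \<subseteq> (\<Union>p\<in>P. Bl (c p) r)"
  shows "sc \<delta> A \<le> ennreal (real (card P) * r ^ d)"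
proof -
  have "sc \<delta> A \<le> sc \<delta> (\<Union>p\<in>P. Bl (c p) r)" by (rule sc_mono) fact
  also have "\<dots> \<le> (\<Sum>p\<in>P. sc \<delta> (Bl (c p) r))"
    using assms by (intro sc_UN_finite) auto
  also have "\<dots> \<le> (\<Sum>p\<in>P. ennreal (r ^ d))"
    using assms by (intro sum_mono sc_ball)
  also have "\<dots> = ennreal (real (card P) * r ^ d)"
    using assms by (simp add: ennreal_of_nat_eq_real_of_nat ennreal_mult)
  finally show ?thesis .
qed

lemma coarse_compact_open:
  assumes K: "compact K" "K \<subseteq> G" and G: "open G" "G \<subseteq> W0" and \<delta>: "\<delta> > 0"
  shows "sc \<delta> (\<phi> ` K) \<le> ennreal (C2 * measure lebesgue G)"
proof -
  obtain r P c where P: "0 < r" "r \<le> \<delta>" "r \<le> \<delta>0" "C3 * r \<le> \<delta>" "C3 * r \<le> \<delta>0" "finite P" "P \<subseteq> K"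
    "disjoint_family_on (\<lambda>p. E (c p) r) P" "\<And>p. p \<in> P \<Longrightarrow> E (c p) r \<subseteq> G"
    "\<And>p. p \<in> P \<Longrightarrow> a * r ^ d \<le> measure lebesgue (E (c p) r)"
    "K \<subseteq> (\<Union>p\<in>P. E (\<phi> p) (C3 * r))"
    by (rule packing[OF K G \<delta>]) (rule that)
  have "sc \<delta> (\<phi> ` K) \<le> ennreal (real (card P) * (C3 * r) ^ d)"
    by (rule sc_finite_cover[where c = \<phi>]) (use P C3 in \<open>auto simp: E_def Bl_def\<close>)
  also have "\<dots> \<le> ennreal (C2 * measure lebesgue G)"
  proof (rule ennreal_leI)
    have "real (card P) * (C3 * r) ^ d = C2 * (\<Sum>p\<in>P. a * r ^ d)"
      using pos by (simp add: C2_def power_mult_distrib)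
    also have "\<dots> \<le> C2 * (\<Sum>p\<in>P. measure lebesgue (E (c p) r))"
      using C2 P by (intro mult_left_mono sum_mono) auto
    also have "\<dots> = C2 * measure lebesgue (\<Union>p\<in>P. E (c p) r)"
      using P by (simp add: sum_E)
    also have "\<dots> \<le> C2 * measure lebesgue G"
    proof (intro mult_left_mono measure_mono_fmeasurable)
      show "G \<in> lmeasurable" by (rule lmeasurable_sub) (use G W in auto)
    qed (use P C2 lmeasurable_E in \<open>auto intro!: sets.finite_UN\<close>)
    finally show "real (card P) * (C3 * r) ^ d \<le> C2 * measure lebesgue G" .
  qed
  finally show ?thesis .
qed

lemma coarse_compact:
  assumes K: "compact K" "K \<subseteq> W0" and \<delta>: "\<delta> > 0"
  shows "sc \<delta> (\<phi> ` K) \<le> ennreal (C2 * measure lebesgue K)"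
proof (rule ennreal_le_epsilon)
  fix e :: real assume e: "e > 0"
  have Km: "K \<in> lmeasurable" using K by (simp add: lmeasurable_compact)
  obtain T where T: "open T" "K \<subseteq> T" "T \<in> lmeasurable" "measure lebesgue T < measure lebesgue K + e / C2"
    using lmeasurable_outer_open[OF Km, of "e / C2"] e C2 by auto
  have "sc \<delta> (\<phi> ` K) \<le> ennreal (C2 * measure lebesgue (T \<inter> W0))"
    by (rule coarse_compact_open) (use K T W \<delta> in auto)
  also have "\<dots> \<le> ennreal (C2 * measure lebesgue K + e)"
  proof (rule ennreal_leI)
    have "measure lebesgue (T \<inter> W0) \<le> measure lebesgue T"
      by (intro measure_mono_fmeasurable) (use T W in auto)
    then have "C2 * measure lebesgue (T \<inter> W0) \<le> C2 * (measure lebesgue K + e / C2)"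
      using T C2 by (intro mult_left_mono) auto
    also have "\<dots> = C2 * measure lebesgue K + e"
      using C2 by (simp add: field_simps)
    finally show "C2 * measure lebesgue (T \<inter> W0) \<le> C2 * measure lebesgue K + e" .
  qed
  also have "\<dots> = ennreal (C2 * measure lebesgue K) + ennreal e"
    using C2 e by (intro ennreal_plus) auto
  finally show "sc \<delta> (\<phi> ` K) \<le> ennreal (C2 * measure lebesgue K) + ennreal e" .
qed

text \<open>The open set is cut into countably many non-overlapping compact boxes. Their boundaries
  are null sets, so the sum of their measures does not exceed that of \<open>G\<close>, and the
  content is countably subadditive.\<close>

lemma coarse_open:
  assumes G: "open G" "G \<subseteq> W0" and \<delta>: "\<delta> > 0"
  shows "sc \<delta> (\<phi> ` G) \<le> ennreal (C2 * measure lebesgue G)"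
proof -
  have "bounded G" using bounded_subset[OF W(3)] G W by blast
  then obtain w where w: "G \<subseteq> box (- w) w" by (metis bounded_subset_box_symmetric)
  have Gm: "G \<in> lmeasurable" by (rule lmeasurable_sub) (use G W in auto)
  \<comment> \<open>Each box of \<open>covering_lemma\<close> lies in \<open>g x\<close> for a tag
    \<open>x\<close> in \<open>G\<close>, so this gauge forces the boxes into
    \<open>G\<close>.\<close>
  define g where "g x = (if x \<in> G then G else UNIV)" for x
  have gauge: "gauge g" using G by (simp add: gauge_def g_def)
  show ?thesis
  proof (cases "box (- w) w = {}")
    case True
    then have "G = {}" using w by simp
    then show ?thesis using \<delta> by simp
  next
    case False
    have "G \<subseteq> cbox (- w) w" using w box_subset_cbox by blast
    from covering_lemma[OF this False gauge] obtain \<D> where D: "countable \<D>"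
      "\<And>K. K \<in> \<D> \<Longrightarrow> interior K \<noteq> {} \<and> (\<exists>c d. K = cbox c d)"
      "pairwise (\<lambda>A B. interior A \<inter> interior B = {}) \<D>"
      "\<And>K. K \<in> \<D> \<Longrightarrow> \<exists>x \<in> G \<inter> K. K \<subseteq> g x" "G \<subseteq> \<Union>\<D>"
      by metis
    define K where "K n = (if n \<in> to_nat_on \<D> ` \<D> then from_nat_into \<D> n else {})" for n
    have Kc: "K n \<in> \<D> \<or> K n = {}" for n
      using from_nat_into_to_nat_on[OF D(1)] by (auto simp: K_def)
    have KG: "K n \<subseteq> G" for n
      using Kc[of n] D(4)[of "K n"] by (auto simp: g_def)
    have Kbox: "\<exists>c d. K n = cbox c d" for n
      using Kc[of n] D(2)[of "K n"] empty_as_interval by metis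
    have cover: "G \<subseteq> (\<Union>n. K n)"
    proof
      fix x assume "x \<in> G"
      then obtain S where S: "S \<in> \<D>" "x \<in> S" using D(5) by blast
      then have "K (to_nat_on \<D> S) = S"
        using from_nat_into_to_nat_on[OF D(1)] by (simp add: K_def)
      then show "x \<in> (\<Union>n. K n)" using S by blast
    qed
    have disj: "disjoint_family (\<lambda>n. interior (K n))"
      unfolding disjoint_family_on_def
    proof (intro ballI impI)
      fix m n :: nat assume "m \<noteq> n"
      show "interior (K m) \<inter> interior (K n) = {}"
      proof (cases "m \<in> to_nat_on \<D> ` \<D> \<and> n \<in> to_nat_on \<D> ` \<D>")
        case True
        then obtain A B where AB: "A \<in> \<D>" "B \<in> \<D>" "m = to_nat_on \<D> A" "n = to_nat_on \<D> B" by blast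
        then have "K m = A" "K n = B" "A \<noteq> B"
          using from_nat_into_to_nat_on[OF D(1)] \<open>m \<noteq> n\<close> by (auto simp: K_def)
        then show ?thesis using D(3) AB by (auto simp: pairwise_def)
      qed (auto simp: K_def)
    qed
    have Kint: "emeasure lborel (K n) = emeasure lborel (interior (K n))" for n
    proof -
      obtain c d where "K n = cbox c d" using Kbox by blast
      then show ?thesis by (simp add: interior_cbox emeasure_lborel_box_eq emeasure_lborel_cbox_eq)
    qed
    have Kcomp: "compact (K n)" for n using Kbox[of n] by auto
    have em: "ennreal (measure lebesgue S) = emeasure lborel S" if "S \<in> lmeasurable" "S \<in> sets borel" for S :: "(real^'m) set"
      using emeasure_lborel_lmeasurable[OF that] by simp
    have "sc \<delta> (\<phi> ` G) \<le> sc \<delta> (\<Union>n. \<phi> ` K n)"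
      by (rule sc_mono) (use cover in blast)
    also have "\<dots> \<le> (\<Sum>n. sc \<delta> (\<phi> ` K n))" by (rule sc_subadd)
    also have "\<dots> \<le> (\<Sum>n. ennreal C2 * emeasure lborel (interior (K n)))"
    proof (intro suminf_le)
      fix n
      have "sc \<delta> (\<phi> ` K n) \<le> ennreal (C2 * measure lebesgue (K n))"
        by (rule coarse_compact) (use Kcomp KG G \<delta> in blast)+
      also have "\<dots> = ennreal C2 * emeasure lborel (K n)"
        using em[OF lmeasurable_compact[OF Kcomp[of n]]] Kcomp[of n] C2
        by (simp add: ennreal_mult' borel_compact)
      finally show "sc \<delta> (\<phi> ` K n) \<le> ennreal C2 * emeasure lborel (interior (K n))"
        by (simp add: Kint)
    qed auto
    also have "\<dots> = ennreal C2 * (\<Sum>n. emeasure lborel (interior (K n)))" by simp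
    also have "(\<Sum>n. emeasure lborel (interior (K n))) = emeasure lborel (\<Union>n. interior (K n))"
      by (rule suminf_emeasure[OF _ disj]) auto
    also have "\<dots> \<le> emeasure lborel G"
      by (rule emeasure_mono) (use KG interior_subset G in \<open>blast, auto\<close>)
    also have "ennreal C2 * emeasure lborel G = ennreal (C2 * measure lebesgue G)"
      using em[OF Gm] G C2 by (simp add: ennreal_mult')
    finally show ?thesis by (simp add: mult_left_mono)
  qed
qed

text \<open>The fraction of an open set that one packing is certain to use up: a compact subset
  catches half of the measure, and the enlarged balls that cover it have in total at most
  \<open>b * C3 ^ d / a\<close> times the measure of the packed ones.\<close>

definition \<kappa>2 where "\<kappa>2 = a / (2 * b * C3 ^ d)"

lemma a_le_b: "W0 \<noteq> {} \<Longrightarrow> a \<le> b"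
proof -
  assume "W0 \<noteq> {}"
  then obtain u1 where "u1 \<in> W0" by blast
  from lower[OF this pos(4) order_refl] upper[OF pos(4) order_refl] have "a * \<delta>0 ^ d \<le> b * \<delta>0 ^ d"
    by (meson order_trans)
  then show ?thesis using pos by simp
qed

text \<open>One round of exhaustion. The packed sets cost \<open>1 / a\<close> per unit of measure,
  the rate aimed at. They are closed in \<open>W\<close>, so the uncovered rest is open again and
  the step can be repeated.\<close>

lemma open_step:
  assumes G: "open G" "G \<subseteq> W0" and \<delta>: "\<delta> > 0"
  shows "\<exists>G' m. open G' \<and> G' \<subseteq> G \<and> m \<ge> 0 \<and> measure lebesgue G' + m = measure lebesgue G \<and>
    m \<ge> \<kappa>2 * measure lebesgue G \<and> sc \<delta> (\<phi> ` G) \<le> ennreal (m / a) + sc \<delta> (\<phi> ` G')"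
proof (cases "measure lebesgue G = 0")
  case True
  then show ?thesis by (intro exI[of _ G] exI[of _ 0]) (use G in auto)
next
  case False
  have Gm: "G \<in> lmeasurable" by (rule lmeasurable_sub) (use G W in auto)
  have Gpos: "measure lebesgue G > 0" using False measure_nonneg[of lebesgue G] by linarith
  obtain K where K: "compact K" "K \<subseteq> G" "measure lebesgue G - measure lebesgue G / 2 < measure lebesgue K"
  proof -
    have "G \<in> sets lebesgue" using Gm by auto
    then obtain T where T: "closed T" "T \<subseteq> G" "G - T \<in> lmeasurable" "emeasure lebesgue (G - T) < ennreal (measure lebesgue G / 2)"
      using sets_lebesgue_inner_closed[of G "measure lebesgue G / 2"] Gpos by auto
    have "bounded T" using bounded_subset[OF W(3)] T G W by blast
    then have cT: "compact T" using T by (simp add: compact_eq_bounded_closed)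
    have "measure lebesgue (G - T) = measure lebesgue G - measure lebesgue T"
      using T Gm cT by (intro measurable_measure_Diff) (auto simp: lmeasurable_compact)
    moreover have "measure lebesgue (G - T) < measure lebesgue G / 2"
      using T Gpos by (simp add: fmeasurable_def emeasure_eq_ennreal_measure less_top[symmetric] ennreal_less_iff)
    ultimately show thesis by (intro that[of T] cT T) simp
  qed
  obtain r P c where P: "0 < r" "r \<le> \<delta>" "r \<le> \<delta>0" "C3 * r \<le> \<delta>" "C3 * r \<le> \<delta>0" "finite P" "P \<subseteq> K"
    "disjoint_family_on (\<lambda>p. E (c p) r) P" "\<And>p. p \<in> P \<Longrightarrow> E (c p) r \<subseteq> G"
    "\<And>p. p \<in> P \<Longrightarrow> a * r ^ d \<le> measure lebesgue (E (c p) r)"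
    "K \<subseteq> (\<Union>p\<in>P. E (\<phi> p) (C3 * r))"
    by (rule packing[OF K(1,2) G \<delta>]) (rule that)
  let ?U = "\<Union>p\<in>P. E (c p) r"
  define m where "m = measure lebesgue ?U"
  define G' where "G' = G - ?U"
  have Um: "?U \<in> lmeasurable" by (rule fmeasurable.finite_UN) (use P lmeasurable_E in auto)
  have UG: "?U \<subseteq> G" using P(9) by blast
  have cm: "real (card P) * (a * r ^ d) \<le> m"
  proof -
    have "real (card P) * (a * r ^ d) = (\<Sum>p\<in>P. a * r ^ d)" by simp
    also have "\<dots> \<le> (\<Sum>p\<in>P. measure lebesgue (E (c p) r))" by (intro sum_mono P(10))
    also have "\<dots> = m" unfolding m_def by (rule sum_E[OF P(6,8)])
    finally show ?thesis .
  qed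
  have "open G'"
  proof -
    obtain T where T: "\<And>p. closed (T p) \<and> E (c p) r = W \<inter> T p"
      using closed_E[of "c _" r] by metis
    have "G' = G - (\<Union>p\<in>P. T p)" using T G W by (auto simp: G'_def)
    moreover have "closed (\<Union>p\<in>P. T p)" using T P(6) by (intro closed_UN) auto
    ultimately show ?thesis using G by auto
  qed
  moreover have "measure lebesgue G' + m = measure lebesgue G"
    unfolding G'_def m_def using measurable_measure_Diff[OF Gm _ UG] Um by auto
  moreover have "m \<ge> \<kappa>2 * measure lebesgue G"
  proof -
    have "measure lebesgue K \<le> measure lebesgue (\<Union>p\<in>P. E (\<phi> p) (C3 * r))"
      by (rule measure_mono_fmeasurable[OF P(11)]) (use K P lmeasurable_E in \<open>auto intro!: fmeasurable.finite_UN borel_compact\<close>)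
    also have "\<dots> \<le> (\<Sum>p\<in>P. measure lebesgue (E (\<phi> p) (C3 * r)))"
      by (rule measure_UNION_le) (use P lmeasurable_E in auto)
    also have "\<dots> \<le> (\<Sum>p\<in>P. b * (C3 * r) ^ d)"
      by (intro sum_mono) (use upper P C3 in \<open>auto simp: E_def\<close>)
    also have "\<dots> = b * C3 ^ d / a * (real (card P) * (a * r ^ d))"
      using pos by (simp add: power_mult_distrib)
    also have "\<dots> \<le> b * C3 ^ d / a * m"
      using cm pos C3 by (intro mult_left_mono) auto
    finally have "measure lebesgue G / 2 \<le> b * C3 ^ d / a * m" using K(3) by linarith
    then have "\<kappa>2 * measure lebesgue G \<le> (a / (b * C3 ^ d)) * (b * C3 ^ d / a * m)"
      using pos C3 by (simp add: \<kappa>2_def field_simps)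
    also have "\<dots> = m" using pos C3 by simp
    finally show ?thesis .
  qed
  moreover have "sc \<delta> (\<phi> ` G) \<le> ennreal (m / a) + sc \<delta> (\<phi> ` G')"
  proof -
    have "sc \<delta> (\<phi> ` G) \<le> sc \<delta> (\<phi> ` ?U \<union> \<phi> ` G')"
      by (rule sc_mono) (auto simp: G'_def)
    also have "\<dots> \<le> sc \<delta> (\<phi> ` ?U) + sc \<delta> (\<phi> ` G')" by (rule sc_Un[OF \<delta>])
    also have "sc \<delta> (\<phi> ` ?U) \<le> ennreal (real (card P) * r ^ d)"
      by (rule sc_finite_cover[where c = c]) (use P in \<open>auto simp: E_def Bl_def\<close>)
    also have "\<dots> \<le> ennreal (m / a)"
      using cm pos by (intro ennreal_leI) (simp add: field_simps)
    finally show ?thesis by (simp add: add_right_mono)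
  qed
  ultimately show ?thesis
    by (intro exI[of _ G'] exI[of _ m]) (auto simp: G'_def m_def)
qed

lemma \<kappa>2: "0 < \<kappa>2" "W0 \<noteq> {} \<Longrightarrow> \<kappa>2 < 1"
proof -
  show "0 < \<kappa>2" using pos C3 by (simp add: \<kappa>2_def)
  assume "W0 \<noteq> {}"
  then have ab: "a \<le> b" by (rule a_le_b)
  have "1 \<le> C3 ^ d" using pos by (intro one_le_power) (simp add: C3_def)
  then have "b * 1 \<le> b * C3 ^ d" using pos by (intro mult_left_mono) auto
  then have "a < 2 * b * C3 ^ d" using ab pos by linarith
  then show "\<kappa>2 < 1" using pos C3 by (simp add: \<kappa>2_def)
qed

text \<open>After \<open>k\<close> rounds the rest has at most the fraction
  \<open>(1 - \<kappa>2) ^ k\<close> of the measure and is covered at the crude rate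
  \<open>C2\<close>, while everything packed so far was covered at the rate
  \<open>1 / a\<close>.\<close>

lemma open_iterate:
  assumes "open G" "G \<subseteq> W0" and \<delta>: "\<delta> > 0" and ne: "W0 \<noteq> {}"
  shows "sc \<delta> (\<phi> ` G) \<le> ennreal (measure lebesgue G / a + C2 * (1 - \<kappa>2) ^ k * measure lebesgue G)"
  using assms(1,2)
proof (induction k arbitrary: G)
  case 0
  have "sc \<delta> (\<phi> ` G) \<le> ennreal (C2 * measure lebesgue G)" by (rule coarse_open[OF 0 \<delta>])
  also have "\<dots> \<le> ennreal (measure lebesgue G / a + C2 * (1 - \<kappa>2) ^ 0 * measure lebesgue G)"
    using pos by (intro ennreal_leI) simp
  finally show ?case .
next
  case (Suc k)
  obtain G' m where G': "open G'" "G' \<subseteq> G" "m \<ge> 0" "measure lebesgue G' + m = measure lebesgue G"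
    "m \<ge> \<kappa>2 * measure lebesgue G" "sc \<delta> (\<phi> ` G) \<le> ennreal (m / a) + sc \<delta> (\<phi> ` G')"
    using open_step[OF Suc.prems \<delta>] by blast
  have IH: "sc \<delta> (\<phi> ` G') \<le> ennreal (measure lebesgue G' / a + C2 * (1 - \<kappa>2) ^ k * measure lebesgue G')"
    by (rule Suc.IH) (use G' Suc.prems in auto)
  have nn: "0 \<le> C2 * (1 - \<kappa>2) ^ k" using C2 \<kappa>2(2)[OF ne] by simp
  have "sc \<delta> (\<phi> ` G) \<le> ennreal (m / a) + ennreal (measure lebesgue G' / a + C2 * (1 - \<kappa>2) ^ k * measure lebesgue G')"
    using G'(6) IH by (meson add_left_mono order_trans)
  also have "\<dots> = ennreal (m / a + (measure lebesgue G' / a + C2 * (1 - \<kappa>2) ^ k * measure lebesgue G'))"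
    using pos G'(3) nn by (intro ennreal_plus[symmetric]) auto
  also have "\<dots> \<le> ennreal (measure lebesgue G / a + C2 * (1 - \<kappa>2) ^ Suc k * measure lebesgue G)"
  proof (rule ennreal_leI)
    have "measure lebesgue G' \<le> (1 - \<kappa>2) * measure lebesgue G" using G' by (simp add: algebra_simps)
    then have "C2 * (1 - \<kappa>2) ^ k * measure lebesgue G' \<le> C2 * (1 - \<kappa>2) ^ k * ((1 - \<kappa>2) * measure lebesgue G)"
      using nn by (rule mult_left_mono)
    moreover have "m / a + measure lebesgue G' / a = measure lebesgue G / a"
      using G'(4) by (simp add: add_divide_distrib[symmetric] add.commute)
    ultimately show "m / a + (measure lebesgue G' / a + C2 * (1 - \<kappa>2) ^ k * measure lebesgue G')
        \<le> measure lebesgue G / a + C2 * (1 - \<kappa>2) ^ Suc k * measure lebesgue G"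
      by (simp add: mult_ac)
  qed
  finally show ?case .
qed

lemma open_upper:
  assumes "open G" "G \<subseteq> W0" and \<delta>: "\<delta> > 0"
  shows "sc \<delta> (\<phi> ` G) \<le> ennreal (measure lebesgue G / a)"
proof (cases "W0 = {}")
  case True
  then show ?thesis using assms by simp
next
  case False
  have lim: "(\<lambda>k. (1 - \<kappa>2) ^ k) \<longlonglongrightarrow> 0"
    using \<kappa>2(1) \<kappa>2(2)[OF False] by (intro LIMSEQ_realpow_zero) auto
  have "(\<lambda>k. measure lebesgue G / a + C2 * (1 - \<kappa>2) ^ k * measure lebesgue G) \<longlonglongrightarrow> measure lebesgue G / a + C2 * 0 * measure lebesgue G"
    by (intro tendsto_add tendsto_mult tendsto_const lim)
  then have "(\<lambda>k. ennreal (measure lebesgue G / a + C2 * (1 - \<kappa>2) ^ k * measure lebesgue G)) \<longlonglongrightarrow> ennreal (measure lebesgue G / a)"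
    by (intro tendsto_ennrealI) simp
  then show ?thesis
    by (rule LIMSEQ_le_const) (use open_iterate[OF assms False] in blast)
qed

lemma hausdorff_le_measure:
  assumes A: "A \<subseteq> W0" "A \<in> sets borel"
  shows "sh (\<phi> ` A) \<le> ennreal (1 / a) * emeasure lborel A"
proof -
  have Am: "A \<in> lmeasurable" by (rule lmeasurable_sub) (use A W in auto)
  have em: "ennreal (measure lebesgue A) = emeasure lborel A"
    using emeasure_lborel_lmeasurable[OF Am A(2)] by simp
  have "sh (\<phi> ` A) \<le> ennreal (measure lebesgue A / a)"
  proof (rule sh_leI, rule ennreal_le_epsilon)
    fix \<delta> e :: real assume \<delta>: "\<delta> > 0" and e: "e > 0"
    obtain T where T: "open T" "A \<subseteq> T" "T \<in> lmeasurable" "measure lebesgue T < measure lebesgue A + e * a"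
      using lmeasurable_outer_open[OF Am, of "e * a"] e pos by auto
    have "sc \<delta> (\<phi> ` A) \<le> sc \<delta> (\<phi> ` (T \<inter> W0))"
      by (rule sc_mono) (use T A in auto)
    also have "\<dots> \<le> ennreal (measure lebesgue (T \<inter> W0) / a)"
      by (rule open_upper) (use T W \<delta> in auto)
    also have "\<dots> \<le> ennreal (measure lebesgue A / a + e)"
    proof (rule ennreal_leI)
      have "measure lebesgue (T \<inter> W0) \<le> measure lebesgue T"
        by (intro measure_mono_fmeasurable) (use T W in auto)
      then show "measure lebesgue (T \<inter> W0) / a \<le> measure lebesgue A / a + e"
        using T pos by (simp add: field_simps)
    qed
    also have "\<dots> = ennreal (measure lebesgue A / a) + ennreal e"
      using pos e by (intro ennreal_plus) auto
    finally show "sc \<delta> (\<phi> ` A) \<le> ennreal (measure lebesgue A / a) + ennreal e" .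
  qed
  also have "\<dots> = ennreal (1 / a) * emeasure lborel A"
    using pos by (simp add: em[symmetric] ennreal_mult'[symmetric])
  finally show ?thesis .
qed

end

section \<open>The Cauchy--Binet formula and multivectors\<close>

lemma prod_sum_UNIV:
  fixes f :: "'m::finite \<Rightarrow> 'k::finite \<Rightarrow> real"
  shows "(\<Prod>i\<in>UNIV. \<Sum>k\<in>UNIV. f i k) = (\<Sum>g\<in>UNIV. \<Prod>i\<in>UNIV. f i (g i))"
proof -
  have "(\<Prod>i\<in>UNIV. \<Sum>k\<in>UNIV. f i k) = (\<Sum>g\<in>PiE UNIV (\<lambda>_. UNIV). \<Prod>i\<in>UNIV. f i (g i))"
    by (rule prod_sum_PiE) auto
  then show ?thesis by (simp add: PiE_UNIV_domain)
qed

text \<open>The determinant is expanded over all maps \<open>f\<close> from row to column indices.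
  Those that are not injective give two equal rows; the injective ones factor uniquely as
  \<open>e K \<circ> q\<close> with \<open>K\<close> their range and \<open>q\<close> a
  permutation.\<close>

lemma Cauchy_Binet:
  fixes A :: "real^'k::finite^'m::finite" and e :: "'k set \<Rightarrow> 'm \<Rightarrow> 'k"
  assumes e: "\<And>K. card K = CARD('m) \<Longrightarrow> bij_betw (e K) UNIV K"
  shows "det (A ** transpose A) = (\<Sum>K | card K = CARD('m). (det (\<chi> i j. A $ i $ e K j :: real^'m^'m))\<^sup>2)"
proof -
  define C where "C f = (\<chi> i j. A $ j $ f i :: real^'m^'m)" for f :: "'m \<Rightarrow> 'k"
  have "det (A ** transpose A) = (\<Sum>p | p permutes (UNIV :: 'm set). of_int (sign p) * (\<Prod>i\<in>UNIV. \<Sum>k\<in>UNIV. A $ i $ k * A $ p i $ k))"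
    by (simp add: det_def matrix_matrix_mult_def transpose_def)
  also have "\<dots> = (\<Sum>p | p permutes (UNIV :: 'm set). \<Sum>f\<in>UNIV. of_int (sign p) * (\<Prod>i\<in>UNIV. A $ i $ f i * A $ p i $ f i))"
    by (simp only: prod_sum_UNIV sum_distrib_left)
  also have "\<dots> = (\<Sum>f\<in>UNIV. \<Sum>p | p permutes (UNIV :: 'm set). (\<Prod>i\<in>UNIV. A $ i $ f i) * (of_int (sign p) * (\<Prod>i\<in>UNIV. A $ p i $ f i)))"
    by (subst sum.swap) (simp add: prod.distrib mult_ac)
  also have "\<dots> = (\<Sum>f\<in>UNIV. (\<Prod>i\<in>UNIV. A $ i $ f i) * det (C f))"
    by (simp add: det_def C_def sum_distrib_left)
  also have "\<dots> = (\<Sum>f | inj f. (\<Prod>i\<in>UNIV. A $ i $ f i) * det (C f))"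
  proof (rule sum.mono_neutral_right)
    show "\<forall>f\<in>UNIV - {f. inj f}. (\<Prod>i\<in>UNIV. A $ i $ f i) * det (C f) = 0"
    proof
      fix f :: "'m \<Rightarrow> 'k" assume "f \<in> UNIV - {f. inj f}"
      then obtain i j where "i \<noteq> j" "f i = f j" by (auto simp: inj_def)
      then have "det (C f) = 0"
        by (intro det_identical_rows[of i j]) (auto simp: C_def row_def)
      then show "(\<Prod>i\<in>UNIV. A $ i $ f i) * det (C f) = 0" by simp
    qed
  qed auto
  also have "\<dots> = (\<Sum>(K, q)\<in>{K. card K = CARD('m)} \<times> {q. q permutes (UNIV :: 'm set)}. (\<Prod>i\<in>UNIV. A $ i $ e K (q i)) * det (C (e K \<circ> q)))"
  proof (rule sum.reindex_bij_witness[where j = "\<lambda>f. (range f, inv_into UNIV (e (range f)) \<circ> f)" and i = "\<lambda>(K, q). e K \<circ> q"])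
    fix f :: "'m \<Rightarrow> 'k" assume "f \<in> {f. inj f}"
    then have f: "inj f" by simp
    then have cK: "card (range f) = CARD('m)" by (simp add: card_image)
    note b = e[OF cK]
    have r: "e (range f) (inv_into UNIV (e (range f)) (f i)) = f i" for i
      using b by (intro f_inv_into_f) (auto simp: bij_betw_def)
    then show "(case (range f, inv_into UNIV (e (range f)) \<circ> f) of (K, q) \<Rightarrow> e K \<circ> q) = f"
      by (simp add: fun_eq_iff)
    have I: "inj (inv_into UNIV (e (range f)) \<circ> f)"
      by (rule injI) (metis comp_apply f injD r)
    have "bij (inv_into UNIV (e (range f)) \<circ> f)"
      by (rule bijI[OF I finite_UNIV_inj_surj[OF finite I]])
    then show "(range f, inv_into UNIV (e (range f)) \<circ> f) \<in> {K. card K = CARD('m)} \<times> {q. q permutes UNIV}"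
      using cK by (auto intro: bij_imp_permutes)
    show "(case (range f, inv_into UNIV (e (range f)) \<circ> f) of (K, q) \<Rightarrow> (\<Prod>i\<in>UNIV. A $ i $ e K (q i)) * det (C (e K \<circ> q)))
        = (\<Prod>i\<in>UNIV. A $ i $ f i) * det (C f)"
      using r by (simp add: comp_def)
  next
    fix p assume "p \<in> {K :: 'k set. card K = CARD('m)} \<times> {q. q permutes (UNIV :: 'm set)}"
    then obtain K q where p: "p = (K, q)" "card K = CARD('m)" "q permutes (UNIV :: 'm set)" by auto
    note b = e[OF p(2)]
    have bq: "bij q" using p(3) by (rule permutes_bij)
    have rng: "range (e K \<circ> q) = K"
      using b bq by (metis bij_betw_def image_comp bij_is_surj)
    have "inj (e K \<circ> q)" using b bq by (metis bij_betw_def bij_is_inj inj_compose)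
    then show "(case p of (K, q) \<Rightarrow> e K \<circ> q) \<in> {f. inj f}" by (simp add: p)
    have "inv_into UNIV (e K) (e K i) = i" for i
      using b by (intro inv_into_f_f) (auto simp: bij_betw_def)
    then show "(range (case p of (K, q) \<Rightarrow> e K \<circ> q), inv_into UNIV (e (range (case p of (K, q) \<Rightarrow> e K \<circ> q))) \<circ> (case p of (K, q) \<Rightarrow> e K \<circ> q)) = p"
      using rng by (simp add: p fun_eq_iff comp_def)
  qed
  also have "\<dots> = (\<Sum>K | card K = CARD('m). \<Sum>q | q permutes (UNIV :: 'm set). (\<Prod>i\<in>UNIV. A $ i $ e K (q i)) * det (C (e K \<circ> q)))"
    by (rule sum.cartesian_product[symmetric])
  also have "\<dots> = (\<Sum>K | card K = CARD('m). (det (\<chi> i j. A $ i $ e K j :: real^'m^'m))\<^sup>2)"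
  proof (rule sum.cong[OF refl])
    fix K :: "'k set"
    let ?AK = "\<chi> i j. A $ i $ e K j :: real^'m^'m"
    have "C (e K) = transpose ?AK" by (simp add: C_def transpose_def)
    then have dC: "det (C (e K)) = det ?AK" by (simp add: det_transpose)
    have perm: "det (C (e K \<circ> q)) = of_int (sign q) * det (C (e K))" if "q permutes UNIV" for q
      using det_permute_rows[OF that, of "C (e K)"] by (simp add: C_def)
    have "(\<Sum>q | q permutes UNIV. (\<Prod>i\<in>UNIV. A $ i $ e K (q i)) * det (C (e K \<circ> q))) =
        (\<Sum>q | q permutes UNIV. (of_int (sign q) * (\<Prod>i\<in>UNIV. A $ i $ e K (q i))) * det ?AK)"
      by (rule sum.cong) (simp_all add: perm dC mult_ac)
    also have "\<dots> = det ?AK * det ?AK"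
      by (simp add: det_def sum_distrib_right)
    finally show "(\<Sum>q | q permutes UNIV. (\<Prod>i\<in>UNIV. A $ i $ e K (q i)) * det (C (e K \<circ> q))) = (det ?AK)\<^sup>2"
      by (simp add: power2_eq_square)
  qed
  finally show ?thesis .
qed

lemma enum_idx_bij:
  fixes K :: "'n::finite idx set"
  assumes "card K = CARD('m::finite)"
  shows "bij_betw (enum_idx K :: 'm \<Rightarrow> 'n idx) UNIV K"
proof -
  have "\<exists>f :: 'm \<Rightarrow> 'n idx. bij_betw f UNIV K"
    using assms by (intro finite_same_card_bij) auto
  then show ?thesis
    unfolding enum_idx_def by (rule someI_ex)
qed

definition minor :: "('m::finite \<Rightarrow> 'n::finite heis) \<Rightarrow> 'n idx set \<Rightarrow> real^'m^'m" where
  "minor l K = (\<chi> i j. l i $ enum_idx K j)"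

lemma wedge_minor: "wedge x v K = (if card K = CARD('m) then det (minor (\<lambda>i. cof x (v i)) K) else 0)"
  for v :: "'m::finite \<Rightarrow> 'n::finite heis"
  by (simp add: wedge_def minor_def cof_nth)

lemma sum_minors:
  fixes l :: "'m::finite \<Rightarrow> 'n::finite heis"
  shows "(\<Sum>K | card K = CARD('m). (det (minor l K))\<^sup>2) = det (\<chi> i j. inner (l i) (l j))"
proof -
  define A where "A = (\<chi> i k. l i $ k)"
  have "A ** transpose A = (\<chi> i j. inner (l i) (l j))"
    by (simp add: A_def matrix_matrix_mult_def transpose_def inner_vec_def)
  then show ?thesis
    using Cauchy_Binet[of enum_idx A, OF enum_idx_bij] by (simp add: A_def minor_def)
qed

lemma mvec_norm_wedge:
  fixes v :: "'m::finite \<Rightarrow> 'n::finite heis"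
  shows "mvec_norm (wedge x v) = sqrt (det (\<chi> i j. hmetric x (v i) (v j)))"
proof -
  have "(\<Sum>K\<in>UNIV. (wedge x v K)\<^sup>2) = (\<Sum>K | card K = CARD('m). (wedge x v K)\<^sup>2)"
    by (rule sum.mono_neutral_right) (auto simp: wedge_minor)
  also have "\<dots> = (\<Sum>K | card K = CARD('m). (det (minor (\<lambda>i. cof x (v i)) K))\<^sup>2)"
    by (rule sum.cong) (auto simp: wedge_minor)
  finally show ?thesis
    by (simp add: mvec_norm_def sum_minors hmetric_cof)
qed

lemma wedge_linear_comb:
  fixes v :: "'m::finite \<Rightarrow> 'n::finite heis" and w :: "real^'m^'m"
  shows "wedge x (\<lambda>i. \<Sum>j\<in>UNIV. (w $ i $ j) *\<^sub>R v j) = (\<lambda>K. det w * wedge x v K)"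
proof
  fix K
  have "cof x (\<Sum>j\<in>UNIV. (w $ i $ j) *\<^sub>R v j) = (\<Sum>j\<in>UNIV. (w $ i $ j) *\<^sub>R cof x (v j))" for i
    by (simp add: linear_sum[OF linear_cof] linear_scale[OF linear_cof])
  then have "minor (\<lambda>i. cof x (\<Sum>j\<in>UNIV. (w $ i $ j) *\<^sub>R v j)) K = w ** minor (\<lambda>i. cof x (v i)) K"
    by (simp add: minor_def matrix_matrix_mult_def vec_eq_iff)
  then show "wedge x (\<lambda>i. \<Sum>j\<in>UNIV. (w $ i $ j) *\<^sub>R v j) K = det w * wedge x v K"
    by (simp add: wedge_minor det_mul)
qed

lemma sum_idx_degree: "(\<Sum>k\<in>K. idx_degree k) = card K + (if iT \<in> K then 1 else 0)" for K :: "'n::finite idx set"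
proof -
  have "idx_degree k = 1 + (if k = iT then 1 else 0)" for k :: "'n idx"
    by (cases k rule: idx_cases) auto
  then have "(\<Sum>k\<in>K. idx_degree k) = (\<Sum>k\<in>K. 1) + (\<Sum>k\<in>K. if k = iT then 1 else 0)"
    by (simp only: sum.distrib)
  then show ?thesis
    by (simp add: sum.delta)
qed

text \<open>Among \<open>m\<close>-fold wedge products only those with the factor \<open>iT\<close>
  have degree \<open>m + 1\<close>, the others have degree \<open>m\<close>. For coordinate vectors
  of a chart this number is the density of \<mu> with respect to Lebesgue measure.\<close>

definition vertical_part :: "('m::finite \<Rightarrow> 'n::finite heis) \<Rightarrow> 'n heis \<Rightarrow> real" where
  "vertical_part v x = mvec_norm (degree_part (CARD('m) + 1) (wedge x v))"

lemma vertical_part_minors: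
  fixes v :: "'m::finite \<Rightarrow> 'n::finite heis"
  shows "vertical_part v x = sqrt (\<Sum>K | card K = CARD('m) \<and> iT \<in> K. (det (minor (\<lambda>i. cof x (v i)) K))\<^sup>2)"
proof -
  have "(\<Sum>K\<in>UNIV. (degree_part (CARD('m) + 1) (wedge x v) K)\<^sup>2) =
      (\<Sum>K | card K = CARD('m) \<and> iT \<in> K. (degree_part (CARD('m) + 1) (wedge x v) K)\<^sup>2)"
    by (rule sum.mono_neutral_right) (auto simp: degree_part_def sum_idx_degree wedge_minor)
  also have "\<dots> = (\<Sum>K | card K = CARD('m) \<and> iT \<in> K. (det (minor (\<lambda>i. cof x (v i)) K))\<^sup>2)"
    by (rule sum.cong) (auto simp: degree_part_def sum_idx_degree wedge_minor)
  finally show ?thesis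
    by (simp add: vertical_part_def mvec_norm_def)
qed

text \<open>Identifies the density of \<mu> with the Jacobian of the projection to the blow-up
  limit. In a minor with the column \<open>iT\<close>, the terms along \<open>q\<close> only add
  multiples of this column to others, a shear, so it equals \<open>det ?M\<close> times the same
  minor of \<Theta>. Minors of \<Theta> without that column vanish because \<open>eT\<close> is one
  of its vectors, so by orthonormality the squares of the others add up to 1.\<close>

lemma vertical_part_det:
  fixes L :: "real^'m::finite \<Rightarrow> 'n::finite heis"
  assumes \<Theta>: "vert_iso i0 \<Theta>" and lin: "linear L" and nh: "L h0 $ iT \<noteq> 0"
    and q: "\<And>h. L h = \<Theta> (isoadj \<Theta> (L h)) + (L h $ iT) *\<^sub>R q"
    and v: "\<And>i. cof x (v i) = L (axis i 1)"
  shows "vertical_part v x = \<bar>det (matrix (\<lambda>h. isoadj \<Theta> (L h)))\<bar>"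
proof -
  let ?M = "matrix (\<lambda>h. isoadj \<Theta> (L h))"
  let ?t = "\<lambda>l. \<Theta> (axis l 1)"
  have qT: "q $ iT = 0"
  proof -
    have "L h0 $ iT = L h0 $ iT + (L h0 $ iT) * q $ iT"
      using arg_cong[OF q[of h0], of "\<lambda>y. y $ iT"] by (simp add: iso_T[OF \<Theta>] isoadj_T[OF \<Theta>])
    then show ?thesis using nh by simp
  qed
  have L: "L (axis i 1) = (\<Sum>l\<in>UNIV. (?M $ l $ i) *\<^sub>R ?t l) + (L (axis i 1) $ iT) *\<^sub>R q" for i
  proof -
    have "\<Theta> (isoadj \<Theta> (L (axis i 1))) = \<Theta> (\<Sum>l\<in>UNIV. (?M $ l $ i) *\<^sub>R axis l 1)"
      by (simp add: matrix_def vec_expansion)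
    also have "\<dots> = (\<Sum>l\<in>UNIV. (?M $ l $ i) *\<^sub>R ?t l)"
      by (simp add: linear_sum[OF iso_lin[OF \<Theta>]] linear_scale[OF iso_lin[OF \<Theta>]])
    finally show ?thesis using q[of "axis i 1"] by simp
  qed
  have main: "det (minor (\<lambda>i. cof x (v i)) K) = det ?M * det (minor ?t K)"
    if K: "card K = CARD('m)" "iT \<in> K" for K
  proof -
    obtain j0 :: 'm where j0: "enum_idx K j0 = iT"
      using enum_idx_bij[OF K(1)] K(2) by (metis bij_betw_iff_bijections)
    define w :: "real^'m" where "w = (\<chi> j. q $ enum_idx K j)"
    have w: "w $ j0 = 0" by (simp add: w_def j0 qT)
    let ?S = "matrix (\<lambda>h. h + inner w h *\<^sub>R axis j0 1)"
    let ?B = "transpose ?M ** minor ?t K"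
    have B: "?B $ i $ j = (\<Sum>l\<in>UNIV. (?M $ l $ i) *\<^sub>R ?t l) $ enum_idx K j" for i j
      by (simp add: matrix_matrix_mult_def transpose_def minor_def)
    have BT: "?B $ i $ j0 = L (axis i 1) $ iT" for i
      unfolding B j0 using arg_cong[OF L[of i], of "\<lambda>y. y $ iT"] by (simp add: qT)
    have S: "?S $ l $ j = (if l = j then 1 else 0) + (if l = j0 then w $ j else 0)" for l j
      by (simp add: matrix_def inner_axis) (simp add: axis_def)
    have "minor (\<lambda>i. cof x (v i)) K $ i $ j = (?B ** ?S) $ i $ j" for i j
    proof -
      have "(?B ** ?S) $ i $ j = (\<Sum>l\<in>UNIV. ?B $ i $ l * ?S $ l $ j)"
        by (simp add: matrix_matrix_mult_def)
      also have "\<dots> = (\<Sum>l\<in>UNIV. (if l = j then ?B $ i $ l else 0) + (if l = j0 then ?B $ i $ l * w $ j else 0))"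
        unfolding S by (rule sum.cong) (auto simp: algebra_simps)
      also have "\<dots> = ?B $ i $ j + ?B $ i $ j0 * w $ j"
        by (simp add: sum.distrib)
      also have "\<dots> = L (axis i 1) $ enum_idx K j"
        unfolding BT unfolding B using arg_cong[OF L[of i], of "\<lambda>y. y $ enum_idx K j"] by (simp add: w_def)
      finally show ?thesis by (simp add: minor_def v)
    qed
    then have "minor (\<lambda>i. cof x (v i)) K = ?B ** ?S" by (simp add: vec_eq_iff)
    then show ?thesis
      by (simp add: det_mul det_transpose det_shear[OF w])
  qed
  have zero: "det (minor ?t K) = 0" if K: "card K = CARD('m)" "iT \<notin> K" for K
  proof -
    have "enum_idx K j \<noteq> iT" for j :: 'm
      using enum_idx_bij[OF K(1)] K(2) by (metis UNIV_I bij_betw_apply)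
    then have "eT $ enum_idx K j = 0" for j :: 'm
      by (simp add: eT_def axis_def)
    then have "row i0 (minor ?t K) = 0"
      by (simp add: row_def minor_def iso_axis[OF \<Theta>] vec_eq_iff)
    then show ?thesis by (rule det_zero_row)
  qed
  have "(\<Sum>K | card K = CARD('m) \<and> iT \<in> K. (det (minor (\<lambda>i. cof x (v i)) K))\<^sup>2) =
      (det ?M)\<^sup>2 * (\<Sum>K | card K = CARD('m) \<and> iT \<in> K. (det (minor ?t K))\<^sup>2)"
    unfolding sum_distrib_left by (rule sum.cong) (auto simp: main power_mult_distrib)
  also have "(\<Sum>K | card K = CARD('m) \<and> iT \<in> K. (det (minor ?t K))\<^sup>2) = (\<Sum>K | card K = CARD('m). (det (minor ?t K))\<^sup>2)"
    by (rule sum.mono_neutral_left) (auto simp: zero)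
  also have "\<dots> = det (\<chi> i j. inner (?t i) (?t j))" by (rule sum_minors)
  also have "(\<chi> i j. inner (?t i) (?t j)) = (mat 1 :: real^'m^'m)"
    by (simp add: iso_inner[OF \<Theta>] inner_axis_axis mat_def vec_eq_iff)
  finally show ?thesis
    by (simp add: vertical_part_minors)
qed

section \<open>The area formula near a point\<close>

lemma norm_linear_le_Basis:
  fixes T :: "'a::euclidean_space \<Rightarrow> 'b::real_normed_vector"
  assumes "linear T"
  shows "norm (T h) \<le> (\<Sum>b\<in>Basis. norm (T b)) * norm h"
proof -
  have "T h = (\<Sum>b\<in>Basis. (h \<bullet> b) *\<^sub>R T b)"
    using linear_sum[OF assms, of "\<lambda>b. (h \<bullet> b) *\<^sub>R b" Basis] by (simp add: euclidean_representation linear_scale[OF assms])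
  also have "norm \<dots> \<le> (\<Sum>b\<in>Basis. norm ((h \<bullet> b) *\<^sub>R T b))"
    by (rule norm_sum)
  also have "\<dots> \<le> (\<Sum>b\<in>Basis. norm (T b) * norm h)"
  proof (intro sum_mono)
    fix b :: 'a assume "b \<in> Basis"
    then have "\<bar>h \<bullet> b\<bar> * norm (T b) \<le> norm h * norm (T b)"
      by (intro mult_right_mono Basis_le_norm) auto
    then show "norm ((h \<bullet> b) *\<^sub>R T b) \<le> norm (T b) * norm h" by (simp add: mult.commute)
  qed
  finally show ?thesis by (simp add: sum_distrib_right)
qed

lemma continuous_on_det_entries:
  fixes A :: "'a::topological_space \<Rightarrow> real^'m::finite^'m"
  assumes "\<And>i j. continuous_on S (\<lambda>x. A x $ i $ j)"
  shows "continuous_on S (\<lambda>x. det (A x))"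
  unfolding det_def by (intro continuous_intros assms)

text \<open>For a fixed base point \<open>u1\<close> the map \<open>cof (\<phi> u1)\<close> is
  linear, so the mean value inequality applies to the difference from the derivative at
  \<open>u0\<close>. Joint continuity in the base point and in the point of differentiation gives
  one radius for all of them.\<close>

lemma strict_differentiability:
  fixes \<phi> :: "real^'m::finite \<Rightarrow> 'n::finite heis" and \<Theta> :: "real^'m \<Rightarrow> 'n heis"
  assumes U: "open U" "u0 \<in> U"
    and der: "\<And>u. u \<in> U \<Longrightarrow> (\<phi> has_derivative D u) (at u)"
    and cD: "\<And>b. b \<in> Basis \<Longrightarrow> continuous_on U (\<lambda>u. D u b)"
    and e: "e > 0"
  obtains s where "s > 0" "ball u0 s \<subseteq> U"
    "\<And>u1 u u'. \<lbrakk>u1 \<in> ball u0 s; u \<in> ball u0 s; u' \<in> ball u0 s\<rbrakk> \<Longrightarrow>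
      norm (cof (\<phi> u1) (\<phi> u - \<phi> u') - cof (\<phi> u0) (D u0 (u - u'))) \<le> e * norm (u - u')"
    "\<And>u1 u. \<lbrakk>u1 \<in> ball u0 s; u \<in> ball u0 s\<rbrakk> \<Longrightarrow>
      \<bar>det (matrix (\<lambda>h. isoadj \<Theta> (cof (\<phi> u1) (D u h)))) - det (matrix (\<lambda>h. isoadj \<Theta> (cof (\<phi> u0) (D u0 h))))\<bar> \<le> e"
proof -
  have linD: "linear (D u)" if "u \<in> U" for u
    using der[OF that] by (rule has_derivative_linear)
  have cphi: "continuous_on U \<phi>"
    using der by (meson continuous_at_imp_continuous_on has_derivative_continuous)
  define Gb where "Gb b p = cof (\<phi> (fst p)) (D (snd p) b)" for b and p :: "(real^'m) \<times> (real^'m)"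
  define dd where "dd p = det (matrix (\<lambda>h. isoadj \<Theta> (cof (\<phi> (fst p)) (D (snd p) h))))" for p :: "(real^'m) \<times> (real^'m)"
  have cGb: "continuous_on (U \<times> U) (Gb b)" if "b \<in> Basis" for b
    unfolding Gb_def[abs_def] cof_def
    by (intro continuous_intros bounded_bilinear.continuous_on[OF bounded_bilinear_om]
        continuous_on_compose2[OF cphi continuous_on_fst] continuous_on_compose2[OF cD[OF that] continuous_on_snd]) auto
  have cdd: "continuous_on (U \<times> U) dd"
    unfolding dd_def
  proof (rule continuous_on_det_entries)
    fix i j :: 'm
    have "continuous_on (U \<times> U) (\<lambda>p. isoadj \<Theta> (Gb (axis j 1) p))"
      by (intro linear_continuous_on_compose[OF _ linear_isoadj] cGb) simp
    then show "continuous_on (U \<times> U) (\<lambda>p. matrix (\<lambda>h. isoadj \<Theta> (cof (\<phi> (fst p)) (D (snd p) h))) $ i $ j)"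
      unfolding matrix_def Gb_def by (simp add: continuous_on_component)
  qed
  define G where "G p = (\<Sum>b\<in>Basis. norm (Gb b p - Gb b (u0, u0))) + \<bar>dd p - dd (u0, u0)\<bar>" for p
  have cG: "continuous_on (U \<times> U) G"
    unfolding G_def[abs_def] by (intro continuous_intros cGb cdd)
  have "open ((U \<times> U) \<inter> G -` {..<e})"
    by (rule continuous_open_preimage[OF cG]) (use U in \<open>auto intro: open_Times\<close>)
  moreover have "(u0, u0) \<in> (U \<times> U) \<inter> G -` {..<e}"
    using U e by (simp add: G_def)
  ultimately obtain A B where AB: "open A" "open B" "(u0, u0) \<in> A \<times> B" "A \<times> B \<subseteq> (U \<times> U) \<inter> G -` {..<e}"
    by (rule open_prod_elim)
  then have "open (A \<inter> B \<inter> U)" "u0 \<in> A \<inter> B \<inter> U" using U by auto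
  then obtain s where s: "s > 0" "ball u0 s \<subseteq> A \<inter> B \<inter> U"
    using open_contains_ball by blast
  have Ge: "G (u1, u) < e" if "u1 \<in> ball u0 s" "u \<in> ball u0 s" for u1 u
    using that s(2) AB(4) by blast
  let ?L = "\<lambda>h. cof (\<phi> u0) (D u0 h)"
  have linL: "linear ?L"
    using linear_compose[OF linD[OF U(2)] linear_cof] by (simp add: comp_def)
  show thesis
  proof (rule that[OF s(1)])
    show "ball u0 s \<subseteq> U" using s(2) by blast
    fix u1 u u' assume u: "u1 \<in> ball u0 s" "u \<in> ball u0 s" "u' \<in> ball u0 s"
    define f where "f v = cof (\<phi> u1) (\<phi> v) - ?L v" for v
    have "norm (f u - f u') \<le> e * norm (u - u')"
    proof (rule differentiable_bound[OF convex_ball _ _ u(2,3)])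
      fix v assume v: "v \<in> ball u0 s"
      then have vU: "v \<in> U" using s(2) by blast
      have "(f has_derivative (\<lambda>h. cof (\<phi> u1) (D v h) - ?L h)) (at v)"
        unfolding f_def[abs_def]
        by (intro has_derivative_diff bounded_linear.has_derivative[OF linear_linear[THEN iffD2, OF linear_cof]] der[OF vU]
            linear_imp_has_derivative[OF linL])
      then show "(f has_derivative (\<lambda>h. cof (\<phi> u1) (D v h) - ?L h)) (at v within ball u0 s)"
        by (rule has_derivative_at_withinI)
      have lin: "linear (\<lambda>h. cof (\<phi> u1) (D v h) - ?L h)"
        using linear_compose[OF linD[OF vU] linear_cof, of "\<phi> u1"] by (intro linear_compose_sub linL) (simp add: comp_def)
      have le: "(\<Sum>b\<in>Basis. norm (cof (\<phi> u1) (D v b) - ?L b)) \<le> e"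
        using Ge[OF u(1) v] by (simp add: G_def Gb_def)
      show "onorm (\<lambda>h. cof (\<phi> u1) (D v h) - ?L h) \<le> e"
      proof (rule onorm_bound)
        show "norm (cof (\<phi> u1) (D v h) - ?L h) \<le> e * norm h" for h
          using norm_linear_le_Basis[OF lin, of h] mult_right_mono[OF le norm_ge_zero[of h]] by linarith
      qed (use e in simp)
    qed
    moreover have "f u - f u' = cof (\<phi> u1) (\<phi> u - \<phi> u') - ?L (u - u')"
      by (simp add: f_def linear_diff[OF linear_cof] linear_diff[OF linD[OF U(2)]])
    ultimately show "norm (cof (\<phi> u1) (\<phi> u - \<phi> u') - ?L (u - u')) \<le> e * norm (u - u')" by simp
  next
    fix u1 u assume u: "u1 \<in> ball u0 s" "u \<in> ball u0 s"
    have "0 \<le> (\<Sum>b\<in>Basis. norm (Gb b (u1, u) - Gb b (u0, u0)))" by (intro sum_nonneg) auto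
    then show "\<bar>det (matrix (\<lambda>h. isoadj \<Theta> (cof (\<phi> u1) (D u h)))) - det (matrix (\<lambda>h. isoadj \<Theta> (?L h)))\<bar> \<le> e"
      using Ge[OF u] by (simp add: G_def dd_def)
  qed
qed

text \<open>By \<open>sup_area_eq\<close> all vertical isometries give the same value. That one
  exists is shown by \<open>vertical_decomposition\<close> at a non-horizontal point, and by a
  dimension count in \<open>metric_factor_pos\<close>.\<close>

definition metric_factor :: "'m::finite \<Rightarrow> 'n::finite itself \<Rightarrow> real" where
  "metric_factor i0 _ = (SUP c. area (SOME \<Theta> :: real^'m \<Rightarrow> 'n heis. vert_iso i0 \<Theta>) c)"

lemma metric_factor_eq:
  fixes \<Theta> :: "real^'m::finite \<Rightarrow> 'n::finite heis"
  assumes "vert_iso i0 \<Theta>"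
  shows "metric_factor i0 TYPE('n) = (SUP c. area \<Theta> c)"
  unfolding metric_factor_def by (rule sup_area_eq[OF someI[of "vert_iso i0", OF assms] assms])

text \<open>Absorbs the factors of \<open>ball_measure_le\<close> and \<open>ball_measure_ge\<close>
  into \<open>1 + e\<close> and \<open>1 - e\<close>.\<close>

lemma small_parameter:
  fixes e :: real
  assumes "e > 0"
  obtains t where "0 < t" "t < 1" "(1 + t) ^ d \<le> (1 + e) * (1 - t)" "(1 - e) * (1 + t) \<le> (1 - t) * (1 - t) ^ d"
proof -
  have "((\<lambda>t. (1 + e) * (1 - t) - (1 + t) ^ d) \<longlongrightarrow> (1 + e) * (1 - 0) - (1 + 0) ^ d) (at_right 0)"
    by (intro tendsto_intros)
  then have "((\<lambda>t. (1 + e) * (1 - t) - (1 + t) ^ d) \<longlongrightarrow> e) (at_right 0)" by simp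
  then have 1: "\<forall>\<^sub>F t in at_right 0. 0 < (1 + e) * (1 - t) - (1 + t) ^ d"
    using assms by (rule order_tendstoD)
  have "((\<lambda>t. (1 - t) * (1 - t) ^ d - (1 - e) * (1 + t)) \<longlongrightarrow> (1 - 0) * (1 - 0) ^ d - (1 - e) * (1 + 0)) (at_right 0)"
    by (intro tendsto_intros)
  then have "((\<lambda>t. (1 - t) * (1 - t) ^ d - (1 - e) * (1 + t)) \<longlongrightarrow> e) (at_right 0)" by simp
  then have 2: "\<forall>\<^sub>F t in at_right 0. 0 < (1 - t) * (1 - t) ^ d - (1 - e) * (1 + t)"
    using assms by (rule order_tendstoD)
  have 3: "\<forall>\<^sub>F t in at_right (0::real). t \<in> {0<..<1}"
    by (rule eventually_at_right_real) simp
  have "\<forall>\<^sub>F t in at_right 0. 0 < (1 + e) * (1 - t) - (1 + t) ^ d \<and> 0 < (1 - t) * (1 - t) ^ d - (1 - e) * (1 + t) \<and> t \<in> {0<..<1}"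
    using 1 2 3 by eventually_elim auto
  then obtain t where "0 < (1 + e) * (1 - t) - (1 + t) ^ d \<and> 0 < (1 - t) * (1 - t) ^ d - (1 - e) * (1 + t) \<and> t \<in> {0<..<1}"
    using eventually_happens'[OF trivial_limit_at_right_real] by blast
  then show thesis by (intro that[of t]) auto
qed

text \<open>The radius is chosen before the Borel set \<open>A\<close>, which later allows the
  inequalities to be summed over a partition. \<open>J0\<close> equals the Jacobian of the
  projection to the limit subspace by \<open>vertical_part_det\<close>, and cancels against the
  \<open>J0\<close> in the density bounds of balls.\<close>

lemma local_area_formula:
  fixes \<phi> :: "real^'m::finite \<Rightarrow> 'n::finite heis" and i0 :: 'm
  assumes U: "open U" "u0 \<in> U"
    and der: "\<And>u. u \<in> U \<Longrightarrow> (\<phi> has_derivative D u) (at u)"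
    and cD: "\<And>b. b \<in> Basis \<Longrightarrow> continuous_on U (\<lambda>u. D u b)"
    and inj: "inj (D u0)" and nh: "cof (\<phi> u0) (D u0 h0) $ iT \<noteq> 0" and e: "0 < e" "e < 1"
  defines "J0 \<equiv> vertical_part (\<lambda>i. D u0 (axis i 1)) (\<phi> u0)"
    and "S \<equiv> spherical_hausdorff cc_dist (CARD('m) + 1)"
  shows "0 < J0 \<and> 0 < metric_factor i0 TYPE('n) \<and> (\<exists>s>0. ball u0 s \<subseteq> U \<and> (\<forall>A\<in>sets borel. A \<subseteq> ball u0 s \<longrightarrow>
    ennreal J0 * emeasure lborel A \<le> ennreal ((1 + e) * metric_factor i0 TYPE('n)) * S (\<phi> ` A) \<and>
    ennreal ((1 - e) * metric_factor i0 TYPE('n)) * S (\<phi> ` A) \<le> ennreal J0 * emeasure lborel A))"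
proof -
  define L where "L h = cof (\<phi> u0) (D u0 h)" for h
  define d where "d = CARD('m) + 1"
  have linD: "linear (D u0)"
    using der[OF U(2)] by (rule has_derivative_linear)
  have linL: "linear L"
    using linear_compose[OF linD linear_cof] by (simp add: L_def[abs_def] comp_def)
  have injL: "inj L"
  proof (rule linear_injective_0[OF linL, THEN iffD2], intro allI impI)
    fix h assume "L h = 0"
    then have 1: "D u0 h = (om (\<phi> u0) (D u0 h) / 2) *\<^sub>R eT" by (simp add: L_def cof_def)
    have "om (\<phi> u0) (D u0 h) = 0" by (subst 1) (simp add: om_simps)
    then have "D u0 h = 0" using 1 by simp
    then show "h = 0" using inj linear_injective_0[OF linD] by blast
  qed
  have nhL: "L h0 $ iT \<noteq> 0" using nh by (simp add: L_def)
  obtain \<Theta> q \<kappa> where \<Theta>: "vert_iso i0 \<Theta>" and \<kappa>: "\<kappa> > 0"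
    and q: "\<And>h. L h = \<Theta> (isoadj \<Theta> (L h)) + (L h $ iT) *\<^sub>R q"
    and expand: "\<And>h. \<kappa> * norm h \<le> norm (isoadj \<Theta> (L h))"
    by (rule vertical_decomposition[OF linL injL nhL]) (rule that)
  have J0: "J0 = \<bar>det (matrix (\<lambda>h. isoadj \<Theta> (L h)))\<bar>"
    unfolding J0_def by (rule vertical_part_det[OF \<Theta> linL nhL q]) (simp add: L_def)
  interpret blow_up i0 \<Theta> L "norm q" \<kappa>
  proof
    show "norm (L h - \<Theta> (isoadj \<Theta> (L h))) \<le> norm q * \<bar>L h $ iT\<bar>" for h
    proof -
      have "L h - \<Theta> (isoadj \<Theta> (L h)) = (L h $ iT) *\<^sub>R q" using q[of h] by (metis add_diff_cancel_left')
      then show ?thesis by (simp add: mult.commute)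
    qed
  qed (use \<Theta> \<kappa> expand in \<open>auto simp: linear_add[OF linL] linear_scale[OF linL]\<close>)
  have J0pos: "J0 > 0"
    using det_nz_iff_inj[OF linear_iso_L] inj_iso_L by (simp add: J0)
  let ?\<beta> = "SUP c. area \<Theta> c"
  have \<beta>: "metric_factor i0 TYPE('n) = ?\<beta>" by (rule metric_factor_eq[OF \<Theta>])
  have \<beta>pos: "?\<beta> > 0" by (rule sup_area_pos[OF \<Theta>])
  obtain t where t: "0 < t" "t < 1" "(1 + t) ^ d \<le> (1 + e) * (1 - t)" "(1 - e) * (1 + t) \<le> (1 - t) * (1 - t) ^ d"
    using small_parameter[OF e(1)] by blast
  obtain c0 where c0: "\<And>r. r > 0 \<Longrightarrow> measure lebesgue {k. hdist (dil r c0) (\<Theta> k) \<le> r} \<ge> (1 - t) * ?\<beta> * r ^ (CARD('m) + 1)"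
    by (rule measure_iso_ball_ge[OF \<Theta> t(1)]) (rule that)
  define C where "C = (1 + hn c0) + (1 + hn c0)\<^sup>2"
  \<comment> \<open>The upper estimate asks for a constant of at least 4 and the lower one for
    exactly \<open>C\<close>; the property obtained for \<open>CC\<close> implies both.\<close>
  define CC where "CC = C + 4"
  have C0: "C \<ge> 0" by (simp add: C_def)
  have CC: "CC \<ge> 1" "CC \<ge> 4" "C \<le> CC" using C0 by (auto simp: CC_def)
  obtain \<epsilon> where \<epsilon>: "0 < \<epsilon>" "\<epsilon> \<le> \<kappa> / 2" "\<epsilon> \<le> 1"
    and nv: "\<And>g h r. \<lbrakk>norm (g - L h) \<le> \<epsilon> * norm h; 0 < r; r \<le> \<epsilon>; norm (isoadj \<Theta> g) \<le> CC * r; \<bar>g $ iT\<bar> \<le> CC * r\<^sup>2\<rbrakk>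
      \<Longrightarrow> hdist (\<Theta> (isoadj \<Theta> g)) g \<le> t * r"
    by (rule near_vertical[OF CC(1) t(1)]) (rule that)
  have nvC: "hdist (\<Theta> (isoadj \<Theta> g)) g \<le> t * r"
    if "norm (g - L h) \<le> \<epsilon> * norm h" "0 < r" "r \<le> \<epsilon>" "norm (isoadj \<Theta> g) \<le> C * r" "\<bar>g $ iT\<bar> \<le> C * r\<^sup>2" for g h r
  proof (rule nv[OF that(1-3)])
    show "norm (isoadj \<Theta> g) \<le> CC * r" using that(4) mult_right_mono[OF CC(3), of r] that(2) by linarith
    show "\<bar>g $ iT\<bar> \<le> CC * r\<^sup>2" using that(5) mult_right_mono[OF CC(3), of "r\<^sup>2"] by simp
  qed
  \<comment> \<open>The second bound turns the absolute error of the Jacobian into an error relative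
    to \<open>J0\<close>.\<close>
  define \<epsilon>' where "\<epsilon>' = min \<epsilon> (t * J0)"
  have \<epsilon>': "\<epsilon>' > 0" "\<epsilon>' \<le> \<epsilon>" "\<epsilon>' \<le> t * J0" using \<epsilon> t J0pos by (auto simp: \<epsilon>'_def)
  obtain s where s: "s > 0" "ball u0 s \<subseteq> U"
    and close: "\<And>u1 u u'. \<lbrakk>u1 \<in> ball u0 s; u \<in> ball u0 s; u' \<in> ball u0 s\<rbrakk> \<Longrightarrow>
      norm (cof (\<phi> u1) (\<phi> u - \<phi> u') - cof (\<phi> u0) (D u0 (u - u'))) \<le> \<epsilon>' * norm (u - u')"
    and jac: "\<And>u1 u. \<lbrakk>u1 \<in> ball u0 s; u \<in> ball u0 s\<rbrakk> \<Longrightarrow>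
      \<bar>det (matrix (\<lambda>h. isoadj \<Theta> (cof (\<phi> u1) (D u h)))) - det (matrix (\<lambda>h. isoadj \<Theta> (cof (\<phi> u0) (D u0 h))))\<bar> \<le> \<epsilon>'"
    by (rule strict_differentiability[OF U der cD \<epsilon>'(1)]) (assumption+, rule that)
  interpret B: blow_up_chart i0 \<Theta> L "norm q" \<kappa> \<phi> D u0 s \<epsilon> t J0
  proof
    show "norm (cof (\<phi> u1) (\<phi> u - \<phi> u') - L (u - u')) \<le> \<epsilon> * norm (u - u')"
      if "u1 \<in> ball u0 s" "u \<in> ball u0 s" "u' \<in> ball u0 s" for u1 u u'
      using close[OF that] mult_right_mono[OF \<epsilon>'(2), of "norm (u - u')"] by (simp add: L_def)
    show "\<bar>\<bar>det (matrix (\<lambda>h. isoadj \<Theta> (cof (\<phi> u1) (D u h))))\<bar> - J0\<bar> \<le> t * J0"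
      if "u1 \<in> ball u0 s" "u \<in> ball u0 s" for u1 u
      using jac[OF that] \<epsilon>'(3) unfolding J0 L_def by linarith
  qed (use s \<epsilon> t J0 der in auto)
  have Bbeta: "B.beta = ?\<beta>" by (simp add: B.beta_def)
  \<comment> \<open>\<open>b\<close> and \<open>a\<close> are the bounds of
    \<open>B.ball_measure_le\<close> and \<open>B.ball_measure_ge\<close> solved for the measure of
    a ball; \<open>J0 * b\<close> and \<open>J0 * a\<close> then lie between
    \<open>(1 - e) * ?\<beta>\<close> and \<open>(1 + e) * ?\<beta>\<close>.\<close>
  define b where "b = (1 + t) ^ d * ?\<beta> / ((1 - t) * J0)"
  define a where "a = (1 - t) * (1 - t) ^ d * ?\<beta> / ((1 + t) * J0)"
  have ab: "a > 0" "b > 0" using t J0pos \<beta>pos by (simp_all add: a_def b_def)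
  \<comment> \<open>\<open>hn c0\<close> is the distance of a dense ball from its point at unit
    scale, and \<open>4 / \<kappa>\<close> is the constant of \<open>dist_le_hdist\<close>.\<close>
  define C' where "C' = hn c0 + 4 / \<kappa>"
  have C': "C' > 0" "hn c0 \<le> C'" "4 / \<kappa> \<le> C'" using \<kappa> by (auto simp: C'_def add_nonneg_pos)
  \<comment> \<open>The last bound makes \<open>2 / \<kappa> * (C * r)\<close> at most
    \<open>s / 4\<close>, so that the ball on which \<open>F_surj\<close> applies Brouwer's theorem
    stays inside the chart.\<close>
  define \<delta>0 where "\<delta>0 = min (min \<epsilon> (1/2)) (s * \<kappa> / (8 * (C + 1)))"
  have \<delta>0: "\<delta>0 > 0" "\<delta>0 \<le> \<epsilon>" "2 * \<delta>0 \<le> 1" "\<delta>0 \<le> s * \<kappa> / (8 * (C + 1))"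
    using \<epsilon> s \<kappa> C0 by (auto simp: \<delta>0_def)
  have \<delta>s: "2 / \<kappa> * (C * r) < s / 2" if "0 < r" "r \<le> \<delta>0" for r
  proof -
    have "C * r \<le> (C + 1) * (s * \<kappa> / (8 * (C + 1)))"
      using that \<delta>0(4) C0 by (intro mult_mono) auto
    also have "\<dots> = s * \<kappa> / 8" using C0 by (simp add: field_simps)
    finally have "2 / \<kappa> * (C * r) \<le> 2 / \<kappa> * (s * \<kappa> / 8)" using \<kappa> by (intro mult_left_mono) auto
    also have "\<dots> = s / 4" using \<kappa> by simp
    finally show ?thesis using s by simp
  qed
  interpret H: distance "hdist :: 'n heis \<Rightarrow> 'n heis \<Rightarrow> real" d by (rule hdist_distance) (simp add: d_def)
  interpret V: density_chart d \<phi> "ball u0 s" "ball u0 (s/2)" a b C' \<delta>0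
  proof
    show "open (ball u0 (s/2))" "bounded (ball u0 s)" "ball u0 s \<in> sets borel" by auto
    show "ball u0 (s/2) \<subseteq> ball u0 s" using s by (intro subset_ball) simp
    show "continuous_on (ball u0 s) \<phi>" by (rule B.cont)
    show "0 < a" "0 < b" "0 < C'" "0 < \<delta>0" by fact+
    show "measure lebesgue {u \<in> ball u0 s. hdist c (\<phi> u) \<le> r} \<le> b * r ^ d" if r: "0 < r" "r \<le> \<delta>0" for c r
    proof -
      have "(1 - t) * J0 * measure lebesgue (B.E c r) \<le> (1 + t) ^ (CARD('m) + 1) * B.beta * r ^ (CARD('m) + 1)"
        by (rule B.ball_measure_le[OF nv CC(2)]) (use r \<delta>0 in auto)
      then have "measure lebesgue (B.E c r) * ((1 - t) * J0) \<le> (1 + t) ^ d * ?\<beta> * r ^ d"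
        unfolding Bbeta d_def by (simp only: mult.commute)
      then have "measure lebesgue (B.E c r) \<le> (1 + t) ^ d * ?\<beta> * r ^ d / ((1 - t) * J0)"
        using t J0pos by (subst pos_le_divide_eq) simp_all
      then show ?thesis
        by (simp add: b_def B.E_def)
    qed
    show "\<exists>c. hdist c (\<phi> u1) \<le> C' * r \<and> a * r ^ d \<le> measure lebesgue {u \<in> ball u0 s. hdist c (\<phi> u) \<le> r}"
      if u1: "u1 \<in> ball u0 (s/2)" and r: "0 < r" "r \<le> \<delta>0" for u1 r
    proof -
      have "\<exists>c. hdist c (\<phi> u1) \<le> hn c0 * r \<and>
        (1 - t) * (1 - t) ^ (CARD('m) + 1) * B.beta * r ^ (CARD('m) + 1) \<le> (1 + t) * J0 * measure lebesgue (B.E c r)"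
        by (rule B.ball_measure_ge[OF nvC _ C_def]) (use r \<delta>0 \<delta>s u1 c0 Bbeta in auto)
      then obtain c where c: "hdist c (\<phi> u1) \<le> hn c0 * r"
        "(1 - t) * (1 - t) ^ d * ?\<beta> * r ^ d \<le> (1 + t) * J0 * measure lebesgue (B.E c r)"
        unfolding Bbeta d_def by blast
      have "hdist c (\<phi> u1) \<le> C' * r" using c(1) mult_right_mono[OF C'(2), of r] r by linarith
      moreover have "a * r ^ d \<le> measure lebesgue {u \<in> ball u0 s. hdist c (\<phi> u) \<le> r}"
      proof -
        have "(1 - t) * (1 - t) ^ d * ?\<beta> * r ^ d / ((1 + t) * J0) \<le> measure lebesgue (B.E c r)"
          using c(2) t J0pos by (subst pos_divide_le_eq) (simp_all add: mult.commute)
        then show ?thesis by (simp add: a_def B.E_def)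
      qed
      ultimately show ?thesis by blast
    qed
    show "norm (u - u1) \<le> C' * r" if "u1 \<in> ball u0 s" "u \<in> ball u0 s" "hdist (\<phi> u1) (\<phi> u) \<le> r" "r \<le> 1" for u1 u r
    proof -
      have "0 \<le> r" using that(3) H.rr_nonneg[of "\<phi> u1" "\<phi> u"] by linarith
      then show ?thesis
        using B.dist_le_hdist[OF that] mult_right_mono[OF C'(3), of r] by linarith
    qed
  qed
  have S: "S = H.sh" by (simp add: S_def d_def cc_dist_hdist)
  have "\<exists>s>0. ball u0 s \<subseteq> U \<and> (\<forall>A\<in>sets borel. A \<subseteq> ball u0 s \<longrightarrow>
    ennreal J0 * emeasure lborel A \<le> ennreal ((1 + e) * ?\<beta>) * S (\<phi> ` A) \<and>
    ennreal ((1 - e) * ?\<beta>) * S (\<phi> ` A) \<le> ennreal J0 * emeasure lborel A)"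
  proof (intro exI[of _ "s/2"] conjI ballI impI)
    show "0 < s / 2" using s by simp
    have sub: "ball u0 (s/2) \<subseteq> ball u0 s" using s by (intro subset_ball) simp
    then show "ball u0 (s/2) \<subseteq> U" using s by blast
    fix A :: "(real^'m) set" assume A: "A \<in> sets borel" "A \<subseteq> ball u0 (s/2)"
    have "ennreal J0 * emeasure lborel A \<le> ennreal J0 * (ennreal b * S (\<phi> ` A))"
      unfolding S by (intro mult_left_mono V.measure_le_hausdorff) (use A sub in auto)
    also have "\<dots> = ennreal (J0 * b) * S (\<phi> ` A)"
      using J0pos by (simp add: ennreal_mult' mult.assoc)
    also have "\<dots> \<le> ennreal ((1 + e) * ?\<beta>) * S (\<phi> ` A)"
    proof (intro mult_right_mono ennreal_leI)
      have "J0 * b = (1 + t) ^ d * ?\<beta> / (1 - t)" using J0pos by (simp add: b_def)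
      also have "\<dots> \<le> (1 + e) * (1 - t) * ?\<beta> / (1 - t)"
        using t \<beta>pos by (intro divide_right_mono mult_right_mono) auto
      also have "\<dots> = (1 + e) * ?\<beta>" using t by simp
      finally show "J0 * b \<le> (1 + e) * ?\<beta>" .
    qed simp
    finally show "ennreal J0 * emeasure lborel A \<le> ennreal ((1 + e) * ?\<beta>) * S (\<phi> ` A)" .
    have "ennreal ((1 - e) * ?\<beta>) * S (\<phi> ` A) \<le> ennreal (J0 * a) * S (\<phi> ` A)"
    proof (intro mult_right_mono ennreal_leI)
      have "(1 - e) * ?\<beta> = ((1 - e) * (1 + t)) * ?\<beta> / (1 + t)" using t by simp
      also have "\<dots> \<le> ((1 - t) * (1 - t) ^ d) * ?\<beta> / (1 + t)"
        using t \<beta>pos by (intro divide_right_mono mult_right_mono) auto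
      also have "\<dots> = J0 * a" using J0pos by (simp add: a_def)
      finally show "(1 - e) * ?\<beta> \<le> J0 * a" .
    qed simp
    also have "\<dots> \<le> ennreal (J0 * a) * (ennreal (1 / a) * emeasure lborel A)"
      unfolding S by (intro mult_left_mono V.hausdorff_le_measure) (use A in auto)
    also have "\<dots> = ennreal J0 * emeasure lborel A"
      using J0pos ab by (simp add: mult.assoc[symmetric] ennreal_mult'[symmetric])
    finally show "ennreal ((1 - e) * ?\<beta>) * S (\<phi> ` A) \<le> ennreal J0 * emeasure lborel A" .
  qed
  then show ?thesis using J0pos \<beta>pos unfolding \<beta> by blast
qed

section \<open>Smooth charts and tangent spaces\<close>

lemma frechet_derivative_eqI: "(f has_derivative f') (at x) \<Longrightarrow> frechet_derivative f (at x) = f'"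
  using frechet_derivative_at by metis

lemma differentiable_on_openD:
  "\<lbrakk>f differentiable_on U; open U; x \<in> U\<rbrakk> \<Longrightarrow> (f has_derivative frechet_derivative f (at x)) (at x)"
  by (metis at_within_open differentiable_on_def frechet_derivative_works)

lemma k_smooth_on_cong:
  assumes "open U" "\<And>x. x \<in> U \<Longrightarrow> f x = g x" "k_smooth_on k U f"
  shows "k_smooth_on k U g"
  using assms(2,3)
proof (induction k arbitrary: f g)
  case 0
  then show ?case by (simp cong: continuous_on_cong)
next
  case (Suc k)
  have der: "(g has_derivative frechet_derivative f (at x)) (at x)" if "x \<in> U" for x
    using differentiable_on_openD[OF _ assms(1) that, of f] Suc.prems that
    by (auto intro: has_derivative_transform_within_open[OF _ assms(1)])
  have "g differentiable_on U"
    unfolding differentiable_on_def using der has_derivative_at_withinI differentiableI by blast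
  moreover have "k_smooth_on k U (\<lambda>x. frechet_derivative g (at x) b)" if "b \<in> Basis" for b
  proof (rule Suc.IH)
    show "k_smooth_on k U (\<lambda>x. frechet_derivative f (at x) b)" using Suc.prems that by simp
    show "frechet_derivative f (at x) b = frechet_derivative g (at x) b" if "x \<in> U" for x
      using frechet_derivative_eqI[OF der[OF that]] by simp
  qed
  ultimately show ?case by simp
qed

lemma k_smooth_on_linear_comb:
  assumes "open U" "finite B" "\<And>b. b \<in> B \<Longrightarrow> k_smooth_on k U (f b)"
  shows "k_smooth_on k U (\<lambda>x. \<Sum>b\<in>B. c b *\<^sub>R f b x)"
  using assms(3)
proof (induction k arbitrary: f)
  case 0
  then show ?case by (auto intro!: continuous_intros)
next
  case (Suc k)
  have der: "((\<lambda>x. \<Sum>b\<in>B. c b *\<^sub>R f b x) has_derivative (\<lambda>h. \<Sum>b\<in>B. c b *\<^sub>R frechet_derivative (f b) (at x) h)) (at x)"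
    if "x \<in> U" for x
    using Suc.prems by (intro has_derivative_sum has_derivative_scaleR_right differentiable_on_openD[OF _ assms(1) that]) auto
  have "(\<lambda>x. \<Sum>b\<in>B. c b *\<^sub>R f b x) differentiable_on U"
    unfolding differentiable_on_def using der has_derivative_at_withinI differentiableI by blast
  moreover have "k_smooth_on k U (\<lambda>x. frechet_derivative (\<lambda>x. \<Sum>b\<in>B. c b *\<^sub>R f b x) (at x) i)" if i: "i \<in> Basis" for i
  proof (rule k_smooth_on_cong[OF assms(1)])
    show "k_smooth_on k U (\<lambda>x. \<Sum>b\<in>B. c b *\<^sub>R frechet_derivative (f b) (at x) i)"
      by (rule Suc.IH) (use Suc.prems i in auto)
    show "(\<Sum>b\<in>B. c b *\<^sub>R frechet_derivative (f b) (at x) i) = frechet_derivative (\<lambda>x. \<Sum>b\<in>B. c b *\<^sub>R f b x) (at x) i"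
      if "x \<in> U" for x
      using frechet_derivative_eqI[OF der[OF that]] by simp
  qed
  ultimately show ?case by simp
qed

text \<open>A chart followed along a straight line has to be a smooth curve in order to witness a
  tangent vector. The derivative along \<open>h\<close> is a fixed combination of partial
  derivatives, which is why the induction goes through linear combinations.\<close>

lemma k_smooth_on_line:
  fixes f :: "'a::euclidean_space \<Rightarrow> 'b::real_normed_vector" and I :: "real set"
  assumes U: "open U" and I: "open I" "\<And>t. t \<in> I \<Longrightarrow> u + t *\<^sub>R h \<in> U" and f: "k_smooth_on k U f"
  shows "k_smooth_on k I (\<lambda>t. f (u + t *\<^sub>R h))"
  using f
proof (induction k arbitrary: f)
  case 0
  then have f: "continuous_on U f" by simp
  have "continuous_on I (\<lambda>t. u + t *\<^sub>R h)" by (intro continuous_intros)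
  then have "continuous_on I (\<lambda>t. f (u + t *\<^sub>R h))"
    by (rule continuous_on_compose2[OF f]) (use I(2) in blast)
  then show ?case by simp
next
  case (Suc k)
  have der: "((\<lambda>t. f (u + t *\<^sub>R h)) has_derivative (\<lambda>s. frechet_derivative f (at (u + t *\<^sub>R h)) (s *\<^sub>R h))) (at t)" if t: "t \<in> I" for t
  proof -
    have "(f has_derivative frechet_derivative f (at (u + t *\<^sub>R h))) (at (u + t *\<^sub>R h))"
      by (rule differentiable_on_openD[OF _ U I(2)[OF t]]) (use Suc.prems in simp)
    moreover have "((\<lambda>t. u + t *\<^sub>R h) has_derivative (\<lambda>s. s *\<^sub>R h)) (at t)"
      by (auto intro!: derivative_eq_intros)
    ultimately show ?thesis
      using diff_chain_at[of "\<lambda>t. u + t *\<^sub>R h"] by (fastforce simp: comp_def)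
  qed
  have "(\<lambda>t. f (u + t *\<^sub>R h)) differentiable_on I"
    unfolding differentiable_on_def using der has_derivative_at_withinI differentiableI by blast
  moreover have "k_smooth_on k I (\<lambda>t. frechet_derivative (\<lambda>t. f (u + t *\<^sub>R h)) (at t) 1)"
  proof (rule k_smooth_on_cong[OF I(1)])
    show "k_smooth_on k I (\<lambda>t. \<Sum>b\<in>Basis. (h \<bullet> b) *\<^sub>R frechet_derivative f (at (u + t *\<^sub>R h)) b)"
      by (rule k_smooth_on_linear_comb[OF I(1)]) (use Suc in auto)
    fix t assume t: "t \<in> I"
    have lin: "linear (frechet_derivative f (at (u + t *\<^sub>R h)))"
      using differentiable_on_openD[OF _ U I(2)[OF t], of f] Suc.prems has_derivative_linear by auto
    have "(\<Sum>b\<in>Basis. (h \<bullet> b) *\<^sub>R frechet_derivative f (at (u + t *\<^sub>R h)) b) = frechet_derivative f (at (u + t *\<^sub>R h)) h"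
      using linear_sum[OF lin, of "\<lambda>b. (h \<bullet> b) *\<^sub>R b" Basis]
      by (simp add: euclidean_representation linear_scale[OF lin])
    then show "(\<Sum>b\<in>Basis. (h \<bullet> b) *\<^sub>R frechet_derivative f (at (u + t *\<^sub>R h)) b) = frechet_derivative (\<lambda>t. f (u + t *\<^sub>R h)) (at t) 1"
      using frechet_derivative_eqI[OF der[OF t]] by simp
  qed
  ultimately show ?case by simp
qed

locale chart =
  fixes M :: "'n::finite heis set" and U :: "(real^'m::finite) set" and \<phi> :: "real^'m \<Rightarrow> 'n heis"
  assumes param: "local_param M U \<phi>"
begin

abbreviation D where "D u \<equiv> frechet_derivative \<phi> (at u)"

definition v0 :: "real^'m \<Rightarrow> 'm \<Rightarrow> 'n heis" where
  "v0 u i = D u (axis i 1)"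

lemma openU: "open U"
  using param by (simp add: local_param_def)

lemma der: "u \<in> U \<Longrightarrow> (\<phi> has_derivative D u) (at u)"
proof -
  assume u: "u \<in> U"
  have "k_smooth_on (Suc 0) U \<phi>" using param by (simp add: local_param_def smooth_on_def)
  then show ?thesis by (intro differentiable_on_openD[OF _ openU u]) simp
qed

lemma cD: "b \<in> Basis \<Longrightarrow> continuous_on U (\<lambda>u. D u b)"
proof -
  assume b: "b \<in> Basis"
  have "k_smooth_on (Suc 0) U \<phi>" using param by (simp add: local_param_def smooth_on_def)
  then show ?thesis using b by simp
qed

lemma cv0: "continuous_on U (\<lambda>u. v0 u i)"
  unfolding v0_def by (rule cD) simp

lemma cphi: "continuous_on U \<phi>"
  using der by (meson continuous_at_imp_continuous_on has_derivative_continuous)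

lemma linD: "u \<in> U \<Longrightarrow> linear (D u)"
  using der has_derivative_linear by blast

lemma injD: "u \<in> U \<Longrightarrow> inj (D u)"
  using param by (simp add: local_param_def)

definition \<psi> where "\<psi> = (SOME \<psi>. homeomorphism U (\<phi> ` U) \<phi> \<psi>)"

lemma homeo: "homeomorphism U (\<phi> ` U) \<phi> \<psi>"
proof -
  have "\<exists>\<psi>. homeomorphism U (\<phi> ` U) \<phi> \<psi>"
    using param by (simp add: local_param_def)
  then show ?thesis
    unfolding \<psi>_def by (rule someI_ex)
qed

lemma psi_phi: "u \<in> U \<Longrightarrow> \<psi> (\<phi> u) = u"
  using homeo by (simp add: homeomorphism_def)

lemma cpsi: "continuous_on (\<phi> ` U) \<psi>"
  using homeo by (simp add: homeomorphism_def)

lemma imageM: "\<phi> ` U \<subseteq> M"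
  using param by (auto simp: local_param_def)

lemma range_D_tangent:
  assumes u: "u \<in> U" shows "range (D u) \<subseteq> tangent_space M (\<phi> u)"
proof
  fix v assume "v \<in> range (D u)"
  then obtain h where h: "v = D u h" by blast
  obtain e where e: "e > 0" "ball u e \<subseteq> U"
    using openU u open_contains_ball by blast
  define \<epsilon> where "\<epsilon> = e / (norm h + 1)"
  have \<epsilon>: "\<epsilon> > 0" using e by (simp add: \<epsilon>_def add_nonneg_pos)
  have inU: "u + t *\<^sub>R h \<in> U" if "t \<in> {-\<epsilon><..<\<epsilon>}" for t
  proof -
    have "\<bar>t\<bar> * norm h \<le> \<epsilon> * norm h" using that by (intro mult_right_mono) auto
    also have "\<dots> < \<epsilon> * (norm h + 1)" using \<epsilon> by simp
    also have "\<dots> = e" by (simp add: \<epsilon>_def add_nonneg_eq_0_iff)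
    finally have "u + t *\<^sub>R h \<in> ball u e" by (simp add: dist_norm)
    then show ?thesis using e by blast
  qed
  have "smooth_on {-\<epsilon><..<\<epsilon>} (\<lambda>t. \<phi> (u + t *\<^sub>R h))"
    unfolding smooth_on_def
    by (intro allI k_smooth_on_line[OF openU _ inU]) (use param in \<open>auto simp: local_param_def smooth_on_def\<close>)
  moreover have "(\<lambda>t. \<phi> (u + t *\<^sub>R h)) ` {-\<epsilon><..<\<epsilon>} \<subseteq> M"
    using inU imageM by blast
  moreover have "((\<lambda>t. \<phi> (u + t *\<^sub>R h)) has_vector_derivative v) (at 0)"
  proof -
    have "((\<lambda>t. u + t *\<^sub>R h) has_derivative (\<lambda>s. s *\<^sub>R h)) (at 0)"
      by (auto intro!: derivative_eq_intros)
    from diff_chain_at[OF this, of \<phi> "D u"] der[OF u]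
    show ?thesis by (simp add: has_vector_derivative_def h comp_def linear_scale[OF linD[OF u]])
  qed
  ultimately show "v \<in> tangent_space M (\<phi> u)"
    unfolding tangent_space_def using \<epsilon> by (auto intro!: exI[of _ \<epsilon>] exI[of _ "\<lambda>t. \<phi> (u + t *\<^sub>R h)"])
qed

text \<open>A curve in \<open>M\<close> is not known to lift to a differentiable curve of
  parameters. Continuity of \<psi> puts the parameter \<open>w\<close> close to \<open>u\<close>,
  injectivity of \<open>D u\<close> then makes \<open>norm (w - u)\<close> of order
  \<open>t\<close>, and \<open>v\<close> turns out to be a limit of vectors in the range, which is
  closed.\<close>

lemma tangent_range_D:
  assumes u: "u \<in> U" shows "tangent_space M (\<phi> u) \<subseteq> range (D u)"
proof
  fix v assume "v \<in> tangent_space M (\<phi> u)"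
  then obtain \<epsilon> \<gamma> where \<gamma>: "\<epsilon> > 0" "\<gamma> ` {-\<epsilon><..<\<epsilon>} \<subseteq> M" "\<gamma> 0 = \<phi> u" "(\<gamma> has_vector_derivative v) (at 0)"
    unfolding tangent_space_def by blast
  obtain W where W: "open W" "\<phi> ` U = M \<inter> W" using param by (auto simp: local_param_def)
  obtain \<kappa> where \<kappa>: "\<kappa> > 0" "\<And>h. \<kappa> * norm h \<le> norm (D u h)"
    using linear_inj_bounded_below_pos[OF linD[OF u] injD[OF u]] by (metis mult.commute)
  have "v \<in> closure (range (D u))"
    unfolding closure_approachable
  proof (intro allI impI)
    fix e :: real assume e: "e > 0"
    define V where "V = norm v + 1"
    have V: "V > 0" by (simp add: V_def add_nonneg_pos)
    define e1 where "e1 = min 1 (e / 4)"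
    \<comment> \<open>The first bound lets the error of the chart be absorbed in
      \<open>\<kappa> * norm (w - u)\<close>; the second, with
      \<open>norm (w - u) \<le> 2 / \<kappa> * (t * V)\<close>, makes it at most
      \<open>e / 4 * t\<close>.\<close>
    define e2 where "e2 = min (\<kappa> / 2) (e * \<kappa> / (8 * V))"
    have e12: "e1 > 0" "e1 \<le> 1" "e1 \<le> e / 4" "e2 > 0" "e2 \<le> \<kappa> / 2" "e2 \<le> e * \<kappa> / (8 * V)"
      using e \<kappa> V by (auto simp: e1_def e2_def)
    have dg: "(\<gamma> has_derivative (\<lambda>t. t *\<^sub>R v)) (at 0)" using \<gamma>(4) by (simp add: has_vector_derivative_def)
    obtain d1 where d1: "d1 > 0" "\<And>t. norm t < d1 \<Longrightarrow> norm (\<gamma> t - \<gamma> 0 - t *\<^sub>R v) \<le> e1 * norm t"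
      using dg e12(1) unfolding has_derivative_at_alt by force
    obtain d2 where d2: "d2 > 0" "\<And>w. norm (w - u) < d2 \<Longrightarrow> norm (\<phi> w - \<phi> u - D u (w - u)) \<le> e2 * norm (w - u)"
      using der[OF u] e12(4) unfolding has_derivative_at_alt by meson
    obtain d3 where d3: "d3 > 0" "\<And>y. \<lbrakk>y \<in> \<phi> ` U; dist y (\<phi> u) < d3\<rbrakk> \<Longrightarrow> dist (\<psi> y) (\<psi> (\<phi> u)) < d2"
      using cpsi u d2(1) unfolding continuous_on_iff by blast
    obtain d4 where d4: "d4 > 0" "ball (\<phi> u) d4 \<subseteq> W"
      using W u open_contains_ball by blast
    define t where "t = min (min (\<epsilon> / 2) (d1 / 2)) (min d3 d4 / (2 * V))"
    have t: "t > 0" "t < \<epsilon>" "t < d1" "t * V < d3" "t * V < d4"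
    proof -
      show "t > 0" using \<gamma>(1) d1 d3 d4 V by (simp add: t_def)
      show "t < \<epsilon>" "t < d1" using \<gamma>(1) d1(1) by (auto simp: t_def min_def)
      have "t * V \<le> min d3 d4 / (2 * V) * V" using V by (intro mult_right_mono) (auto simp: t_def)
      also have "\<dots> = min d3 d4 / 2" using V by simp
      finally have "t * V \<le> min d3 d4 / 2" .
      then show "t * V < d3" "t * V < d4" using d3(1) d4(1) by (auto simp: min_def split: if_splits)
    qed
    have g1: "norm (\<gamma> t - \<gamma> 0 - t *\<^sub>R v) \<le> e1 * t" using d1(2)[of t] t by simp
    have g2: "norm (\<gamma> t - \<phi> u) \<le> t * V"
    proof -
      have "norm (\<gamma> t - \<gamma> 0) \<le> norm (\<gamma> t - \<gamma> 0 - t *\<^sub>R v) + norm (t *\<^sub>R v)"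
        using norm_triangle_ineq[of "\<gamma> t - \<gamma> 0 - t *\<^sub>R v" "t *\<^sub>R v"] by simp
      also have "\<dots> \<le> e1 * t + t * norm v" using g1 t by simp
      also have "\<dots> \<le> 1 * t + t * norm v" using e12 t by (intro add_right_mono mult_right_mono) auto
      finally show ?thesis by (simp add: \<gamma>(3) V_def algebra_simps)
    qed
    have "\<gamma> t \<in> M" using \<gamma>(2) t by force
    moreover have "\<gamma> t \<in> W" using d4(2) g2 t by (auto simp: dist_norm norm_minus_commute)
    ultimately have gU: "\<gamma> t \<in> \<phi> ` U" using W by blast
    then obtain w where w: "w \<in> U" "\<gamma> t = \<phi> w" by blast
    have "dist (\<psi> (\<gamma> t)) (\<psi> (\<phi> u)) < d2"
      using d3(2)[OF gU] g2 t by (simp add: dist_norm)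
    then have wu: "norm (w - u) < d2" using w u by (simp add: psi_phi dist_norm)
    have f1: "norm (\<phi> w - \<phi> u - D u (w - u)) \<le> e2 * norm (w - u)" by (rule d2(2)[OF wu])
    have f2: "norm (w - u) \<le> 2 / \<kappa> * (t * V)"
    proof -
      have "\<kappa> * norm (w - u) \<le> norm (D u (w - u))" by (rule \<kappa>(2))
      also have "\<dots> \<le> norm (\<phi> w - \<phi> u) + norm (\<phi> w - \<phi> u - D u (w - u))"
        using norm_triangle_ineq4[of "\<phi> w - \<phi> u" "\<phi> w - \<phi> u - D u (w - u)"] by simp
      also have "\<dots> \<le> t * V + \<kappa> / 2 * norm (w - u)"
        using g2 w f1 e12(5) mult_right_mono[OF e12(5) norm_ge_zero[of "w - u"]] by simp
      finally have "\<kappa> / 2 * norm (w - u) \<le> t * V" by simp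
      then show ?thesis using \<kappa> by (simp add: field_simps)
    qed
    have f3: "norm (\<phi> w - \<phi> u - D u (w - u)) \<le> e / 4 * t"
    proof -
      have "e2 * norm (w - u) \<le> e * \<kappa> / (8 * V) * (2 / \<kappa> * (t * V))"
        using e12 f2 e \<kappa> V t by (intro mult_mono) auto
      also have "\<dots> = e / 4 * t" using \<kappa> V by (simp add: field_simps)
      finally show ?thesis using f1 by linarith
    qed
    have "norm (D u (w - u) - t *\<^sub>R v) \<le> norm (\<gamma> t - \<gamma> 0 - t *\<^sub>R v) + norm (\<phi> w - \<phi> u - D u (w - u))"
    proof -
      have "D u (w - u) - t *\<^sub>R v = (\<gamma> t - \<gamma> 0 - t *\<^sub>R v) - (\<phi> w - \<phi> u - D u (w - u))"
        by (simp add: w \<gamma>(3))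
      then show ?thesis by (metis norm_triangle_ineq4)
    qed
    also have "\<dots> \<le> e / 4 * t + e / 4 * t"
      using g1 f3 mult_right_mono[OF e12(3), of t] t by linarith
    finally have *: "norm (D u (w - u) - t *\<^sub>R v) \<le> e / 2 * t" by simp
    have "D u ((1 / t) *\<^sub>R (w - u)) - v = (1 / t) *\<^sub>R (D u (w - u) - t *\<^sub>R v)"
      unfolding linear_scale[OF linD[OF u], of "1 / t" "w - u"] scaleR_diff_right[of "1 / t" "D u (w - u)"]
      using t by simp
    then have "norm (D u ((1 / t) *\<^sub>R (w - u)) - v) = norm (D u (w - u) - t *\<^sub>R v) / t"
      using t by simp
    also have "\<dots> \<le> e / 2" using * t by (simp add: field_simps)
    finally have "dist (D u ((1 / t) *\<^sub>R (w - u))) v < e" using e by (simp add: dist_norm)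
    then show "\<exists>y\<in>range (D u). dist y v < e" by blast
  qed
  moreover have "closed (range (D u))"
    by (rule closed_subspace[OF linear_subspace_image[OF linD[OF u] subspace_UNIV]])
  ultimately show "v \<in> range (D u)" by simp
qed

lemma tangent_space_eq: "u \<in> U \<Longrightarrow> tangent_space M (\<phi> u) = range (D u)"
  using range_D_tangent tangent_range_D by blast

text \<open>The density of \<mu> in the chart with respect to Lebesgue measure:
  \<open>sqrt (det (gram \<phi> u))\<close> times the norm of the top-degree part of the unit
  tangent multivector, by \<open>unit_tangent_degree\<close>.\<close>

definition J where "J u = vertical_part (v0 u) (\<phi> u)"

lemma continuous_cof_v0: "continuous_on U (\<lambda>u. cof (\<phi> u) (v0 u i))"
  unfolding cof_def
  by (intro continuous_intros bounded_bilinear.continuous_on[OF bounded_bilinear_om] cv0 cphi) auto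

lemma continuous_J: "continuous_on U J"
proof -
  have "continuous_on U (\<lambda>u. det (minor (\<lambda>i. cof (\<phi> u) (v0 u i)) K))" for K
    by (rule continuous_on_det_entries)
      (simp add: minor_def continuous_on_component[OF continuous_cof_v0])
  then show ?thesis
    unfolding J_def vertical_part_minors by (intro continuous_intros)
qed

lemma mvec_norm_v0: "mvec_norm (wedge (\<phi> u) (v0 u)) = sqrt (det (gram \<phi> u))"
  by (simp add: mvec_norm_wedge gram_def v0_def)

lemma continuous_gram: "continuous_on U (\<lambda>u. sqrt (det (gram \<phi> u)))"
proof -
  have "continuous_on U (\<lambda>u. det (gram \<phi> u))"
    by (rule continuous_on_det_entries)
      (simp add: gram_def v0_def[symmetric] hmetric_cof continuous_on_inner[OF continuous_cof_v0 continuous_cof_v0])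
  then show ?thesis
    by (rule continuous_on_real_sqrt)
qed

end

section \<open>The area formula in a chart\<close>

lemma mvec_norm_scale: "mvec_norm (\<lambda>K. c * \<xi> K) = \<bar>c\<bar> * mvec_norm \<xi>"
  by (simp add: mvec_norm_def power_mult_distrib sum_distrib_left[symmetric] real_sqrt_mult)

lemma degree_part_scale: "degree_part d (\<lambda>K. c * \<xi> K) = (\<lambda>K. c * degree_part d \<xi> K)"
  by (auto simp: degree_part_def)

lemma degree_part_le: "mvec_norm (degree_part d \<xi>) \<le> mvec_norm \<xi>"
  unfolding mvec_norm_def by (intro real_sqrt_le_mono sum_mono) (auto simp: degree_part_def)

locale nonhorizontal_chart = chart M U \<phi>
  for M :: "'n::finite heis set" and U :: "(real^'m::finite) set" and \<phi> :: "real^'m \<Rightarrow> 'n heis" +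
  assumes nonhor: "non_horizontal M"
begin

lemma nh: assumes u: "u \<in> U" shows "\<exists>h. cof (\<phi> u) (D u h) $ iT \<noteq> 0"
proof -
  have "\<phi> u \<in> M" using imageM u by blast
  then have "(eT :: 'n heis) \<in> {v + w |v w. v \<in> tangent_space M (\<phi> u) \<and> w \<in> horizontal (\<phi> u)}"
    using nonhor unfolding non_horizontal_def by blast
  then obtain v w where vw: "eT = v + w" "v \<in> tangent_space M (\<phi> u)" "w \<in> horizontal (\<phi> u)"
    by blast
  then obtain h where h: "v = D u h" using tangent_space_eq[OF u] by blast
  have "cof (\<phi> u) eT $ iT = cof (\<phi> u) v $ iT + cof (\<phi> u) w $ iT"
    by (simp add: vw(1) linear_add[OF linear_cof])
  moreover have "cof (\<phi> u) (eT :: 'n heis) $ iT = 1" by (simp add: cof_T)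
  moreover have "cof (\<phi> u) w $ iT = 0" using vw(3) by (simp add: horizontal_iff)
  ultimately show ?thesis using h by (intro exI[of _ h]) simp
qed

lemma local_formula:
  fixes i0 :: 'm
  assumes u: "u \<in> U" and e: "0 < e" "e < 1"
  defines "S \<equiv> spherical_hausdorff cc_dist (CARD('m) + 1)"
  shows "0 < J u \<and> 0 < metric_factor i0 TYPE('n) \<and> (\<exists>s>0. ball u s \<subseteq> U \<and> (\<forall>A\<in>sets borel. A \<subseteq> ball u s \<longrightarrow>
    ennreal (J u) * emeasure lborel A \<le> ennreal ((1 + e) * metric_factor i0 TYPE('n)) * S (\<phi> ` A) \<and>
    ennreal ((1 - e) * metric_factor i0 TYPE('n)) * S (\<phi> ` A) \<le> ennreal (J u) * emeasure lborel A))"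
proof -
  obtain h where h: "cof (\<phi> u) (D u h) $ iT \<noteq> 0" using nh[OF u] by blast
  have "v0 u = (\<lambda>i. D u (axis i 1))" by (simp add: v0_def fun_eq_iff)
  then show ?thesis
    unfolding S_def J_def using local_area_formula[OF openU u der cD injD[OF u] h e] by simp
qed

lemma J_pos: "u \<in> U \<Longrightarrow> J u > 0"
  using local_formula[of u "1/2"] by simp

lemma gram_pos: "u \<in> U \<Longrightarrow> sqrt (det (gram \<phi> u)) > 0"
  using degree_part_le[of "CARD('m) + 1" "wedge (\<phi> u) (v0 u)"] J_pos[of u]
  unfolding J_def vertical_part_def mvec_norm_v0 by linarith

text \<open>Wedges of tangent vectors are all multiples of the wedge of the coordinate vectors, and
  unit norm fixes the factor up to sign. Rescaling a single coordinate vector shows that the choice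
  in \<open>unit_tangent\<close> is not vacuous.\<close>

lemma unit_tangent_degree:
  assumes u: "u \<in> U"
  shows "mvec_norm (degree_part (CARD('m) + 1) (unit_tangent TYPE('m) M (\<phi> u))) = J u / sqrt (det (gram \<phi> u))"
proof -
  let ?g = "sqrt (det (gram \<phi> u))" and ?x = "\<phi> u"
  let ?P = "\<lambda>\<xi>. mvec_norm \<xi> = 1 \<and> (\<exists>v :: 'm \<Rightarrow> 'n heis. (\<forall>i. v i \<in> tangent_space M ?x) \<and> \<xi> = wedge ?x v)"
  have g: "?g > 0" by (rule gram_pos[OF u])
  have "\<exists>\<xi>. ?P \<xi>"
  proof -
    obtain i0 :: 'm where True by simp
    define w :: "real^'m^'m" where "w = (\<chi> i j. if i = j then (if i = i0 then 1 / ?g else 1) else 0)"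
    have "det w = (\<Prod>i\<in>UNIV. w $ i $ i)" by (rule det_diagonal) (simp add: w_def)
    also have "\<dots> = 1 / ?g" by (simp add: w_def)
    finally have dw: "det w = 1 / ?g" .
    define v where "v i = (\<Sum>j\<in>UNIV. (w $ i $ j) *\<^sub>R v0 u j)" for i
    have "v i = D u (\<Sum>j\<in>UNIV. (w $ i $ j) *\<^sub>R axis j 1)" for i
      by (simp add: v_def v0_def linear_sum[OF linD[OF u]] linear_scale[OF linD[OF u]])
    then have "v i \<in> tangent_space M ?x" for i
      using tangent_space_eq[OF u] by auto
    moreover have "mvec_norm (wedge ?x v) = 1"
      unfolding v_def wedge_linear_comb mvec_norm_scale mvec_norm_v0 dw using g by simp
    ultimately show ?thesis by blast
  qed
  then have "?P (unit_tangent TYPE('m) M ?x)"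
    unfolding unit_tangent_def by (rule someI_ex)
  then obtain v :: "'m \<Rightarrow> 'n heis" where v12: "\<forall>i. v i \<in> tangent_space M ?x"
    "unit_tangent TYPE('m) M ?x = wedge ?x v" and n1: "mvec_norm (unit_tangent TYPE('m) M ?x) = 1"
    by blast
  then have v: "\<And>i. v i \<in> tangent_space M ?x" "unit_tangent TYPE('m) M ?x = wedge ?x v"
    "mvec_norm (wedge ?x v) = 1" by simp_all
  have "\<forall>i. \<exists>h. v i = D u h" using v(1) tangent_space_eq[OF u] by auto
  then obtain h where h: "\<And>i. v i = D u (h i)" by metis
  define w :: "real^'m^'m" where "w = (\<chi> i. h i)"
  have "v = (\<lambda>i. \<Sum>j\<in>UNIV. (w $ i $ j) *\<^sub>R v0 u j)"
  proof
    fix i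
    have "v i = D u (\<Sum>j\<in>UNIV. (h i $ j) *\<^sub>R axis j 1)" by (simp add: h vec_expansion)
    then show "v i = (\<Sum>j\<in>UNIV. (w $ i $ j) *\<^sub>R v0 u j)"
      by (simp add: w_def v0_def linear_sum[OF linD[OF u]] linear_scale[OF linD[OF u]])
  qed
  then have vw: "wedge ?x v = (\<lambda>K. det w * wedge ?x (v0 u) K)"
    using wedge_linear_comb[of ?x w "v0 u"] by simp
  have "\<bar>det w\<bar> * ?g = 1"
    using v(3) by (simp add: vw mvec_norm_scale mvec_norm_v0)
  then have "\<bar>det w\<bar> = 1 / ?g" using g by (simp add: field_simps)
  then show ?thesis
    unfolding v(2) vw degree_part_scale mvec_norm_scale by (simp add: J_def vertical_part_def)
qed

text \<open>An open set is a countable union of closed balls, which are compact and have compact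
  images.\<close>

lemma borel_image: "\<phi> ` U \<in> sets borel"
proof -
  define B where "B = {ball x r |x r. 0 < r \<and> cball x r \<subseteq> U}"
  obtain F where F: "F \<subseteq> B" "countable F" "\<Union>F = \<Union>B"
    using Lindelof[of B] by (auto simp: B_def)
  have cl: "compact (closure b)" "closure b \<subseteq> U" if "b \<in> B" for b
    using that by (auto simp: B_def)
  have "U = (\<Union>b\<in>F. closure b)"
  proof
    show "U \<subseteq> (\<Union>b\<in>F. closure b)"
    proof
      fix x assume "x \<in> U"
      then obtain r where "r > 0" "cball x r \<subseteq> U" using openU open_contains_cball by blast
      then have "x \<in> \<Union>B" by (auto simp: B_def intro!: exI[of _ "ball x r"])
      then show "x \<in> (\<Union>b\<in>F. closure b)" using F(3) closure_subset by blast
    qed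
    show "(\<Union>b\<in>F. closure b) \<subseteq> U" using cl(2) F(1) by blast
  qed
  then have eq: "\<phi> ` U = (\<Union>b\<in>F. \<phi> ` closure b)" by blast
  have "\<phi> ` closure b \<in> sets borel" if "b \<in> F" for b
  proof -
    have "b \<in> B" using that F(1) by blast
    then have "compact (\<phi> ` closure b)"
      using cl by (intro compact_continuous_image continuous_on_subset[OF cphi])
    then show ?thesis by (rule borel_compact)
  qed
  then show ?thesis
    unfolding eq using F(2) by (intro sets.countable_UN') auto
qed

lemma borel_image_sub:
  assumes "B \<in> sets borel" "B \<subseteq> U" shows "\<phi> ` B \<in> sets borel"
proof -
  have "\<psi> \<in> borel_measurable (restrict_space borel (\<phi> ` U))"
    by (rule borel_measurable_continuous_on_restrict[OF cpsi])
  then have "\<psi> -` B \<inter> space (restrict_space borel (\<phi> ` U)) \<in> sets (restrict_space borel (\<phi> ` U))"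
    using assms(1) by (rule measurable_sets)
  then have "\<psi> -` B \<inter> \<phi> ` U \<in> sets borel"
    using borel_image by (simp add: space_restrict_space sets_restrict_space_iff)
  moreover have "\<phi> ` B = \<psi> -` B \<inter> \<phi> ` U"
    using assms(2) psi_phi by (auto simp: image_iff)
  ultimately show ?thesis by simp
qed

lemma borel_preimage:
  assumes "A \<in> sets borel" shows "{u \<in> U. \<phi> u \<in> A} \<in> sets borel"
proof -
  have "\<phi> \<in> borel_measurable (restrict_space borel U)"
    by (rule borel_measurable_continuous_on_restrict[OF cphi])
  then have "\<phi> -` A \<inter> space (restrict_space borel U) \<in> sets (restrict_space borel U)"
    using assms by (rule measurable_sets)
  then have "\<phi> -` A \<inter> U \<in> sets borel"
    using openU by (simp add: space_restrict_space sets_restrict_space_iff)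
  moreover have "\<phi> -` A \<inter> U = {u \<in> U. \<phi> u \<in> A}" by auto
  ultimately show ?thesis by simp
qed

lemma measurable_J: "(\<lambda>u. ennreal (J u) * indicator U u) \<in> borel_measurable borel"
proof -
  have "(\<lambda>u. indicator U u *\<^sub>R J u) \<in> borel_measurable borel"
    by (rule borel_measurable_continuous_on_indicator[OF _ continuous_J]) (use openU in auto)
  then have "(\<lambda>u. ennreal (indicator U u *\<^sub>R J u)) \<in> borel_measurable borel" by measurable
  moreover have "(\<lambda>u. ennreal (indicator U u *\<^sub>R J u)) = (\<lambda>u. ennreal (J u) * indicator U u)"
    by (auto simp: indicator_def)
  ultimately show ?thesis by simp
qed

text \<open>The measure \<mu> pulled back to the chart, extended by 0 to the whole parameter
  space.\<close>

definition N where "N = density lborel (\<lambda>u. ennreal (J u) * indicator U u)"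

lemma emeasure_N: "B \<in> sets borel \<Longrightarrow> emeasure N B = (\<integral>\<^sup>+u. (ennreal (J u) * indicator U u) * indicator B u \<partial>lborel)"
  unfolding N_def by (rule emeasure_density) (use measurable_J in auto)

text \<open>One factor \<open>1 + e\<close> or \<open>1 - e\<close> is from
  \<open>local_formula\<close>, the other from the variation of \<open>J\<close> on a small ball.
  Countably many such balls are made disjoint and the estimates summed; this uses that
  \<open>S\<close> is additive on Borel sets.\<close>

lemma area_formula_eps:
  fixes i0 :: 'm
  assumes B: "B \<in> sets borel" "B \<subseteq> U" and e: "0 < e" "e < 1"
  defines "S \<equiv> spherical_hausdorff cc_dist (CARD('m) + 1)" and "\<beta> \<equiv> metric_factor i0 TYPE('n)"
  shows "emeasure N B \<le> ennreal ((1 + e)\<^sup>2 * \<beta>) * S (\<phi> ` B)" "ennreal ((1 - e)\<^sup>2 * \<beta>) * S (\<phi> ` B) \<le> emeasure N B"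
proof -
  define good where "good b \<longleftrightarrow> open b \<and> b \<subseteq> U \<and> (\<forall>A\<in>sets borel. A \<subseteq> b \<longrightarrow>
      emeasure N A \<le> ennreal ((1 + e)\<^sup>2 * \<beta>) * S (\<phi> ` A) \<and> ennreal ((1 - e)\<^sup>2 * \<beta>) * S (\<phi> ` A) \<le> emeasure N A)" for b
  have ex: "\<exists>b. good b \<and> u \<in> b" if u: "u \<in> U" for u
  proof -
    have Ju: "J u > 0" and \<beta>: "\<beta> > 0" using local_formula[OF u e, of i0] by (auto simp: \<beta>_def)
    obtain s where s: "s > 0" "ball u s \<subseteq> U" and loc: "\<And>A. \<lbrakk>A \<in> sets borel; A \<subseteq> ball u s\<rbrakk> \<Longrightarrow>
      ennreal (J u) * emeasure lborel A \<le> ennreal ((1 + e) * \<beta>) * S (\<phi> ` A) \<and>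
      ennreal ((1 - e) * \<beta>) * S (\<phi> ` A) \<le> ennreal (J u) * emeasure lborel A"
      using local_formula[OF u e, of i0] unfolding S_def \<beta>_def by blast
    obtain s' where s': "s' > 0" "\<And>w. \<lbrakk>w \<in> U; dist w u < s'\<rbrakk> \<Longrightarrow> dist (J w) (J u) < e * J u"
      using continuous_J u e Ju unfolding continuous_on_iff by (metis mult_pos_pos)
    define b where "b = ball u s \<inter> ball u s'"
    have Jb: "(1 - e) * J u \<le> J w" "J w \<le> (1 + e) * J u" if "w \<in> b" for w
    proof -
      have "dist (J w) (J u) < e * J u" using that s by (intro s'(2)) (auto simp: b_def dist_commute)
      then show "(1 - e) * J u \<le> J w" "J w \<le> (1 + e) * J u" by (auto simp: dist_real_def algebra_simps)
    qed
    have "good b"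
      unfolding good_def
    proof (intro conjI ballI impI)
      show "open b" "b \<subseteq> U" using s by (auto simp: b_def)
      fix A assume A: "A \<in> sets borel" "A \<subseteq> b"
      then have As: "A \<subseteq> ball u s" "A \<subseteq> U" using s by (auto simp: b_def)
      have c: "(\<integral>\<^sup>+w. ennreal k * indicator A w \<partial>lborel) = ennreal k * emeasure lborel A" for k
        using A by (simp add: nn_integral_cmult_indicator)
      have "emeasure N A \<le> (\<integral>\<^sup>+w. ennreal ((1 + e) * J u) * indicator A w \<partial>lborel)"
        unfolding emeasure_N[OF A(1)]
        by (intro nn_integral_mono) (use Jb A As in \<open>auto simp: indicator_def intro!: ennreal_leI\<close>)
      also have "\<dots> = ennreal (1 + e) * (ennreal (J u) * emeasure lborel A)"
        unfolding c using e Ju by (simp add: ennreal_mult' mult.assoc del: ennreal_plus)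
      also have "\<dots> \<le> ennreal (1 + e) * (ennreal ((1 + e) * \<beta>) * S (\<phi> ` A))"
        using loc[OF A(1) As(1)] by (intro mult_left_mono) auto
      also have "\<dots> = ennreal ((1 + e)\<^sup>2 * \<beta>) * S (\<phi> ` A)"
        using e \<beta> by (simp add: mult.assoc[symmetric] ennreal_mult'[symmetric] power2_eq_square del: ennreal_plus)
      finally show "emeasure N A \<le> ennreal ((1 + e)\<^sup>2 * \<beta>) * S (\<phi> ` A)" .
      have "ennreal ((1 - e)\<^sup>2 * \<beta>) * S (\<phi> ` A) = ennreal (1 - e) * (ennreal ((1 - e) * \<beta>) * S (\<phi> ` A))"
        using e \<beta> by (simp add: mult.assoc[symmetric] ennreal_mult'[symmetric] power2_eq_square del: ennreal_plus)
      also have "\<dots> \<le> ennreal (1 - e) * (ennreal (J u) * emeasure lborel A)"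
        using loc[OF A(1) As(1)] by (intro mult_left_mono) auto
      also have "\<dots> = (\<integral>\<^sup>+w. ennreal ((1 - e) * J u) * indicator A w \<partial>lborel)"
        unfolding c using e Ju by (simp add: ennreal_mult' mult.assoc del: ennreal_plus)
      also have "\<dots> \<le> emeasure N A"
        unfolding emeasure_N[OF A(1)]
        by (intro nn_integral_mono) (use Jb A As in \<open>auto simp: indicator_def intro!: ennreal_leI\<close>)
      finally show "ennreal ((1 - e)\<^sup>2 * \<beta>) * S (\<phi> ` A) \<le> emeasure N A" .
    qed
    moreover have "u \<in> b" using s s' by (simp add: b_def)
    ultimately show ?thesis by blast
  qed
  obtain \<F> where \<F>: "\<F> \<subseteq> Collect good" "countable \<F>" "\<Union>\<F> = \<Union>(Collect good)"
    using Lindelof[of "Collect good"] by (auto simp: good_def)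
  \<comment> \<open>The empty set is included so that the enumeration by
    \<open>from_nat_into\<close> makes sense for a family that may be empty.\<close>
  define G where "G = insert {} \<F>"
  have G: "countable G" "G \<noteq> {}" "U \<subseteq> \<Union>G" "G \<subseteq> Collect good"
    using \<F> ex by (auto simp: G_def good_def S_def cc_dist_hdist intro: distance.sh_empty[OF hdist_distance[where 'n = 'n]])
  define b where "b = from_nat_into G"
  have b: "good (b n)" for n
    using from_nat_into[OF G(2)] G(4) unfolding b_def by blast
  have bU: "U \<subseteq> (\<Union>n. b n)" using G range_from_nat_into[OF G(2,1)] by (simp add: b_def)
  have bm: "disjointed b n \<in> sets borel" for n
  proof -
    have "range b \<subseteq> sets borel" using b by (auto simp: good_def)
    from sets.range_disjointed_sets[OF this] show ?thesis by auto
  qed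
  define C where "C n = B \<inter> disjointed b n" for n
  have C: "C n \<in> sets borel" "C n \<subseteq> b n" "C n \<subseteq> U" for n
    using bm B disjointed_subset[of b n] by (auto simp: C_def)
  have BC: "B = (\<Union>n. C n)" using B(2) bU by (auto simp: C_def UN_disjointed_eq[of b, symmetric] simp del: UN_disjointed_eq)
  have dC: "disjoint_family C"
    using disjoint_family_disjointed[of b] by (auto simp: C_def disjoint_family_on_def)
  have NB: "emeasure N B = (\<Sum>n. emeasure N (C n))"
    unfolding BC by (rule suminf_emeasure[symmetric]) (use C dC in \<open>auto simp: N_def\<close>)
  have inj: "inj_on \<phi> U" using psi_phi by (metis inj_onI)
  have SB: "S (\<phi> ` B) = (\<Sum>n. S (\<phi> ` C n))"
  proof -
    have em: "S X = emeasure (hausdorff_measure (CARD('m) + 1)) X" if "X \<in> sets borel" for X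
      unfolding S_def using emeasure_hausdorff_measure[OF _ that] by simp
    have dphi: "disjoint_family (\<lambda>n. \<phi> ` C n)"
      using dC C(3) inj unfolding disjoint_family_on_def
      by (metis image_empty inj_on_image_Int)
    have "S (\<phi> ` B) = emeasure (hausdorff_measure (CARD('m) + 1)) (\<Union>n. \<phi> ` C n)"
      using em[OF borel_image_sub[OF B]] by (simp add: BC image_UN)
    also have "\<dots> = (\<Sum>n. emeasure (hausdorff_measure (CARD('m) + 1)) (\<phi> ` C n))"
      by (rule suminf_emeasure[symmetric, OF _ dphi]) (use borel_image_sub C in auto)
    also have "\<dots> = (\<Sum>n. S (\<phi> ` C n))"
      using em borel_image_sub C by simp
    finally show ?thesis .
  qed
  have n1: "emeasure N (C n) \<le> ennreal ((1 + e)\<^sup>2 * \<beta>) * S (\<phi> ` C n)"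
    and n2: "ennreal ((1 - e)\<^sup>2 * \<beta>) * S (\<phi> ` C n) \<le> emeasure N (C n)" for n
    using b[of n] C[of n] unfolding good_def by blast+
  have "emeasure N B \<le> (\<Sum>n. ennreal ((1 + e)\<^sup>2 * \<beta>) * S (\<phi> ` C n))"
    unfolding NB by (rule suminf_le[OF n1]) auto
  then show "emeasure N B \<le> ennreal ((1 + e)\<^sup>2 * \<beta>) * S (\<phi> ` B)"
    by (simp add: SB)
  have "(\<Sum>n. ennreal ((1 - e)\<^sup>2 * \<beta>) * S (\<phi> ` C n)) \<le> emeasure N B"
    unfolding NB by (rule suminf_le[OF n2]) auto
  then show "ennreal ((1 - e)\<^sup>2 * \<beta>) * S (\<phi> ` B) \<le> emeasure N B"
    by (simp add: SB)
qed

lemma area_formula: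
  fixes i0 :: 'm
  assumes A: "A \<in> sets borel" "A \<subseteq> \<phi> ` U"
  shows "emeasure N {u \<in> U. \<phi> u \<in> A} = ennreal (metric_factor i0 TYPE('n)) * spherical_hausdorff cc_dist (CARD('m) + 1) A"
proof (cases "U = {}")
  case True
  then show ?thesis
    using A distance.sh_empty[OF hdist_distance[where 'n = 'n, of "CARD('m) + 1"]] by (simp add: cc_dist_hdist)
next
  case False
  then have \<beta>: "metric_factor i0 TYPE('n) > 0" using local_formula[of _ "1/2" i0] by fastforce
  define B where "B = {u \<in> U. \<phi> u \<in> A}"
  have B: "B \<in> sets borel" "B \<subseteq> U" "\<phi> ` B = A"
    using borel_preimage[OF A(1)] A(2) by (auto simp: B_def)
  let ?X = "spherical_hausdorff cc_dist (CARD('m) + 1) A" and ?\<beta> = "metric_factor i0 TYPE('n)"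
  \<comment> \<open>\<open>?X\<close> may be infinite; positivity of \<open>?\<beta>\<close>
    excludes the product of 0 and \<open>top\<close> in the limit.\<close>
  have lim: "((\<lambda>e. ennreal (f e * ?\<beta>) * ?X) \<longlongrightarrow> ennreal ?\<beta> * ?X) (at_right 0)"
    if "(f \<longlongrightarrow> 1) (at_right 0)" for f :: "real \<Rightarrow> real"
  proof -
    have "((\<lambda>e. f e * ?\<beta>) \<longlongrightarrow> 1 * ?\<beta>) (at_right 0)" by (intro tendsto_intros that)
    then have "((\<lambda>e. ennreal (f e * ?\<beta>)) \<longlongrightarrow> ennreal ?\<beta>) (at_right 0)"
      by (intro tendsto_ennrealI) simp
    then show ?thesis
      by (rule tendsto_mult_ennreal[OF _ tendsto_const]) (use \<beta> in auto)
  qed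
  have ev: "\<forall>\<^sub>F e in at_right (0::real). e \<in> {0<..<1}"
    by (rule eventually_at_right_real) simp
  have l1: "((\<lambda>e::real. (1 + e)\<^sup>2) \<longlongrightarrow> 1) (at_right 0)" and l2: "((\<lambda>e::real. (1 - e)\<^sup>2) \<longlongrightarrow> 1) (at_right 0)"
    by (auto intro!: tendsto_eq_intros)
  have "emeasure N B \<le> ennreal ?\<beta> * ?X"
    using area_formula_eps(1)[OF B(1,2), of _ i0] B(3)
    by (intro tendsto_lowerbound[OF lim[OF l1]] eventually_mono[OF ev]) auto
  moreover have "ennreal ?\<beta> * ?X \<le> emeasure N B"
    using area_formula_eps(2)[OF B(1,2), of _ i0] B(3)
    by (intro tendsto_upperbound[OF lim[OF l2]] eventually_mono[OF ev]) auto
  ultimately show ?thesis unfolding B_def by (rule antisym)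
qed

end

section \<open>The Riemannian volume and the spherical Hausdorff measure\<close>

lemma (in chart) chart_open: "\<exists>W. open W \<and> \<phi> ` U = M \<inter> W"
  using param by (simp add: local_param_def)

lemma submanifold_chart_cover:
  fixes M :: "'n::finite heis set"
  assumes M: "submanifold TYPE('m::finite) M"
  obtains \<C> where "countable \<C>" "\<Union>\<C> = M"
    "\<And>C. C \<in> \<C> \<Longrightarrow> \<exists>U (\<phi> :: real^'m \<Rightarrow> 'n heis). local_param M U \<phi> \<and> C = \<phi> ` U"
proof -
  define \<F> where "\<F> = {C. \<exists>U (\<phi> :: real^'m \<Rightarrow> 'n heis). local_param M U \<phi> \<and> C = \<phi> ` U}"
  have op: "openin (top_of_set M) C" if C: "C \<in> \<F>" for C
  proof -
    obtain U and \<phi> :: "real^'m \<Rightarrow> 'n heis" where "local_param M U \<phi>" "C = \<phi> ` U"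
      using C by (auto simp: \<F>_def)
    then show ?thesis
      using chart.chart_open[OF chart.intro] by (auto simp: openin_open)
  qed
  obtain \<C> where \<C>: "\<C> \<subseteq> \<F>" "countable \<C>" "\<Union>\<C> = \<Union>\<F>"
    using Lindelof_openin[OF op] by blast
  have FM: "\<Union>\<F> = M"
  proof
    show "\<Union>\<F> \<subseteq> M" using chart.imageM[OF chart.intro] unfolding \<F>_def by blast
    show "M \<subseteq> \<Union>\<F>" using M unfolding submanifold_def \<F>_def by blast
  qed
  show thesis
  proof (rule that[OF \<C>(2)])
    show "\<Union>\<C> = M" using \<C>(3) FM by simp
    show "\<exists>U (\<phi> :: real^'m \<Rightarrow> 'n heis). local_param M U \<phi> \<and> C = \<phi> ` U" if "C \<in> \<C>" for C
      using that \<C>(1) unfolding \<F>_def by blast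
  qed
qed

lemma measure_eqI_countable_cover:
  assumes sets: "sets N1 = sets N2" and cov: "countable \<C>" "\<C> \<subseteq> sets N1" "\<Union>\<C> = space N1"
    and eq: "\<And>C A. \<lbrakk>C \<in> \<C>; A \<in> sets N1; A \<subseteq> C\<rbrakk> \<Longrightarrow> emeasure N1 A = emeasure N2 A"
  shows "N1 = N2"
proof (rule measure_eqI[OF sets])
  fix A assume A: "A \<in> sets N1"
  define b where "b = from_nat_into (insert {} \<C>)"
  have b: "b n \<in> insert {} \<C>" for n
    unfolding b_def by (rule from_nat_into) simp
  have bm: "range b \<subseteq> sets N1"
  proof (rule image_subsetI)
    show "b n \<in> sets N1" for n using b[of n] cov(2) by auto
  qed
  have bU: "(\<Union>n. b n) = space N1"
    using range_from_nat_into[of "insert {} \<C>"] cov by (simp add: b_def)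
  define D where "D n = A \<inter> disjointed b n" for n
  have D: "D n \<in> sets N1" for n
    using A sets.range_disjointed_sets[OF bm] by (auto simp: D_def)
  have AD: "A = (\<Union>n. D n)"
  proof -
    have "(\<Union>n. disjointed b n) = space N1" using UN_disjointed_eq[of b] bU by simp
    then show ?thesis using sets.sets_into_space[OF A] unfolding D_def by blast
  qed
  have dD: "disjoint_family D"
    using disjoint_family_disjointed[of b] by (auto simp: D_def disjoint_family_on_def)
  have e: "emeasure N1 (D n) = emeasure N2 (D n)" for n
  proof (cases "b n = {}")
    case True
    then show ?thesis using disjointed_subset[of b n] by (simp add: D_def)
  next
    case False
    then have "b n \<in> \<C>" using b[of n] by simp
    then show ?thesis
      using eq[OF _ D] disjointed_subset[of b n] by (auto simp: D_def)
  qed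
  have "emeasure N1 A = (\<Sum>n. emeasure N1 (D n))"
    unfolding AD by (rule suminf_emeasure[symmetric]) (use D dD in auto)
  also have "\<dots> = (\<Sum>n. emeasure N2 (D n))" by (simp add: e)
  also have "\<dots> = emeasure N2 A"
    unfolding AD by (rule suminf_emeasure) (use D dD sets in auto)
  finally show "emeasure N1 A = emeasure N2 A" .
qed

definition vfactor :: "'m::finite itself \<Rightarrow> 'n::finite heis set \<Rightarrow> 'n heis \<Rightarrow> real" where
  "vfactor m M x = mvec_norm (degree_part (CARD('m) + 1) (unit_tangent m M x))"

context nonhorizontal_chart
begin

lemma vfactor_phi: "u \<in> U \<Longrightarrow> vfactor TYPE('m) M (\<phi> u) = J u / sqrt (det (gram \<phi> u))"
  unfolding vfactor_def by (rule unit_tangent_degree)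

lemma vfactor_pos: "u \<in> U \<Longrightarrow> vfactor TYPE('m) M (\<phi> u) > 0"
  using J_pos gram_pos by (simp add: vfactor_phi)

lemma continuous_vfactor: "continuous_on (\<phi> ` U) (vfactor TYPE('m) M)"
proof -
  have "continuous_on U (\<lambda>u. J u / sqrt (det (gram \<phi> u)))"
    by (intro continuous_on_divide continuous_J continuous_gram) (use gram_pos in force)
  then have "continuous_on (\<phi> ` U) (\<lambda>x. J (\<psi> x) / sqrt (det (gram \<phi> (\<psi> x))))"
    by (rule continuous_on_compose2[OF _ cpsi]) (auto simp: psi_phi)
  then show ?thesis
    by (rule continuous_on_eq) (auto simp: psi_phi vfactor_phi)
qed

lemma nn_integral_chart:
  fixes i0 :: 'm
  assumes f: "(\<lambda>x. f x * indicator (\<phi> ` U) x) \<in> borel_measurable borel"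
  shows "(\<integral>\<^sup>+x. f x * indicator (\<phi> ` U) x \<partial>density (hausdorff_measure (CARD('m) + 1)) (\<lambda>_. ennreal (metric_factor i0 TYPE('n)))) =
    (\<integral>\<^sup>+u. ennreal (J u) * f (\<phi> u) * indicator U u \<partial>lborel)"
proof (cases "U = {}")
  case False
  then obtain u0 where u0: "u0 \<in> U" by blast
  let ?\<beta> = "ennreal (metric_factor i0 TYPE('n))" and ?H = "hausdorff_measure (CARD('m) + 1) :: 'n heis measure"
  \<comment> \<open>\<open>distr\<close> takes a map measurable on the whole space. The constant
    value outside \<open>U\<close> is invisible to \<open>N\<close>, which vanishes there.\<close>
  define \<phi>' where "\<phi>' u = (if u \<in> U then \<phi> u else \<phi> u0)" for u
  have m: "\<phi>' \<in> borel_measurable borel"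
    unfolding \<phi>'_def
    using measurable_restrict_space_iff[of U borel "\<phi> u0" borel \<phi>] openU borel_measurable_continuous_on_restrict[OF cphi]
    by simp
  have "distr N borel \<phi>' = density ?H (\<lambda>x. ?\<beta> * indicator (\<phi> ` U) x)"
  proof (rule measure_eqI)
    fix A :: "'n heis set" assume "A \<in> sets (distr N borel \<phi>')"
    then have A: "A \<in> sets borel" by simp
    have mA: "\<phi>' -` A \<in> sets borel" using measurable_sets[OF m A] by simp
    have "emeasure (distr N borel \<phi>') A = emeasure N (\<phi>' -` A)"
      using m A by (simp add: emeasure_distr N_def)
    also have "\<dots> = emeasure N {u \<in> U. \<phi> u \<in> A \<inter> \<phi> ` U}"
      unfolding emeasure_N[OF mA] emeasure_N[OF borel_preimage[OF sets.Int[OF A borel_image]]]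
      by (intro nn_integral_cong) (auto simp: indicator_def \<phi>'_def)
    also have "\<dots> = ?\<beta> * spherical_hausdorff cc_dist (CARD('m) + 1) (A \<inter> \<phi> ` U)"
      by (rule area_formula) (use A borel_image in auto)
    also have "\<dots> = ?\<beta> * emeasure ?H (A \<inter> \<phi> ` U)"
      using A borel_image by (subst emeasure_hausdorff_measure) auto
    also have "\<dots> = emeasure (density ?H (\<lambda>x. ?\<beta> * indicator (\<phi> ` U) x)) A"
    proof -
      have mb: "A \<inter> \<phi> ` U \<in> sets ?H" using A borel_image by auto
      have mi: "(\<lambda>x. ?\<beta> * indicator (\<phi> ` U) x) \<in> borel_measurable ?H"
        using borel_image by (intro borel_measurable_times_ennreal borel_measurable_indicator) auto
      have "emeasure (density ?H (\<lambda>x. ?\<beta> * indicator (\<phi> ` U) x)) A = (\<integral>\<^sup>+x. (?\<beta> * indicator (\<phi> ` U) x) * indicator A x \<partial>?H)"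
        by (rule emeasure_density[OF mi]) (use A in simp)
      also have "\<dots> = (\<integral>\<^sup>+x. ?\<beta> * indicator (A \<inter> \<phi> ` U) x \<partial>?H)"
        by (intro nn_integral_cong) (auto simp: indicator_def)
      also have "\<dots> = ?\<beta> * emeasure ?H (A \<inter> \<phi> ` U)"
        by (rule nn_integral_cmult_indicator[OF mb])
      finally show ?thesis by simp
    qed
    finally show "emeasure (distr N borel \<phi>') A = emeasure (density ?H (\<lambda>x. ?\<beta> * indicator (\<phi> ` U) x)) A" .
  qed simp
  then have eq: "(\<integral>\<^sup>+x. f x * indicator (\<phi> ` U) x \<partial>distr N borel \<phi>') =
      (\<integral>\<^sup>+x. f x * indicator (\<phi> ` U) x \<partial>density ?H (\<lambda>x. ?\<beta> * indicator (\<phi> ` U) x))" by simp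
  have fH: "(\<lambda>x. f x * indicator (\<phi> ` U) x) \<in> borel_measurable ?H"
    using f by (simp add: measurable_def)
  have iH: "(\<lambda>x. ?\<beta> * indicator (\<phi> ` U) x) \<in> borel_measurable ?H"
    using borel_image by (intro borel_measurable_times_ennreal borel_measurable_indicator) auto
  have "(\<integral>\<^sup>+x. f x * indicator (\<phi> ` U) x \<partial>density ?H (\<lambda>x. ?\<beta> * indicator (\<phi> ` U) x)) =
      (\<integral>\<^sup>+x. (?\<beta> * indicator (\<phi> ` U) x) * (f x * indicator (\<phi> ` U) x) \<partial>?H)"
    by (rule nn_integral_density[OF iH fH])
  also have "\<dots> = (\<integral>\<^sup>+x. ?\<beta> * (f x * indicator (\<phi> ` U) x) \<partial>?H)"
    by (intro nn_integral_cong) (auto simp: indicator_def)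
  also have "\<dots> = (\<integral>\<^sup>+x. f x * indicator (\<phi> ` U) x \<partial>density ?H (\<lambda>_. ?\<beta>))"
    by (rule nn_integral_density[symmetric, OF _ fH]) simp
  finally have r: "(\<integral>\<^sup>+x. f x * indicator (\<phi> ` U) x \<partial>density ?H (\<lambda>x. ?\<beta> * indicator (\<phi> ` U) x)) =
      (\<integral>\<^sup>+x. f x * indicator (\<phi> ` U) x \<partial>density ?H (\<lambda>_. ?\<beta>))" .
  have m': "\<phi>' \<in> N \<rightarrow>\<^sub>M borel" using m by (simp add: N_def)
  have "(\<integral>\<^sup>+x. f x * indicator (\<phi> ` U) x \<partial>distr N borel \<phi>') = (\<integral>\<^sup>+u. f (\<phi>' u) * indicator (\<phi> ` U) (\<phi>' u) \<partial>N)"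
    by (rule nn_integral_distr[OF m']) (use f in simp)
  also have "\<dots> = (\<integral>\<^sup>+u. (ennreal (J u) * indicator U u) * (f (\<phi>' u) * indicator (\<phi> ` U) (\<phi>' u)) \<partial>lborel)"
    unfolding N_def
    by (rule nn_integral_density) (use measurable_J measurable_compose[OF m f] in simp_all)
  also have "\<dots> = (\<integral>\<^sup>+u. ennreal (J u) * f (\<phi> u) * indicator U u \<partial>lborel)"
    by (intro nn_integral_cong) (auto simp: indicator_def \<phi>'_def mult.assoc)
  finally show ?thesis using eq r by simp
qed simp

end

locale nonhorizontal_submanifold =
  fixes M :: "'n::finite heis set" and i0 :: "'m::finite"
  assumes sub: "submanifold TYPE('m) M" and nonhor: "non_horizontal M"
begin

lemma chartI: "local_param M U \<phi> \<Longrightarrow> nonhorizontal_chart M U \<phi>" for \<phi> :: "real^'m \<Rightarrow> 'n heis"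
  by (simp add: nonhorizontal_chart_def nonhorizontal_chart_axioms_def chart_def nonhor)

lemma borelM: "M \<in> sets borel"
proof -
  obtain \<C> where \<C>: "countable \<C>" "\<Union>\<C> = M"
    "\<And>C. C \<in> \<C> \<Longrightarrow> \<exists>U (\<phi> :: real^'m \<Rightarrow> 'n heis). local_param M U \<phi> \<and> C = \<phi> ` U"
    using submanifold_chart_cover[OF sub] by blast
  have "C \<in> sets borel" if "C \<in> \<C>" for C
    using \<C>(3)[OF that] nonhorizontal_chart.borel_image[OF chartI] by blast
  then have "\<Union>\<C> \<in> sets borel" using \<C>(1) by (intro sets.countable_Union) auto
  then show ?thesis by (simp add: \<C>(2))
qed

lemma vf_pos: "x \<in> M \<Longrightarrow> vfactor TYPE('m) M x > 0"
proof -
  assume "x \<in> M"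
  then obtain U and \<phi> :: "real^'m \<Rightarrow> 'n heis" where "local_param M U \<phi>" "x \<in> \<phi> ` U"
    using sub unfolding submanifold_def by blast
  then show ?thesis
    using nonhorizontal_chart.vfactor_pos[OF chartI] by blast
qed

lemma continuous_vf: "continuous_on M (vfactor TYPE('m) M)"
  unfolding continuous_on_eq_continuous_within
proof
  fix x assume x: "x \<in> M"
  then obtain U and \<phi> :: "real^'m \<Rightarrow> 'n heis" where c: "local_param M U \<phi>" "x \<in> \<phi> ` U"
    using sub unfolding submanifold_def by blast
  obtain W where W: "open W" "\<phi> ` U = M \<inter> W"
    using chart.chart_open[OF chart.intro[OF c(1)]] by blast
  have "continuous (at x within \<phi> ` U) (vfactor TYPE('m) M)"
    using nonhorizontal_chart.continuous_vfactor[OF chartI[OF c(1)]] c(2)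
    unfolding continuous_on_eq_continuous_within by blast
  moreover have "at x within \<phi> ` U = at x within M"
    by (rule at_within_nhd[of x W]) (use W c(2) in auto)
  ultimately show "continuous (at x within M) (vfactor TYPE('m) M)" by simp
qed

lemma measurable_vf: "vfactor TYPE('m) M \<in> borel_measurable (restrict_space borel M)"
  by (rule borel_measurable_continuous_on_restrict[OF continuous_vf])

definition \<beta> where "\<beta> = metric_factor i0 TYPE('n)"

definition H\<beta> where "H\<beta> = restrict_space (density (hausdorff_measure (CARD('m) + 1)) (\<lambda>_. ennreal \<beta>)) M"

definition vol where "vol = density H\<beta> (\<lambda>x. ennreal (1 / vfactor TYPE('m) M x))"

lemma sets_H\<beta>: "sets H\<beta> = sets (restrict_space borel M)"
  unfolding H\<beta>_def by (rule sets_restrict_space_cong) simp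

lemma sets_vol [simp]: "sets vol = sets (restrict_space borel M)"
  by (simp add: vol_def sets_H\<beta>)

lemma measurable_vf': "(\<lambda>x. ennreal (1 / vfactor TYPE('m) M x)) \<in> borel_measurable H\<beta>" "(\<lambda>x. ennreal (vfactor TYPE('m) M x)) \<in> borel_measurable H\<beta>"
proof -
  have "vfactor TYPE('m) M \<in> borel_measurable H\<beta>"
    using measurable_vf measurable_cong_sets[OF sets_H\<beta> refl] by blast
  then show "(\<lambda>x. ennreal (1 / vfactor TYPE('m) M x)) \<in> borel_measurable H\<beta>" "(\<lambda>x. ennreal (vfactor TYPE('m) M x)) \<in> borel_measurable H\<beta>"
    by measurable
qed

lemma sets_restrict: "A \<in> sets (restrict_space borel M) \<longleftrightarrow> A \<in> sets borel \<and> A \<subseteq> M"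
  using borelM by (auto simp: sets_restrict_space_iff)

text \<open>
  The area formula already shows that the charts agree on overlaps, so the volume can be defined by
  dividing the Hausdorff measure by \<open>vfactor\<close>, without changing variables between charts.
\<close>

lemma emeasure_vol_chart:
  fixes \<phi> :: "real^'m \<Rightarrow> 'n heis"
  assumes c: "local_param M U \<phi>" and A: "A \<in> sets borel" "A \<subseteq> \<phi> ` U"
  shows "emeasure vol A = (\<integral>\<^sup>+u\<in>{u \<in> U. \<phi> u \<in> A}. ennreal (sqrt (det (gram \<phi> u))) \<partial>lborel)"
proof -
  interpret C: nonhorizontal_chart M U \<phi> by (rule chartI[OF c])
  let ?D = "density (hausdorff_measure (CARD('m) + 1)) (\<lambda>_. ennreal \<beta>) :: 'n heis measure"
  have AM: "A \<subseteq> M" using A(2) C.imageM by blast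
  have MD: "M \<inter> space ?D \<in> sets ?D" using borelM by simp
  have fm: "(\<lambda>x. ennreal (1 / vfactor TYPE('m) M x) * indicator A x) \<in> borel_measurable borel"
  proof -
    have "(\<lambda>x. ennreal (1 / vfactor TYPE('m) M x)) \<in> borel_measurable (restrict_space borel M)"
      using measurable_vf by measurable
    then have "(\<lambda>x. ennreal (1 / vfactor TYPE('m) M x) * indicator A x) \<in> borel_measurable (restrict_space borel M)"
      by (intro borel_measurable_times_ennreal borel_measurable_indicator) (use A AM sets_restrict in auto)
    then have "(\<lambda>x. ennreal (1 / vfactor TYPE('m) M x) * indicator A x * indicator M x) \<in> borel_measurable borel"
      using borelM by (subst (asm) borel_measurable_restrict_space_iff_ennreal) auto
    moreover have "(\<lambda>x. ennreal (1 / vfactor TYPE('m) M x) * indicator A x * indicator M x) = (\<lambda>x. ennreal (1 / vfactor TYPE('m) M x) * indicator A x)"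
      using AM by (auto simp: indicator_def fun_eq_iff)
    ultimately show ?thesis by simp
  qed
  have ind: "(\<lambda>x. ennreal (1 / vfactor TYPE('m) M x) * indicator A x) = (\<lambda>x. (ennreal (1 / vfactor TYPE('m) M x) * indicator A x) * indicator (\<phi> ` U) x)"
    using A(2) by (auto simp: indicator_def fun_eq_iff)
  have "emeasure vol A = (\<integral>\<^sup>+x. ennreal (1 / vfactor TYPE('m) M x) * indicator A x \<partial>H\<beta>)"
    unfolding vol_def by (rule emeasure_density[OF measurable_vf'(1)]) (use A AM sets_H\<beta> sets_restrict in auto)
  also have "\<dots> = (\<integral>\<^sup>+x. (ennreal (1 / vfactor TYPE('m) M x) * indicator A x) * indicator M x \<partial>?D)"
    unfolding H\<beta>_def by (rule nn_integral_restrict_space[OF MD])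
  also have "\<dots> = (\<integral>\<^sup>+x. (ennreal (1 / vfactor TYPE('m) M x) * indicator A x) * indicator (\<phi> ` U) x \<partial>?D)"
    using A(2) AM by (intro nn_integral_cong) (auto simp: indicator_def)
  also have "\<dots> = (\<integral>\<^sup>+u. ennreal (C.J u) * (ennreal (1 / vfactor TYPE('m) M (\<phi> u)) * indicator A (\<phi> u)) * indicator U u \<partial>lborel)"
    unfolding \<beta>_def by (rule C.nn_integral_chart) (use fm ind in simp)
  also have "\<dots> = (\<integral>\<^sup>+u. ennreal (sqrt (det (gram \<phi> u))) * indicator {u \<in> U. \<phi> u \<in> A} u \<partial>lborel)"
  proof (intro nn_integral_cong)
    fix u
    show "ennreal (C.J u) * (ennreal (1 / vfactor TYPE('m) M (\<phi> u)) * indicator A (\<phi> u)) * indicator U u =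
        ennreal (sqrt (det (gram \<phi> u))) * indicator {u \<in> U. \<phi> u \<in> A} u"
    proof (cases "u \<in> U \<and> \<phi> u \<in> A")
      case True
      then have "C.J u * (1 / vfactor TYPE('m) M (\<phi> u)) = sqrt (det (gram \<phi> u))"
        using C.J_pos[of u] C.gram_pos[of u] by (simp add: C.vfactor_phi)
      then show ?thesis
        using True C.J_pos[of u] by (simp add: ennreal_mult'[symmetric])
    qed (auto simp: indicator_def)
  qed
  finally show ?thesis .
qed

lemma riemannian_volume_eq: "riemannian_volume TYPE('m) M = vol"
  unfolding riemannian_volume_def
proof (rule the_equality)
  show "sets vol = sets (restrict_space borel M) \<and>
     (\<forall>U (\<phi> :: real ^ 'm \<Rightarrow> 'n heis) A. local_param M U \<phi> \<longrightarrow> A \<in> sets borel \<longrightarrow> A \<subseteq> \<phi> ` U \<longrightarrow>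
        emeasure vol A = (\<integral>\<^sup>+u\<in>{u \<in> U. \<phi> u \<in> A}. ennreal (sqrt (det (gram \<phi> u))) \<partial>lborel))"
    using emeasure_vol_chart by simp
next
  fix \<nu> assume \<nu>: "sets \<nu> = sets (restrict_space borel M) \<and>
     (\<forall>U (\<phi> :: real ^ 'm \<Rightarrow> 'n heis) A. local_param M U \<phi> \<longrightarrow> A \<in> sets borel \<longrightarrow> A \<subseteq> \<phi> ` U \<longrightarrow>
        emeasure \<nu> A = (\<integral>\<^sup>+u\<in>{u \<in> U. \<phi> u \<in> A}. ennreal (sqrt (det (gram \<phi> u))) \<partial>lborel))"
  obtain \<C> where \<C>: "countable \<C>" "\<Union>\<C> = M"
    "\<And>C. C \<in> \<C> \<Longrightarrow> \<exists>U (\<phi> :: real^'m \<Rightarrow> 'n heis). local_param M U \<phi> \<and> C = \<phi> ` U"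
    using submanifold_chart_cover[OF sub] by blast
  show "\<nu> = vol"
  proof (rule measure_eqI_countable_cover[OF _ \<C>(1)])
    show "sets \<nu> = sets vol" using \<nu> by simp
    have "C \<in> sets borel" if "C \<in> \<C>" for C
      using \<C>(3)[OF that] nonhorizontal_chart.borel_image[OF chartI] by blast
    then show "\<C> \<subseteq> sets \<nu>" using \<nu> \<C>(2) sets_restrict by blast
    have "space \<nu> = space (restrict_space borel M)"
      using \<nu> by (intro sets_eq_imp_space_eq) simp
    then show "\<Union>\<C> = space \<nu>" using \<C>(2) by (simp add: space_restrict_space)
    fix C A assume C: "C \<in> \<C>" and A: "A \<in> sets \<nu>" "A \<subseteq> C"
    obtain U and \<phi> :: "real^'m \<Rightarrow> 'n heis" where c: "local_param M U \<phi>" "C = \<phi> ` U"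
      using \<C>(3)[OF C] by blast
    have Ab: "A \<in> sets borel" using A(1) \<nu> sets_restrict by blast
    have As: "A \<subseteq> \<phi> ` U" using A(2) c(2) by simp
    have "emeasure \<nu> A = (\<integral>\<^sup>+u\<in>{u \<in> U. \<phi> u \<in> A}. ennreal (sqrt (det (gram \<phi> u))) \<partial>lborel)"
      using \<nu> c(1) Ab As by blast
    also have "\<dots> = emeasure vol A" by (rule emeasure_vol_chart[OF c(1) Ab As, symmetric])
    finally show "emeasure \<nu> A = emeasure vol A" .
  qed
qed

lemma emeasure_mu:
  assumes A: "A \<in> sets (restrict_space borel M)"
  shows "emeasure (mu TYPE('m) (CARD('m) + 1) M) A = ennreal \<beta> * spherical_hausdorff cc_dist (CARD('m) + 1) A"
proof -
  let ?D = "density (hausdorff_measure (CARD('m) + 1)) (\<lambda>_. ennreal \<beta>) :: 'n heis measure"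
  have Ab: "A \<in> sets borel" "A \<subseteq> M" using A sets_restrict by auto
  have MD: "M \<inter> space ?D \<in> sets ?D" using borelM by simp
  have AH: "A \<in> sets H\<beta>" using A sets_H\<beta> by simp
  have sp: "space H\<beta> = M" using borelM by (simp add: H\<beta>_def space_restrict_space)
  have "mu TYPE('m) (CARD('m) + 1) M = density vol (\<lambda>x. ennreal (vfactor TYPE('m) M x))"
    by (simp add: mu_def riemannian_volume_eq vfactor_def)
  also have "\<dots> = density H\<beta> (\<lambda>x. ennreal (1 / vfactor TYPE('m) M x) * ennreal (vfactor TYPE('m) M x))"
    unfolding vol_def by (rule density_density_eq[OF measurable_vf'])
  finally have "emeasure (mu TYPE('m) (CARD('m) + 1) M) A = emeasure (density H\<beta> (\<lambda>x. ennreal (1 / vfactor TYPE('m) M x) * ennreal (vfactor TYPE('m) M x))) A"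
    by simp
  also have "\<dots> = (\<integral>\<^sup>+x. (ennreal (1 / vfactor TYPE('m) M x) * ennreal (vfactor TYPE('m) M x)) * indicator A x \<partial>H\<beta>)"
    by (rule emeasure_density[OF _ AH]) (use measurable_vf' in measurable)
  also have "\<dots> = (\<integral>\<^sup>+x. indicator A x \<partial>H\<beta>)"
  proof (rule nn_integral_cong)
    fix x assume "x \<in> space H\<beta>"
    then have "vfactor TYPE('m) M x > 0" using vf_pos sp by simp
    then show "(ennreal (1 / vfactor TYPE('m) M x) * ennreal (vfactor TYPE('m) M x)) * indicator A x = indicator A x"
      by (simp add: ennreal_mult'[symmetric])
  qed
  also have "\<dots> = emeasure H\<beta> A" using AH by simp
  also have "\<dots> = emeasure ?D A"
    unfolding H\<beta>_def by (rule emeasure_restrict_space[OF MD Ab(2)])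
  also have "\<dots> = (\<integral>\<^sup>+x. ennreal \<beta> * indicator A x \<partial>hausdorff_measure (CARD('m) + 1))"
    by (rule emeasure_density) (use Ab in auto)
  also have "\<dots> = ennreal \<beta> * emeasure (hausdorff_measure (CARD('m) + 1)) A"
    by (rule nn_integral_cmult_indicator) (use Ab in simp)
  also have "\<dots> = ennreal \<beta> * spherical_hausdorff cc_dist (CARD('m) + 1) A"
    by (subst emeasure_hausdorff_measure[OF _ Ab(1)]) simp_all
  finally show ?thesis .
qed

end

text \<open>The constant is chosen before \<open>M\<close>, so its positivity must come from
  dimensions alone: the bound on \<open>CARD('m)\<close> leaves room for a horizontal subspace of
  dimension \<open>CARD('m) - 1\<close>, and with \<open>eT\<close> it spans a vertical one.\<close>

lemma metric_factor_pos:
  assumes "CARD('m::finite) \<le> 2 * CARD('n::finite) + 1"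
  shows "metric_factor (i0 :: 'm) TYPE('n) > 0"
proof -
  have "dim {x :: 'n heis. x $ iT = 0} = 2 * CARD('n)"
  proof -
    have "(eT :: 'n heis) \<noteq> 0" using norm_eT[where 'n = 'n] by (metis norm_zero zero_neq_one)
    from dim_hyperplane[OF this] show ?thesis by simp
  qed
  then have "CARD('m) - 1 \<le> dim {x :: 'n heis. x $ iT = 0}" using assms by simp
  then obtain N :: "'n heis set" where N: "subspace N" "N \<subseteq> span {x. x $ iT = 0}" "dim N = CARD('m) - 1"
    by (rule choose_subspace_of_subspace)
  have "subspace {x :: 'n heis. x $ iT = 0}" by (simp add: subspace_def)
  then have "x $ iT = 0" if "x \<in> N" for x using N(2) that by (auto simp: span_eq_iff[THEN iffD2])
  then obtain \<Theta> :: "real^'m \<Rightarrow> 'n heis" where "vert_iso i0 \<Theta>"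
    using vert_iso_exists[OF N(1) _ N(3)] by metis
  then show ?thesis
    using metric_factor_eq sup_area_pos by metis
qed

theorem theorem3:
  fixes p :: nat
  assumes "CARD('m::finite) + p = 2 * CARD('n::finite) + 1"
  shows "\<exists>c>0. \<forall>M :: 'n heis set. submanifold TYPE('m) M \<and> non_horizontal M \<longrightarrow>
    (\<forall>A \<in> sets (restrict_space borel M).
      emeasure (mu TYPE('m) (2 * CARD('n) + 2 - p) M) A =
        ennreal c * spherical_hausdorff cc_dist (2 * CARD('n) + 2 - p) A)"
proof -
  obtain i0 :: 'm where True by simp
  have d: "2 * CARD('n) + 2 - p = CARD('m) + 1" using assms by simp
  show ?thesis
    unfolding d
  proof (intro exI[of _ "metric_factor i0 TYPE('n)"] conjI allI impI ballI)
    show "metric_factor i0 TYPE('n) > 0"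
      using assms by (intro metric_factor_pos) simp
    fix M :: "'n heis set" and A
    assume M: "submanifold TYPE('m) M \<and> non_horizontal M" and A: "A \<in> sets (restrict_space borel M)"
    interpret nonhorizontal_submanifold M i0
      using M by unfold_locales auto
    show "emeasure (mu TYPE('m) (CARD('m) + 1) M) A =
        ennreal (metric_factor i0 TYPE('n)) * spherical_hausdorff cc_dist (CARD('m) + 1) A"
      using emeasure_mu[OF A] by (simp add: \<beta>_def)
  qed
qed

end
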